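(* Let $\Gamma$ be a finitely generated group with the outer commensurator-normalizer property. Then any (finite-dimensional) linear representation of $\Gamma$ over a field of positive characteristic has finite image.
   Context: Groups are countable. Two subgroups of a group are commensurable if their intersection has finite index in both. A subgroup $\Lambda$ of a group $\Delta$ is commensurated by a subgroup $\Gamma'\le\Delta$ if $\gamma\Lambda\gamma^{-1}$ is commensurable with $\Lambda$ for every $\gamma\in\Gamma'$. A group $\Gamma$ has the outer commensurator-normalizer property if for any group $\Delta$ and any homomorphism $\varphi:\Gamma\to\Delta$, for any subgroup $\Lambda<\Delta$ which is commensurated by $\varphi(\Gamma)$ there is a subgroup of $\Delta$ commensurable with $\Lambda$ which is normalized by $\varphi(\Gamma)$. *)

theory Defs
  imports "HOL-Algebra.Algebra" "HOL-Library.Countable_Set"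
begin

definition finitely_generated_group :: "('a, 'b) monoid_scheme \<Rightarrow> bool" where
  "finitely_generated_group G \<longleftrightarrow>
     group G \<and> (\<exists>S. finite S \<and> S \<subseteq> carrier G \<and> generate G S = carrier G)"

text \<open>The right cosets below are formed inside the subgroup \<open>H\<close>, so this says that the
  index \<open>[H : K]\<close> is finite; it is meant for subgroups \<open>K \<subseteq> H\<close> of \<open>G\<close>.\<close>

definition finite_index :: "('a, 'b) monoid_scheme \<Rightarrow> 'a set \<Rightarrow> 'a set \<Rightarrow> bool" where
  "finite_index G H K \<longleftrightarrow> finite (rcosets\<^bsub>G\<lparr>carrier := H\<rparr>\<^esub> K)"

definition commensurable :: "('a, 'b) monoid_scheme \<Rightarrow> 'a set \<Rightarrow> 'a set \<Rightarrow> bool" where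
  "commensurable G H K \<longleftrightarrow>
     subgroup H G \<and> subgroup K G \<and> finite_index G H (H \<inter> K) \<and> finite_index G K (H \<inter> K)"

definition commensurated_by :: "('a, 'b) monoid_scheme \<Rightarrow> 'a set \<Rightarrow> 'a set \<Rightarrow> bool" where
  "commensurated_by G L C \<longleftrightarrow>
     (\<forall>g\<in>C. commensurable G (g <#\<^bsub>G\<^esub> L #>\<^bsub>G\<^esub> inv\<^bsub>G\<^esub> g) L)"

text \<open>All groups are meant to be countable. Every countable group is isomorphic to one whose
  carrier is a set of natural numbers, so letting \<open>D\<close> range over type \<^typ>\<open>nat monoid\<close> loses
  nothing; \<open>outer_commensurator_normalizerD\<close> below gives the property for
  countable groups over an arbitrary type.\<close>

definition outer_commensurator_normalizer :: "('a, 'b) monoid_scheme \<Rightarrow> bool" where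
  "outer_commensurator_normalizer G \<longleftrightarrow>
     (\<forall>(D :: nat monoid) \<phi> L.
        group D \<longrightarrow> \<phi> \<in> hom G D \<longrightarrow> subgroup L D \<longrightarrow> commensurated_by D L (\<phi> ` carrier G) \<longrightarrow>
        (\<exists>M. subgroup M D \<and> commensurable D M L \<and> \<phi> ` carrier G \<subseteq> normalizer D M))"

definition general_linear_group :: "('k::field \<Rightarrow> 'v::ab_group_add \<Rightarrow> 'v) \<Rightarrow> ('v \<Rightarrow> 'v) monoid" where
  "general_linear_group scale =
     \<lparr>carrier = {f. Vector_Spaces.linear scale scale f \<and> bij f}, monoid.mult = (\<circ>), one = id\<rparr>"

lemma group_general_linear_group:
  assumes "vector_space scale"
  shows "group (general_linear_group scale)"
proof -
  interpret vector_space scale by fact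
  interpret vector_space_pair scale scale by unfold_locales
  show ?thesis
  proof (rule groupI)
    fix f assume f: "f \<in> carrier (general_linear_group scale)"
    then have "Vector_Spaces.linear scale scale (inv_into UNIV f)"
      unfolding general_linear_group_def Vector_Spaces.linear_iff
      by (auto simp: vector_space_axioms bij_def surj_f_inv_f intro!: inv_f_eq)
    with f show "\<exists>g\<in>carrier (general_linear_group scale).
       g \<otimes>\<^bsub>general_linear_group scale\<^esub> f = \<one>\<^bsub>general_linear_group scale\<^esub>"
      by (intro bexI[of _ "inv_into UNIV f"])
         (auto simp: general_linear_group_def bij_imp_bij_inv dest: bij_is_inj)
  qed (auto simp: general_linear_group_def comp_assoc bij_comp Vector_Spaces.linear_iff vector_space_axioms)
qed

lemma hom_image_conjugate:
  assumes "group G" "group D" "h \<in> hom G D" "L \<subseteq> carrier G" "g \<in> carrier G"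
  shows "h ` (g <#\<^bsub>G\<^esub> L #>\<^bsub>G\<^esub> inv\<^bsub>G\<^esub> g) = h g <#\<^bsub>D\<^esub> h ` L #>\<^bsub>D\<^esub> inv\<^bsub>D\<^esub> h g"
proof -
  interpret group_hom G D h using assms by (simp add: group_hom_def group_hom_axioms_def)
  have *: "h (g \<otimes>\<^bsub>G\<^esub> x \<otimes>\<^bsub>G\<^esub> inv\<^bsub>G\<^esub> g) = h g \<otimes>\<^bsub>D\<^esub> h x \<otimes>\<^bsub>D\<^esub> inv\<^bsub>D\<^esub> h g" if "x \<in> L" for x
    using that assms(4,5) by (auto simp: subset_iff)
  have "h ` (g <#\<^bsub>G\<^esub> L #>\<^bsub>G\<^esub> inv\<^bsub>G\<^esub> g) = (\<lambda>x. h (g \<otimes>\<^bsub>G\<^esub> x \<otimes>\<^bsub>G\<^esub> inv\<^bsub>G\<^esub> g)) ` L"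
    unfolding l_coset_def r_coset_def by auto
  also have "\<dots> = (\<lambda>x. h g \<otimes>\<^bsub>D\<^esub> h x \<otimes>\<^bsub>D\<^esub> inv\<^bsub>D\<^esub> h g) ` L"
    using * by (rule image_cong[OF refl])
  also have "\<dots> = h g <#\<^bsub>D\<^esub> h ` L #>\<^bsub>D\<^esub> inv\<^bsub>D\<^esub> h g"
    unfolding l_coset_def r_coset_def by auto
  finally show ?thesis .
qed

lemma finite_index_image:
  assumes "h \<in> hom G D" "H \<subseteq> carrier G" "K \<subseteq> H" "finite_index G H K"
  shows "finite_index D (h ` H) (h ` K)"
proof -
  have *: "h (k \<otimes>\<^bsub>G\<^esub> x) = h k \<otimes>\<^bsub>D\<^esub> h x" if "x \<in> H" "k \<in> K" for k x
    using assms(1-3) that by (auto simp: hom_def subset_iff)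
  have "rcosets\<^bsub>D\<lparr>carrier := h ` H\<rparr>\<^esub> (h ` K) \<subseteq> (`) h ` (rcosets\<^bsub>G\<lparr>carrier := H\<rparr>\<^esub> K)"
  proof
    fix C assume "C \<in> rcosets\<^bsub>D\<lparr>carrier := h ` H\<rparr>\<^esub> (h ` K)"
    then obtain x where x: "x \<in> H" "C = (\<lambda>k. h k \<otimes>\<^bsub>D\<^esub> h x) ` K"
      unfolding RCOSETS_def r_coset_def by (auto simp: UNION_singleton_eq_range image_image)
    have "C = h ` ((\<lambda>k. k \<otimes>\<^bsub>G\<^esub> x) ` K)"
      unfolding x(2) image_image using * x(1) by (intro image_cong) auto
    with x(1) show "C \<in> (`) h ` (rcosets\<^bsub>G\<lparr>carrier := H\<rparr>\<^esub> K)"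
      unfolding RCOSETS_def r_coset_def by (auto simp: UNION_singleton_eq_range)
  qed
  with assms(4) show ?thesis
    unfolding finite_index_def by (meson finite_imageI finite_subset)
qed

lemma commensurable_image:
  assumes "group G" "group D" "h \<in> iso G D" "commensurable G H K"
  shows "commensurable D (h ` H) (h ` K)"
proof -
  interpret group_hom G D h using assms by (simp add: group_hom_def group_hom_axioms_def iso_def)
  have sub: "subgroup H G" "subgroup K G" using assms(4) by (auto simp: commensurable_def)
  then have "H \<subseteq> carrier G" "K \<subseteq> carrier G" by (auto dest: subgroup.subset)
  moreover from this have "h ` H \<inter> h ` K = h ` (H \<inter> K)"
    using assms(3) inj_on_image_Int[of h "carrier G" H K] by (auto simp: iso_def bij_betw_def)
  ultimately show ?thesis
    using assms(4) finite_index_image[OF homh] subgroup_img_is_subgroup[OF sub(1)]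
      subgroup_img_is_subgroup[OF sub(2)]
    unfolding commensurable_def by auto
qed

lemma (in group) mem_normalizer_iff:
  assumes "M \<subseteq> carrier G"
  shows "g \<in> normalizer G M \<longleftrightarrow> g \<in> carrier G \<and> g <# M #> inv g = M"
  using assms by (auto simp: normalizer_def stabilizer_def)

lemma outer_commensurator_normalizerD:
  fixes D :: "'d monoid"
  assumes "outer_commensurator_normalizer G" "group D" "countable (carrier D)"
    and "\<phi> \<in> hom G D" "subgroup L D" "commensurated_by D L (\<phi> ` carrier G)"
  shows "\<exists>M. subgroup M D \<and> commensurable D M L \<and> \<phi> ` carrier G \<subseteq> normalizer D M"
proof -
  interpret D: group D by fact
  define h where "h = to_nat_on (carrier D)"
  define E where "E = image_group h D"
  have inj: "inj_on h (carrier D)" unfolding h_def using assms(3) by (rule inj_on_to_nat_on)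
  have hom: "h \<in> hom D E"
    using inj by (auto simp: E_def image_group_def hom_def)
  have iso: "h \<in> iso D E"
    using hom inj by (auto simp: iso_def bij_betw_def E_def image_group_def)
  have grpE: "group E"
    using D.iso_imp_img_group[OF iso] by (simp add: E_def image_group_def)
  interpret E: group E by fact
  interpret h: group_hom D E h using hom by unfold_locales
  define h' where "h' = inv_into (carrier D) h"
  have iso': "h' \<in> iso E D" unfolding h'_def using D.iso_set_sym[OF iso] .
  have hom': "h' \<in> hom E D" using iso' by (simp add: iso_def)
  interpret h': group_hom E D h' using hom' by unfold_locales
  have h'h: "h' (h x) = x" if "x \<in> carrier D" for x
    unfolding h'_def using inj that by simp
  have h'h_set: "h' ` h ` A = A" if "A \<subseteq> carrier D" for A
    unfolding h'_def using inj that by simp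
  have L: "L \<subseteq> carrier D" using assms(5) by (rule subgroup.subset)
  have \<phi>: "\<phi> x \<in> carrier D" if "x \<in> carrier G" for x using assms(4) that by (auto simp: hom_def)
  have "commensurated_by E (h ` L) ((h \<circ> \<phi>) ` carrier G)"
    unfolding commensurated_by_def
  proof
    fix e assume "e \<in> (h \<circ> \<phi>) ` carrier G"
    then obtain x where x: "x \<in> carrier G" "e = h (\<phi> x)" by auto
    have "commensurable D (\<phi> x <#\<^bsub>D\<^esub> L #>\<^bsub>D\<^esub> inv\<^bsub>D\<^esub> \<phi> x) L"
      using assms(6) x(1) by (simp add: commensurated_by_def)
    from commensurable_image[OF assms(2) grpE iso this]
    show "commensurable E (e <#\<^bsub>E\<^esub> (h ` L) #>\<^bsub>E\<^esub> inv\<^bsub>E\<^esub> e) (h ` L)"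
      using hom_image_conjugate[OF assms(2) grpE hom L \<phi>[OF x(1)]] x(2) by simp
  qed
  moreover have "h \<circ> \<phi> \<in> hom G E" using hom_compose[OF assms(4) hom] .
  moreover have "subgroup (h ` L) E" using h.subgroup_img_is_subgroup[OF assms(5)] .
  ultimately obtain M where M: "subgroup M E" "commensurable E M (h ` L)"
      "(h \<circ> \<phi>) ` carrier G \<subseteq> normalizer E M"
    using assms(1) grpE unfolding outer_commensurator_normalizer_def by blast
  have ME: "M \<subseteq> carrier E" using M(1) by (rule subgroup.subset)
  have sub: "subgroup (h' ` M) D" using h'.subgroup_img_is_subgroup[OF M(1)] .
  moreover have "commensurable D (h' ` M) L"
    using commensurable_image[OF grpE assms(2) iso' M(2)] h'h_set[OF L] by simp
  moreover have "\<phi> ` carrier G \<subseteq> normalizer D (h' ` M)"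
  proof
    fix d assume "d \<in> \<phi> ` carrier G"
    then obtain x where x: "x \<in> carrier G" "d = \<phi> x" by auto
    have "h d \<in> normalizer E M" using M(3) x by auto
    then have e: "h d \<in> carrier E" "h d <#\<^bsub>E\<^esub> M #>\<^bsub>E\<^esub> inv\<^bsub>E\<^esub> h d = M"
      using E.mem_normalizer_iff[OF ME] by auto
    have d: "d \<in> carrier D" using \<phi> x by simp
    have "d <#\<^bsub>D\<^esub> (h' ` M) #>\<^bsub>D\<^esub> inv\<^bsub>D\<^esub> d = h' ` M"
      using hom_image_conjugate[OF grpE assms(2) hom' ME e(1)] e(2) h'h[OF d] by simp
    with d show "d \<in> normalizer D (h' ` M)"
      using D.mem_normalizer_iff[OF subgroup.subset[OF sub]] by blast
  qed
  ultimately show ?thesis by blast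
qed

end

theory Submission
  imports Defs "HOL-Algebra.Algebraic_Closure_Type" "HOL-Library.Function_Algebras"
    "HOL-Computational_Algebra.Formal_Laurent_Series" "Jordan_Normal_Form.Char_Poly"
begin

text \<open>The matrix coefficients span a finite-dimensional space of functions on \<open>\<Gamma>\<close> with values
  in the algebraic closure, and it suffices that every vector there has finite orbit under
  translation. If not, one passes to an irreducible subquotient. The finitely many coefficients needed generate a
  subring which embeds into the algebraic closure of the local field \<open>F\<^sub>p((X))\<close>, and if some element of
  the group had an eigenvalue transcendental over \<open>F\<^sub>p\<close>, the embedding could be chosen to send it to
  \<open>X\<^sup>-\<^sup>1\<close>. A lattice over \<open>F\<^sub>p[[X]]\<close> is commensurated by the group, so the hypothesis on \<open>\<Gamma>\<close>
  yields an invariant subgroup commensurable with it; that subgroup is bounded, which excludes the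
  eigenvalue \<open>X\<^sup>-\<^sup>1\<close>. Hence all eigenvalues are algebraic over \<open>F\<^sub>p\<close>, so the
  traces are algebraic elements of a finitely generated domain and there are only finitely many of
  them. By the argument of Burnside and Schur the irreducible subquotient then has finite image,
  and finite generation carries finiteness through extensions.\<close>

section \<open>Commensurated subgroups of additive groups\<close>

text \<open>Two obstacles shape the construction. The property assumed of the group speaks of
  countable groups, while a vector space over Laurent series is uncountable; the lattice is
  therefore cut out of the countable additive group generated by the orbits of the vectors
  \<open>scale (fls_X ^ k) v\<close>. And the matrix entries live in an algebraic extension of the
  local field, to which the valuation would have to be extended; instead scalars are restricted: the
  entries act on a finite-dimensional space over the Laurent series, so that only orders of Laurent
  series occur. Finiteness of the prime field leaves finitely many possible polar parts of bounded
  order, which makes the lattice commensurated. The eigenvalue is sent to an element of negative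
  order because a bounded group that meets a line nontrivially cannot be stable under a map
  multiplying that line by such an element. Functions on the group serve as extension of scalars:
  with values in the algebraic closure they form a vector space at once, whereas the given space
  would have to be tensored. Finiteness of the prime field returns at the end, where it makes
  finitely generated additive groups finite.\<close>

lemma countable_finitely_generated_group:
  fixes G (structure)
  assumes "finitely_generated_group G"
  shows "countable (carrier G)"
proof -
  interpret group G using assms by (simp add: finitely_generated_group_def)
  obtain S where S: "finite S" "S \<subseteq> carrier G" "generate G S = carrier G"
    using assms by (auto simp: finitely_generated_group_def)
  define T where "T = S \<union> m_inv G ` S"
  have T: "T \<subseteq> carrier G" "countable T"
    using S by (auto simp: T_def countable_finite)
  have "carrier G \<subseteq> (\<lambda>xs. foldr (\<otimes>) xs \<one>) ` lists T"
  proof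
    have append: "foldr (\<otimes>) (xs @ ys) \<one> = foldr (\<otimes>) xs \<one> \<otimes> foldr (\<otimes>) ys \<one>"
      and closed: "foldr (\<otimes>) xs \<one> \<in> carrier G"
      if "xs \<in> lists T" "ys \<in> lists T" for xs ys
    proof -
      have c: "foldr (\<otimes>) zs \<one> \<in> carrier G" if "zs \<in> lists T" for zs
        using that T by (induction zs) auto
      show "foldr (\<otimes>) xs \<one> \<in> carrier G" using c that by auto
      show "foldr (\<otimes>) (xs @ ys) \<one> = foldr (\<otimes>) xs \<one> \<otimes> foldr (\<otimes>) ys \<one>"
        using that T c by (induction xs) (auto simp: m_assoc subset_iff)
    qed
    fix x assume "x \<in> carrier G"
    then have "x \<in> generate G S" using S by simp
    then show "x \<in> (\<lambda>xs. foldr (\<otimes>) xs \<one>) ` lists T"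
    proof (induction rule: generate.induct)
      case one
      show ?case by (intro image_eqI[of _ _ "[]"]) auto
    next
      case (incl h)
      then show ?case using S by (intro image_eqI[of _ _ "[h]"]) (auto simp: T_def)
    next
      case (inv h)
      then show ?case using S by (intro image_eqI[of _ _ "[inv h]"]) (auto simp: T_def)
    next
      case (eng h1 h2)
      then obtain xs ys where "xs \<in> lists T" "ys \<in> lists T"
        "h1 = foldr (\<otimes>) xs \<one>" "h2 = foldr (\<otimes>) ys \<one>" by auto
      then show ?case using append by (intro image_eqI[of _ _ "xs @ ys"]) auto
    qed
  qed
  then show ?thesis
    using T by (meson countable_image countable_lists countable_subset)
qed

text \<open>The induction rule has no inverse step: properties proved with it, such as membership of
  matrix entries in a subring, do not visibly pass to inverses. The inverses of generators are made
  generators instead.\<close>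

lemma generating_set_closed_under_inverse:
  fixes G (structure)
  assumes "finitely_generated_group G"
  obtains S where "finite S" "S \<subseteq> carrier G"
    and "\<And>P x. x \<in> carrier G \<Longrightarrow> P \<one> \<Longrightarrow> (\<And>s. s \<in> S \<Longrightarrow> P s) \<Longrightarrow>
      (\<And>x y. x \<in> carrier G \<Longrightarrow> y \<in> carrier G \<Longrightarrow> P x \<Longrightarrow> P y \<Longrightarrow> P (x \<otimes> y)) \<Longrightarrow> P x"
proof -
  interpret group G using assms by (simp add: finitely_generated_group_def)
  obtain S where S: "finite S" "S \<subseteq> carrier G" "generate G S = carrier G"
    using assms by (auto simp: finitely_generated_group_def)
  show ?thesis
  proof (rule that[of "S \<union> m_inv G ` S"])
    fix P x
    assume x: "x \<in> carrier G" and "P \<one>" "\<And>s. s \<in> S \<union> m_inv G ` S \<Longrightarrow> P s"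
      "\<And>x y. x \<in> carrier G \<Longrightarrow> y \<in> carrier G \<Longrightarrow> P x \<Longrightarrow> P y \<Longrightarrow> P (x \<otimes> y)"
    from x have "x \<in> generate G S" using S by simp
    then show "P x"
    proof (induction rule: generate.induct)
      case (eng h1 h2)
      then show ?case using \<open>\<And>x y. _ \<Longrightarrow> _ \<Longrightarrow> P x \<Longrightarrow> P y \<Longrightarrow> P (x \<otimes> y)\<close> S by auto
    qed (use \<open>P \<one>\<close> \<open>\<And>s. s \<in> S \<union> m_inv G ` S \<Longrightarrow> P s\<close> in auto)
  qed (use S in auto)
qed

section \<open>Counting cosets by labels with finitely many values\<close>

lemma finite_image_factor:
  assumes "finite (f ` A)" "\<And>x y. x \<in> A \<Longrightarrow> y \<in> A \<Longrightarrow> f x = f y \<Longrightarrow> F x = F y"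
  shows "finite (F ` A)"
proof -
  have "F x = F (inv_into A f (f x))" if "x \<in> A" for x
    using assms(2)[OF that inv_into_into[of "f x" f A]] that by (simp add: f_inv_into_f)
  then have "F ` A \<subseteq> (\<lambda>c. F (inv_into A f c)) ` f ` A" by blast
  with assms(1) show ?thesis by (meson finite_imageI finite_subset)
qed

text \<open>\<open>A\<close> meets only finitely many cosets of \<open>L\<close>, witnessed by a
  labelling whose fibres each lie in one coset; this avoids quotients and does not ask that
  \<open>L\<close> be contained in \<open>A\<close>. The labels are sets because a definition cannot
  quantify over a type of labels; \<open>finitely_many_cosetsI\<close> turns arbitrary labels into
  their fibres.\<close>

definition finitely_many_cosets :: "'a::ab_group_add set \<Rightarrow> 'a set \<Rightarrow> bool" where
  "finitely_many_cosets A L \<longleftrightarrow>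
     (\<exists>f :: 'a \<Rightarrow> 'a set. finite (f ` A) \<and> (\<forall>x\<in>A. \<forall>y\<in>A. f x = f y \<longrightarrow> x - y \<in> L))"

lemma finitely_many_cosetsI:
  fixes f :: "'a::ab_group_add \<Rightarrow> 'c"
  assumes "finite (f ` A)" "\<And>x y. x \<in> A \<Longrightarrow> y \<in> A \<Longrightarrow> f x = f y \<Longrightarrow> x - y \<in> L"
  shows "finitely_many_cosets A L"
  unfolding finitely_many_cosets_def
proof (intro exI[of _ "\<lambda>x. {y \<in> A. f y = f x}"] conjI ballI impI)
  have "(\<lambda>x. {y \<in> A. f y = f x}) ` A = (\<lambda>c. {y \<in> A. f y = c}) ` f ` A" by auto
  with assms(1) show "finite ((\<lambda>x. {y \<in> A. f y = f x}) ` A)" by simp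
qed (use assms(2) in blast)

text \<open>The coset of \<open>x\<close> modulo \<open>H \<inter> K\<close> inside \<open>H\<close>
  consists of those \<open>y\<close> in \<open>H\<close> for which \<open>y\<close> times the
  inverse of \<open>x\<close> lies in \<open>K\<close>. In this form it becomes a condition on
  differences once the group is additive.\<close>

lemma finite_index_iff:
  fixes D (structure)
  assumes "group D" "subgroup H D" "subgroup K D"
  shows "finite_index D H (H \<inter> K) \<longleftrightarrow>
    finite ((\<lambda>x. {y \<in> H. y \<otimes>\<^bsub>D\<^esub> inv\<^bsub>D\<^esub> x \<in> K}) ` H)"
proof -
  interpret group D by fact
  have HD: "H \<subseteq> carrier D" "K \<subseteq> carrier D" using assms subgroup.subset by auto
  have "rcosets\<^bsub>D\<lparr>carrier := H\<rparr>\<^esub> (H \<inter> K) = (\<lambda>x. {y \<in> H. y \<otimes> inv x \<in> K}) ` H"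
  proof -
    have "(\<Union>h\<in>H \<inter> K. {h \<otimes> x}) = {y \<in> H. y \<otimes> inv x \<in> K}" if x: "x \<in> H" for x
    proof (intro equalityI subsetI)
      fix y assume "y \<in> (\<Union>h\<in>H \<inter> K. {h \<otimes> x})"
      then obtain h where h: "h \<in> H" "h \<in> K" "y = h \<otimes> x" by auto
      then have "y \<otimes> inv x = h" using x HD by (simp add: m_assoc subset_iff)
      with h x show "y \<in> {y \<in> H. y \<otimes> inv x \<in> K}"
        using assms(2) by (auto intro: subgroup.m_closed)
    next
      fix y assume y: "y \<in> {y \<in> H. y \<otimes> inv x \<in> K}"
      then have "y = (y \<otimes> inv x) \<otimes> x" using x HD by (auto simp: m_assoc subset_iff)
      moreover have "y \<otimes> inv x \<in> H" using y x assms(2)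
        by (auto intro: subgroup.m_closed subgroup.m_inv_closed)
      ultimately show "y \<in> (\<Union>h\<in>H \<inter> K. {h \<otimes> x})" using y by blast
    qed
    then show ?thesis
      unfolding RCOSETS_def r_coset_def by auto
  qed
  then show ?thesis unfolding finite_index_def by simp
qed

text \<open>The property is applied to the semidirect product of the additive group \<open>V\<close> with \<open>G\<close>.\<close>

lemma commensurated_additive_subgroup:
  fixes G (structure) and act :: "'g \<Rightarrow> 'v::ab_group_add \<Rightarrow> 'v"
  assumes G: "group G" "countable (carrier G)" "outer_commensurator_normalizer G"
    and V: "countable V" "0 \<in> V" "\<And>x y. x \<in> V \<Longrightarrow> y \<in> V \<Longrightarrow> x - y \<in> V"
    and act: "\<And>g x. g \<in> carrier G \<Longrightarrow> x \<in> V \<Longrightarrow> act g x \<in> V"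
      "\<And>g x y. g \<in> carrier G \<Longrightarrow> x \<in> V \<Longrightarrow> y \<in> V \<Longrightarrow> act g (x + y) = act g x + act g y"
      "\<And>x. x \<in> V \<Longrightarrow> act \<one> x = x"
      "\<And>g h x. g \<in> carrier G \<Longrightarrow> h \<in> carrier G \<Longrightarrow> x \<in> V \<Longrightarrow>
        act (g \<otimes> h) x = act g (act h x)"
    and L: "L \<subseteq> V" "0 \<in> L" "\<And>x y. x \<in> L \<Longrightarrow> y \<in> L \<Longrightarrow> x - y \<in> L"
    and comm: "\<And>g. g \<in> carrier G \<Longrightarrow> finitely_many_cosets (act g ` L) L"
  obtains M where "M \<subseteq> V" "\<And>g x. g \<in> carrier G \<Longrightarrow> x \<in> M \<Longrightarrow> act g x \<in> M"
    "finitely_many_cosets M L" "finitely_many_cosets L M"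
proof -
  interpret group G by fact
  have Vplus: "x + y \<in> V" if "x \<in> V" "y \<in> V" for x y
    using V(3)[OF that(1) V(3)[OF V(2) that(2)]] by simp
  have Vneg: "- x \<in> V" if "x \<in> V" for x using V(3)[OF V(2) that] by simp
  have act0: "act g 0 = 0" if "g \<in> carrier G" for g
    using act(2)[OF that V(2) V(2)] by simp
  have actneg: "act g (- x) = - act g x" if "g \<in> carrier G" "x \<in> V" for g x
    using act(2)[OF that(1) that(2) Vneg[OF that(2)]] act0[OF that(1)]
    by (simp add: eq_neg_iff_add_eq_0 add.commute)
  have actdiff: "act g (x - y) = act g x - act g y" if "g \<in> carrier G" "x \<in> V" "y \<in> V" for g x y
    using act(2)[OF that(1,2) Vneg[OF that(3)]] actneg[OF that(1,3)] by simp
  define D where "D = \<lparr>carrier = V \<times> carrier G,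
    monoid.mult = (\<lambda>(v, g) (w, h). (v + act g w, g \<otimes> h)), one = (0, \<one>)\<rparr>"
  have grpD: "group D"
  proof (rule groupI)
    fix x assume "x \<in> carrier D"
    then obtain v g where x: "x = (v, g)" "v \<in> V" "g \<in> carrier G" by (auto simp: D_def)
    show "\<exists>y\<in>carrier D. y \<otimes>\<^bsub>D\<^esub> x = \<one>\<^bsub>D\<^esub>"
      using x act Vneg by (intro bexI[of _ "(- act (inv g) v, inv g)"]) (auto simp: D_def)
  qed (auto simp: D_def act act0 Vplus V m_assoc add.assoc)
  interpret D: group D by fact
  define \<phi> where "\<phi> g = (0 :: 'v, g)" for g :: 'g
  define L' where "L' = L \<times> {\<one>}"
  have inv_pair: "inv\<^bsub>D\<^esub> (v, \<one>) = (- v, \<one>)" if "v \<in> V" for v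
    using that Vneg act by (intro D.inv_equality) (auto simp: D_def)
  have inv\<phi>: "inv\<^bsub>D\<^esub> (\<phi> g) = \<phi> (inv g)" if "g \<in> carrier G" for g
    using that V act0 by (intro D.inv_equality) (auto simp: D_def \<phi>_def)
  have subD: "subgroup (A \<times> {\<one>}) D" if A: "A \<subseteq> V" "0 \<in> A" "\<And>x y. x \<in> A \<Longrightarrow> y \<in> A \<Longrightarrow> x - y \<in> A" for A
  proof (rule D.subgroupI)
    fix x y assume "x \<in> A \<times> {\<one>}" "y \<in> A \<times> {\<one>}"
    then obtain v w where "x = (v, \<one>)" "y = (w, \<one>)" "v \<in> A" "w \<in> A" by auto
    moreover from this have "v - (0 - w) \<in> A" using A by metis
    ultimately show "x \<otimes>\<^bsub>D\<^esub> y \<in> A \<times> {\<one>}" using A act by (auto simp: D_def)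
  next
    fix x assume "x \<in> A \<times> {\<one>}"
    then obtain v where "x = (v, \<one>)" "v \<in> A" by auto
    moreover from this have "0 - v \<in> A" using A by metis
    ultimately show "inv\<^bsub>D\<^esub> x \<in> A \<times> {\<one>}" using A inv_pair by auto
  qed (use A in \<open>auto simp: D_def\<close>)
  have conj: "\<phi> g \<otimes>\<^bsub>D\<^esub> (v, \<one>) \<otimes>\<^bsub>D\<^esub> inv\<^bsub>D\<^esub> \<phi> g = (act g v, \<one>)" if "g \<in> carrier G" "v \<in> V" for g v
    unfolding inv\<phi>[OF that(1)] using that act0 act by (auto simp: D_def \<phi>_def)
  have conj_set: "\<phi> g <#\<^bsub>D\<^esub> (A \<times> {\<one>}) #>\<^bsub>D\<^esub> inv\<^bsub>D\<^esub> \<phi> g = (act g ` A) \<times> {\<one>}"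
    if "g \<in> carrier G" "A \<subseteq> V" for g A
  proof -
    have "\<phi> g <#\<^bsub>D\<^esub> (A \<times> {\<one>}) #>\<^bsub>D\<^esub> inv\<^bsub>D\<^esub> \<phi> g =
        (\<lambda>v. \<phi> g \<otimes>\<^bsub>D\<^esub> (v, \<one>) \<otimes>\<^bsub>D\<^esub> inv\<^bsub>D\<^esub> \<phi> g) ` A"
      unfolding l_coset_def r_coset_def by auto
    also have "\<dots> = (\<lambda>v. (act g v, \<one>)) ` A"
      using that conj by (intro image_cong) auto
    finally show ?thesis by auto
  qed
  have index: "finite_index D (A \<times> {\<one>}) ((A \<times> {\<one>}) \<inter> (B \<times> {\<one>}))"
    if A: "A \<subseteq> V" "0 \<in> A" "\<And>x y. x \<in> A \<Longrightarrow> y \<in> A \<Longrightarrow> x - y \<in> A"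
      and B: "B \<subseteq> V" "0 \<in> B" "\<And>x y. x \<in> B \<Longrightarrow> y \<in> B \<Longrightarrow> x - y \<in> B"
      and fin: "finitely_many_cosets A B" for A B
  proof -
    obtain f :: "'v \<Rightarrow> 'v set" where f: "finite (f ` A)"
      "\<And>x y. x \<in> A \<Longrightarrow> y \<in> A \<Longrightarrow> f x = f y \<Longrightarrow> x - y \<in> B"
      using fin unfolding finitely_many_cosets_def by blast
    define F where "F x = {y \<in> A. y - x \<in> B}" for x
    have Feq: "F x = F y" if "x \<in> A" "y \<in> A" "f x = f y" for x y
    proof -
      have "z - x \<in> B \<longleftrightarrow> z - y \<in> B" for z
      proof
        assume "z - x \<in> B"
        then have "(z - x) - (y - x) \<in> B" using B(3) f(2)[of y x] that by metis
        then show "z - y \<in> B" by simp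
      next
        assume "z - y \<in> B"
        then have "(z - y) - (x - y) \<in> B" using B(3) f(2)[of x y] that by metis
        then show "z - x \<in> B" by simp
      qed
      then show ?thesis by (simp add: F_def)
    qed
    have finF: "finite (F ` A)" using f(1) Feq by (rule finite_image_factor)
    have "{y \<in> A \<times> {\<one>}. y \<otimes>\<^bsub>D\<^esub> inv\<^bsub>D\<^esub> x \<in> B \<times> {\<one>}} = F (fst x) \<times> {\<one>}"
      if x: "x \<in> A \<times> {\<one>}" for x
    proof -
      obtain v where v: "x = (v, \<one>)" "v \<in> A" "v \<in> V" using x A by auto
      have "(w, \<one>) \<otimes>\<^bsub>D\<^esub> inv\<^bsub>D\<^esub> x = (w - v, \<one>)" for w
        unfolding v(1) inv_pair[OF v(3)] using act(3)[OF Vneg[OF v(3)]] by (simp add: D_def)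
      then show ?thesis by (auto simp: F_def v(1))
    qed
    then have "(\<lambda>x. {y \<in> A \<times> {\<one>}. y \<otimes>\<^bsub>D\<^esub> inv\<^bsub>D\<^esub> x \<in> B \<times> {\<one>}}) ` (A \<times> {\<one>}) \<subseteq>
        (\<lambda>C. C \<times> {\<one>}) ` F ` A" by auto
    with finF have "finite ((\<lambda>x. {y \<in> A \<times> {\<one>}. y \<otimes>\<^bsub>D\<^esub> inv\<^bsub>D\<^esub> x \<in> B \<times> {\<one>}}) ` (A \<times> {\<one>}))"
      by (meson finite_imageI finite_subset)
    moreover have "subgroup (A \<times> {\<one>}) D" "subgroup (B \<times> {\<one>}) D"
      using subD[OF A] subD[OF B] by auto
    ultimately show ?thesis using finite_index_iff[OF grpD] by blast
  qed
  \<comment> \<open>The subgroup supplied by the hypothesis need not lie in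
    \<open>V \<times> {\<one>}\<close>, so the count is made for arbitrary subgroups of
    \<open>D\<close>, restricted to their elements over \<open>\<one>\<close>.\<close>
  have cosets_back: "finitely_many_cosets {v. (v, \<one>) \<in> A} {v. (v, \<one>) \<in> B}"
    if A: "subgroup A D" and B: "subgroup B D" and fin: "finite_index D A (A \<inter> B)" for A B
  proof (rule finitely_many_cosetsI[of "\<lambda>v. {y \<in> A. y \<otimes>\<^bsub>D\<^esub> inv\<^bsub>D\<^esub> (v, \<one>) \<in> B}"])
    show "finite ((\<lambda>v. {y \<in> A. y \<otimes>\<^bsub>D\<^esub> inv\<^bsub>D\<^esub> (v, \<one>) \<in> B}) ` {v. (v, \<one>) \<in> A})"
      using fin[unfolded finite_index_iff[OF grpD A B]]
      by (rule rev_finite_subset) (auto intro!: imageI)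
    fix x y assume xy: "x \<in> {v. (v, \<one>) \<in> A}" "y \<in> {v. (v, \<one>) \<in> A}"
      and eq: "{z \<in> A. z \<otimes>\<^bsub>D\<^esub> inv\<^bsub>D\<^esub> (x, \<one>) \<in> B} = {z \<in> A. z \<otimes>\<^bsub>D\<^esub> inv\<^bsub>D\<^esub> (y, \<one>) \<in> B}"
    have inA: "(x, \<one>) \<in> carrier D" "(y, \<one>) \<in> carrier D" using xy A subgroup.subset by auto
    then have "(x, \<one>) \<in> {z \<in> A. z \<otimes>\<^bsub>D\<^esub> inv\<^bsub>D\<^esub> (x, \<one>) \<in> B}"
      using xy B by (auto intro: subgroup.one_closed)
    then have "(x, \<one>) \<otimes>\<^bsub>D\<^esub> inv\<^bsub>D\<^esub> (y, \<one>) \<in> B" using eq by simp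
    moreover have "x \<in> V" "y \<in> V" using inA by (auto simp: D_def)
    ultimately show "x - y \<in> {v. (v, \<one>) \<in> B}"
      using inv_pair[of y] Vneg[of y] act by (auto simp: D_def)
  qed
  have actL: "act g ` L \<subseteq> V" "0 \<in> act g ` L"
    "\<And>x y. x \<in> act g ` L \<Longrightarrow> y \<in> act g ` L \<Longrightarrow> x - y \<in> act g ` L" if "g \<in> carrier G" for g
  proof -
    show "act g ` L \<subseteq> V" using L act that by auto
    show "0 \<in> act g ` L" using L act0[OF that] by force
    fix x y assume "x \<in> act g ` L" "y \<in> act g ` L"
    then obtain u w where "x = act g u" "y = act g w" "u \<in> L" "w \<in> L" by auto
    moreover from this have "act g (u - w) = act g u - act g w" using L actdiff[OF that] by blast
    ultimately show "x - y \<in> act g ` L" using L by (metis imageI)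
  qed
  \<comment> \<open>The assumption for the inverse of \<open>g\<close>, transported by
    \<open>act g\<close>, bounds the index in the other direction.\<close>
  have comm': "finitely_many_cosets L (act g ` L)" if g: "g \<in> carrier G" for g
  proof -
    obtain f :: "'v \<Rightarrow> 'v set" where f: "finite (f ` act (inv g) ` L)"
      "\<And>x y. x \<in> act (inv g) ` L \<Longrightarrow> y \<in> act (inv g) ` L \<Longrightarrow> f x = f y \<Longrightarrow> x - y \<in> L"
      using comm[of "inv g"] g unfolding finitely_many_cosets_def by blast
    show ?thesis
    proof (rule finitely_many_cosetsI[of "\<lambda>x. f (act (inv g) x)"])
      show "finite ((\<lambda>x. f (act (inv g) x)) ` L)" using f(1) by (simp add: image_image)
      fix x y assume xy: "x \<in> L" "y \<in> L" "f (act (inv g) x) = f (act (inv g) y)"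
      then have "act (inv g) x - act (inv g) y \<in> L" using f(2) by blast
      moreover have "act g (act (inv g) x - act (inv g) y) = x - y"
      proof -
        have "act g (act (inv g) z) = z" if "z \<in> V" for z
          using act(3)[OF that] act(4)[of g "inv g" z] g that by simp
        then show ?thesis using actdiff[OF g, of "act (inv g) x" "act (inv g) y"] xy L act g
          by (auto simp: subset_iff)
      qed
      ultimately show "x - y \<in> act g ` L" by (metis imageI)
    qed
  qed
  have "\<phi> \<in> hom G D" using V act0 by (auto simp: hom_def D_def \<phi>_def)
  moreover have "subgroup L' D" unfolding L'_def by (rule subD[OF L])
  moreover have "countable (carrier D)" using V G by (simp add: D_def)
  moreover have "commensurated_by D L' (\<phi> ` carrier G)"
    unfolding commensurated_by_def L'_def commensurable_def
  proof (intro ballI)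
    fix d assume "d \<in> \<phi> ` carrier G"
    then obtain g where g: "g \<in> carrier G" "d = \<phi> g" by auto
    have "finite_index D (L \<times> {\<one>}) ((act g ` L) \<times> {\<one>} \<inter> L \<times> {\<one>})"
      using index[OF L actL[OF g(1)] comm'[OF g(1)]] by (simp add: Int_commute)
    then show "subgroup (d <#\<^bsub>D\<^esub> (L \<times> {\<one>}) #>\<^bsub>D\<^esub> inv\<^bsub>D\<^esub> d) D \<and> subgroup (L \<times> {\<one>}) D \<and>
      finite_index D (d <#\<^bsub>D\<^esub> (L \<times> {\<one>}) #>\<^bsub>D\<^esub> inv\<^bsub>D\<^esub> d)
        ((d <#\<^bsub>D\<^esub> (L \<times> {\<one>}) #>\<^bsub>D\<^esub> inv\<^bsub>D\<^esub> d) \<inter> L \<times> {\<one>}) \<and>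
      finite_index D (L \<times> {\<one>}) ((d <#\<^bsub>D\<^esub> (L \<times> {\<one>}) #>\<^bsub>D\<^esub> inv\<^bsub>D\<^esub> d) \<inter> L \<times> {\<one>})"
      unfolding g(2) conj_set[OF g(1) L(1)]
      using subD[OF actL[OF g(1)]] subD[OF L] index[OF actL[OF g(1)] L comm[OF g(1)]] by blast
  qed
  ultimately obtain M' where M': "subgroup M' D" "commensurable D M' L'"
      "\<phi> ` carrier G \<subseteq> normalizer D M'"
    using outer_commensurator_normalizerD[OF G(3) grpD] by metis
  have M'D: "M' \<subseteq> carrier D" using M'(1) by (rule subgroup.subset)
  \<comment> \<open>The elements of \<open>M'\<close> over \<open>\<one>\<close> are the ones
    wanted: conjugation by \<open>\<phi> g\<close> keeps the second component \<open>\<one>\<close>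
    and acts on the first by \<open>act g\<close>, and since \<open>L'\<close> lies over
    \<open>\<one>\<close> the coset counts survive the restriction.\<close>
  show ?thesis
  proof (rule that[of "{v. (v, \<one>) \<in> M'}"])
    show "{v. (v, \<one>) \<in> M'} \<subseteq> V" using M'D by (auto simp: D_def)
    have "{v. (v, \<one>) \<in> L'} = L" by (auto simp: L'_def)
    moreover have "finite_index D M' (M' \<inter> L')" "finite_index D L' (L' \<inter> M')"
      using M'(2) by (auto simp: commensurable_def Int_commute)
    ultimately show "finitely_many_cosets {v. (v, \<one>) \<in> M'} L" "finitely_many_cosets L {v. (v, \<one>) \<in> M'}"
      using cosets_back[OF M'(1) \<open>subgroup L' D\<close>] cosets_back[OF \<open>subgroup L' D\<close> M'(1)] by simp_all
    fix g v assume g: "g \<in> carrier G" and v: "v \<in> {v. (v, \<one>) \<in> M'}"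
    have "\<phi> g \<in> normalizer D M'" using M'(3) g by auto
    then have *: "\<phi> g <#\<^bsub>D\<^esub> M' #>\<^bsub>D\<^esub> inv\<^bsub>D\<^esub> \<phi> g = M'"
      using D.mem_normalizer_iff[OF M'D] by simp
    have "\<phi> g \<otimes>\<^bsub>D\<^esub> (v, \<one>) \<otimes>\<^bsub>D\<^esub> inv\<^bsub>D\<^esub> \<phi> g \<in> \<phi> g <#\<^bsub>D\<^esub> M' #>\<^bsub>D\<^esub> inv\<^bsub>D\<^esub> \<phi> g"
      using v unfolding l_coset_def r_coset_def by auto
    moreover have "v \<in> V" using v M'D by (auto simp: D_def)
    ultimately show "act g v \<in> {v. (v, \<one>) \<in> M'}" using conj[OF g] * by simp
  qed
qed

section \<open>Representations over a local field\<close>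

text \<open>The additive subgroup generated by \<open>Q\<close>. A linear span would be too large:
  this hull stays countable over a field of Laurent series, and stays finite for finite
  \<open>Q\<close> in positive characteristic.\<close>

inductive_set add_hull :: "'a::ab_group_add set \<Rightarrow> 'a set" for Q :: "'a set" where
  zero: "0 \<in> add_hull Q"
| plus: "x \<in> add_hull Q \<Longrightarrow> q \<in> Q \<Longrightarrow> x + q \<in> add_hull Q"
| minus: "x \<in> add_hull Q \<Longrightarrow> q \<in> Q \<Longrightarrow> x - q \<in> add_hull Q"

lemma add_hull_base: "q \<in> Q \<Longrightarrow> q \<in> add_hull Q"
  using add_hull.plus[OF add_hull.zero] by auto

lemma add_hull_add:
  assumes "x \<in> add_hull Q" "y \<in> add_hull Q"
  shows "x + y \<in> add_hull Q"
  using assms(2,1)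
proof (induction y rule: add_hull.induct)
  case (plus y q)
  then show ?case using add_hull.plus[of "x + y" Q q] by (simp add: add.assoc)
next
  case (minus y q)
  then show ?case using add_hull.minus[of "x + y" Q q] by (simp add: algebra_simps)
qed auto

lemma add_hull_diff:
  assumes "x \<in> add_hull Q" "y \<in> add_hull Q"
  shows "x - y \<in> add_hull Q"
  using assms(2,1)
proof (induction y rule: add_hull.induct)
  case (plus y q)
  then show ?case using add_hull.minus[of "x - y" Q q] by (simp add: algebra_simps)
next
  case (minus y q)
  then show ?case using add_hull.plus[of "x - y" Q q] by (simp add: algebra_simps)
qed auto

lemma add_hull_image:
  assumes "x \<in> add_hull Q" "\<And>x y. f (x + y) = f x + f y" "\<And>q. q \<in> Q \<Longrightarrow> f q \<in> add_hull R"
  shows "f x \<in> add_hull R"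
  using assms(1)
proof (induction x rule: add_hull.induct)
  case zero
  have "f 0 = 0" using assms(2)[of 0 0] by simp
  then show ?case by (simp add: add_hull.zero)
next
  case (plus x q)
  then show ?case using assms by (simp add: add_hull_add)
next
  case (minus x q)
  have "f (x - q) = f x - f q" using assms(2)[of "x - q" q] by simp
  with minus show ?case using assms by (simp add: add_hull_diff)
qed

lemma add_hull_subset:
  assumes "x \<in> add_hull Q" "Q \<subseteq> A" "0 \<in> A" "\<And>x y. x \<in> A \<Longrightarrow> y \<in> A \<Longrightarrow> x - y \<in> A"
  shows "x \<in> A"
proof -
  have "x + y \<in> A" if "x \<in> A" "y \<in> A" for x y
    using assms(4)[OF that(1) assms(4)[OF assms(3) that(2)]] by simp
  with assms show ?thesis by (induction x rule: add_hull.induct) auto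
qed

lemma countable_add_hull:
  assumes "countable Q"
  shows "countable (add_hull Q)"
proof -
  let ?f = "\<lambda>xs. \<Sum>(b, q)\<leftarrow>xs. if b then q else - q"
  have "x \<in> ?f ` lists (UNIV \<times> Q)" if "x \<in> add_hull Q" for x
    using that
  proof (induction x rule: add_hull.induct)
    case zero
    show ?case by (rule image_eqI[of _ _ "[]"]) auto
  next
    case (plus x q)
    then obtain xs where "xs \<in> lists (UNIV \<times> Q)" "x = ?f xs" by auto
    then show ?case using plus by (intro image_eqI[of _ _ "(True, q) # xs"]) auto
  next
    case (minus x q)
    then obtain xs where "xs \<in> lists (UNIV \<times> Q)" "x = ?f xs" by auto
    then show ?case using minus by (intro image_eqI[of _ _ "(False, q) # xs"]) auto
  qed
  then have "add_hull Q \<subseteq> ?f ` lists (UNIV \<times> Q)" by blast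
  moreover have "countable (lists ((UNIV :: bool set) \<times> Q))" using assms by auto
  ultimately show ?thesis by (meson countable_image countable_subset)
qed

text \<open>Membership in the fractional ideal generated by the \<open>k\<close>-th power of the
  uniformizer. The subdegree alone would not do, since it takes the default value 0 at the zero
  series.\<close>

definition vanishes_below :: "'c::zero fls \<Rightarrow> int \<Rightarrow> bool" where
  "vanishes_below f k \<longleftrightarrow> (\<forall>n<k. fls_nth f n = 0)"

lemma vanishes_below_iff: "vanishes_below f k \<longleftrightarrow> f = 0 \<or> k \<le> fls_subdegree f"
proof (cases "f = 0")
  case False
  have "k \<le> fls_subdegree f" if "vanishes_below f k"
    using that fls_subdegree_geI[OF False] by (auto simp: vanishes_below_def)
  with False show ?thesis by (auto simp: vanishes_below_def)
qed (auto simp: vanishes_below_def)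

lemma vanishes_below_mono: "vanishes_below f k \<Longrightarrow> l \<le> k \<Longrightarrow> vanishes_below f l"
  by (auto simp: vanishes_below_def)

lemma vanishes_below_mult:
  fixes f g :: "'c::idom fls"
  shows "vanishes_below f k \<Longrightarrow> vanishes_below g l \<Longrightarrow> vanishes_below (f * g) (k + l)"
  by (auto simp: vanishes_below_iff)

lemma vanishes_below_sum:
  "(\<And>i. i \<in> I \<Longrightarrow> vanishes_below (f i) k) \<Longrightarrow> vanishes_below (\<Sum>i\<in>I. f i) k"
  by (auto simp: vanishes_below_def fls_nth_sum)

lemma ex_common_vanishes_below:
  fixes f :: "'i \<Rightarrow> 'c::zero fls"
  assumes "finite I"
  obtains d :: nat where "\<And>i. i \<in> I \<Longrightarrow> vanishes_below (f i) (- int d)"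
proof (rule that)
  fix i assume "i \<in> I"
  then have "nat (- fls_subdegree (f i)) \<le> (\<Sum>i\<in>I. nat (- fls_subdegree (f i)))"
    using assms by (intro member_le_sum) auto
  then show "vanishes_below (f i) (- int (\<Sum>i\<in>I. nat (- fls_subdegree (f i))))"
    unfolding vanishes_below_iff by linarith
qed

text \<open>A commensurated lattice \<open>L\<close> yields a \<open>G\<close>-invariant \<open>M\<close>, which is bounded since it is
  covered by finitely many cosets of \<open>L\<close>. But \<open>M\<close> contains a nonzero multiple of \<open>v\<close>, whose
  \<open>g\<close>-orbit is unbounded.\<close>

lemma no_expanding_eigenvector:
  fixes G (structure) and scale :: "'c::field fls \<Rightarrow> 'w::ab_group_add \<Rightarrow> 'w"
  assumes fin: "finite (UNIV :: 'c set)" and vs: "vector_space scale"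
    and G: "group G" "countable (carrier G)" "outer_commensurator_normalizer G"
    and W: "finite W"
    and lin: "\<And>g. g \<in> carrier G \<Longrightarrow> Vector_Spaces.linear scale scale (act g)"
    and inv: "\<And>g w. g \<in> carrier G \<Longrightarrow> w \<in> W \<Longrightarrow> act g w \<in> module.span scale W"
    and one: "\<And>x. x \<in> module.span scale W \<Longrightarrow> act \<one> x = x"
    and mult: "\<And>g h x. g \<in> carrier G \<Longrightarrow> h \<in> carrier G \<Longrightarrow> x \<in> module.span scale W \<Longrightarrow>
      act (g \<otimes> h) x = act g (act h x)"
    and v: "v \<in> module.span scale W" and g: "g \<in> carrier G"
    and eigen: "act g v = scale fls_X_inv v"
  shows "v = 0"
proof (rule ccontr)
  assume "v \<noteq> 0"
  interpret vector_space scale by fact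
  interpret group G by fact
  obtain B where B: "B \<subseteq> W" "independent B" "W \<subseteq> span B"
    using maximal_independent_subset[of W] by metis
  have finB: "finite B" using B W finite_subset by blast
  have spanB: "span W = span B" using B by (meson span_eq span_superset subset_trans)
  define rep where "rep = representation B"
  have rep_add: "rep (x + y) b = rep x b + rep y b" if "x \<in> span B" "y \<in> span B" for x y b
    using representation_add[OF B(2) that(2,1)] by (simp add: rep_def)
  have rep_diff: "rep (x - y) b = rep x b - rep y b" if "x \<in> span B" "y \<in> span B" for x y b
    using representation_diff[OF B(2) that(2,1)] by (simp add: rep_def)
  have rep_scale: "rep (scale c x) b = c * rep x b" if "x \<in> span B" for c x b
    using representation_scale[OF B(2) that] by (simp add: rep_def)
  have rep_eq: "(\<Sum>b\<in>B. scale (rep x b) b) = x" if "x \<in> span B" for x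
    using sum_representation_eq[OF B(2) that finB] by (simp add: rep_def)
  have rep_sum: "rep (\<Sum>i\<in>I. f i) b = (\<Sum>i\<in>I. rep (f i) b)" if "\<And>i. i \<in> I \<Longrightarrow> f i \<in> span B" for I f b
    using representation_sum[OF B(2), of I f] that by (simp add: rep_def)
  have act_add: "act h (x + y) = act h x + act h y" if "h \<in> carrier G" for h x y
    using lin[OF that] by (simp add: Vector_Spaces.linear_iff)
  have act_scale: "act h (scale c x) = scale c (act h x)" if "h \<in> carrier G" for h c x
    using lin[OF that] by (simp add: Vector_Spaces.linear_iff)
  have act_span: "act h x \<in> span B" if h: "h \<in> carrier G" and x: "x \<in> span B" for h x
  proof -
    interpret h: Vector_Spaces.linear scale scale "act h" using lin[OF h] .
    have "act h ` span W = span (act h ` W)" by (simp add: h.span_image)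
    also have "\<dots> \<subseteq> span W" using inv[OF h] by (intro span_minimal) auto
    finally show ?thesis using x spanB by auto
  qed
  \<comment> \<open>The positive powers of the uniformizer are included so that the lattice
    \<open>L\<close> below contains infinitely many multiples of \<open>v\<close>; beyond them only
    the orbit of \<open>v\<close> is taken, which keeps \<open>V\<close> countable.\<close>
  define Q where "Q = (\<lambda>(k, h). scale (fls_X ^ k) (act h v)) ` ((UNIV :: nat set) \<times> carrier G)"
  define V where "V = add_hull Q"
  have QB: "Q \<subseteq> span B" using act_span v by (auto simp: Q_def spanB intro: span_scale)
  have VB: "x \<in> span B" if "x \<in> V" for x
    using add_hull_subset[OF that[unfolded V_def] QB] by (auto intro: span_zero span_diff)
  have XV: "scale (fls_X ^ k) v \<in> V" for k
    unfolding V_def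
  proof (rule add_hull_base)
    show "scale (fls_X ^ k) v \<in> Q"
      using one[OF v] by (auto simp: Q_def intro!: image_eqI[of _ _ "(k, \<one>)"])
  qed
  have actV: "act h x \<in> V" if h: "h \<in> carrier G" and x: "x \<in> V" for h x
    unfolding V_def
  proof (rule add_hull_image[OF x[unfolded V_def]])
    fix q assume "q \<in> Q"
    then obtain k h' where q: "h' \<in> carrier G" "q = scale (fls_X ^ k) (act h' v)"
      by (auto simp: Q_def)
    have "act h q = scale (fls_X ^ k) (act (h \<otimes> h') v)"
      unfolding q(2) act_scale[OF h] mult[OF h q(1) v] ..
    also have "\<dots> \<in> Q" using h q by (auto simp: Q_def intro!: image_eqI[of _ _ "(k, h \<otimes> h')"])
    finally show "act h q \<in> add_hull Q" by (rule add_hull_base)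
  qed (rule act_add[OF h])
  define L where "L = {x \<in> V. \<forall>b\<in>B. vanishes_below (rep x b) 0}"
  \<comment> \<open>Modulo \<open>L\<close> an element is determined by the polar parts of its
    coordinates. With poles of order at most \<open>d\<close> and a finite coefficient field there
    are finitely many of these.\<close>
  have cosets: "finitely_many_cosets A L"
    if A: "A \<subseteq> V" and bound: "\<And>x b. x \<in> A \<Longrightarrow> b \<in> B \<Longrightarrow> vanishes_below (rep x b) (- int d)" for A d
  proof (rule finitely_many_cosetsI)
    let ?f = "\<lambda>x. restrict (\<lambda>(b, n). fls_nth (rep x b) n) (B \<times> {- int d..<0})"
    have "?f ` A \<subseteq> (B \<times> {- int d..<0}) \<rightarrow>\<^sub>E UNIV"
      unfolding image_subset_iff restrict_PiE_iff by blast
    moreover have "finite ((B \<times> {- int d..<0}) \<rightarrow>\<^sub>E (UNIV :: 'c set))"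
      using finB fin by (intro finite_PiE) auto
    ultimately show "finite (?f ` A)" by (rule finite_subset)
    fix x y assume xy: "x \<in> A" "y \<in> A" "?f x = ?f y"
    then have xyV: "x \<in> V" "y \<in> V" using A by auto
    have "fls_nth (rep (x - y) b) n = 0" if "b \<in> B" "n < 0" for b n
    proof (cases "n < - int d")
      case True
      then show ?thesis using bound[OF xy(1) that(1)] bound[OF xy(2) that(1)] VB xyV
        by (simp add: rep_diff vanishes_below_def)
    next
      case False
      then have "?f x (b, n) = fls_nth (rep x b) n" "?f y (b, n) = fls_nth (rep y b) n" using that by auto
      with xy(3) have "fls_nth (rep x b) n = fls_nth (rep y b) n" by simp
      then show ?thesis using VB xyV by (simp add: rep_diff)
    qed
    moreover have "x - y \<in> V" using xyV add_hull_diff unfolding V_def by blast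
    ultimately show "x - y \<in> L" by (auto simp: L_def vanishes_below_def)
  qed
  obtain M where M: "M \<subseteq> V" "\<And>h x. h \<in> carrier G \<Longrightarrow> x \<in> M \<Longrightarrow> act h x \<in> M"
    "finitely_many_cosets M L" "finitely_many_cosets L M"
  proof (rule commensurated_additive_subgroup[OF G, where V = V and L = L and act = act])
    show "countable V" unfolding V_def Q_def using G(2) by (intro countable_add_hull) auto
    show "0 \<in> V" unfolding V_def by (rule add_hull.zero)
    then show "0 \<in> L" using rep_diff[of 0 0] by (auto simp: L_def vanishes_below_def span_zero)
    show diffV: "x - y \<in> V" if "x \<in> V" "y \<in> V" for x y
      using that add_hull_diff unfolding V_def by blast
    show "x - y \<in> L" if "x \<in> L" "y \<in> L" for x y
      using that VB diffV by (auto simp: L_def vanishes_below_def rep_diff)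
    show "act \<one> x = x" if "x \<in> V" for x using one VB[OF that] spanB by simp
    show "act (h \<otimes> h') x = act h (act h' x)" if "h \<in> carrier G" "h' \<in> carrier G" "x \<in> V" for h h' x
      using mult that VB spanB by simp
    show "L \<subseteq> V" by (auto simp: L_def)
    fix h assume h: "h \<in> carrier G"
    \<comment> \<open>Here \<open>d\<close> bounds the pole orders in the matrix of
      \<open>act h\<close> with respect to \<open>B\<close>, so that \<open>act h\<close> sends
      \<open>L\<close> to elements with poles of order at most \<open>d\<close>.\<close>
    obtain d where d: "\<And>i. i \<in> B \<times> B \<Longrightarrow>
        vanishes_below (case i of (b, c) \<Rightarrow> rep (act h b) c) (- int d)"
      using ex_common_vanishes_below[of "B \<times> B" "\<lambda>(b, c). rep (act h b) c"] finB by auto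
    show "finitely_many_cosets (act h ` L) L"
    proof (rule cosets)
      show "act h ` L \<subseteq> V" using actV[OF h] by (auto simp: L_def)
      fix y c assume "y \<in> act h ` L" and c: "c \<in> B"
      then obtain x where x: "x \<in> L" "y = act h x" by auto
      have xB: "x \<in> span B" using x VB by (auto simp: L_def)
      interpret h: Vector_Spaces.linear scale scale "act h" using lin[OF h] .
      have "y = act h (\<Sum>b\<in>B. scale (rep x b) b)" using rep_eq[OF xB] x by simp
      also have "\<dots> = (\<Sum>b\<in>B. scale (rep x b) (act h b))" by (simp add: h.sum h.scale)
      finally have "rep y c = (\<Sum>b\<in>B. rep x b * rep (act h b) c)"
        using act_span[OF h] by (simp add: rep_sum rep_scale span_base span_scale)
      moreover have "vanishes_below (rep x b * rep (act h b) c) (0 + - int d)" if "b \<in> B" for b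
        using x d[of "(b, c)"] that c by (intro vanishes_below_mult) (auto simp: L_def)
      ultimately show "vanishes_below (rep y c) (- int d)" by (simp add: vanishes_below_sum)
    qed
  qed (use actV act_add in auto)
  obtain K :: nat where K: "\<And>x b. x \<in> M \<Longrightarrow> b \<in> B \<Longrightarrow> vanishes_below (rep x b) (- int K)"
  proof -
    obtain f :: "'w \<Rightarrow> 'w set" where f: "finite (f ` M)"
      "\<And>x y. x \<in> M \<Longrightarrow> y \<in> M \<Longrightarrow> f x = f y \<Longrightarrow> x - y \<in> L"
      using M(3) unfolding finitely_many_cosets_def by blast
    \<comment> \<open>One representative for each label: \<open>M\<close> is covered by the
      translates of \<open>L\<close> by elements of \<open>R\<close>, so pole orders on
      \<open>M\<close> are bounded by those on the finite set \<open>R\<close>.\<close>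
    define R where "R = inv_into M f ` f ` M"
    have finR: "finite (R \<times> B)" using f(1) finB by (simp add: R_def)
    obtain K where K: "\<And>i. i \<in> R \<times> B \<Longrightarrow> vanishes_below (case i of (r, b) \<Rightarrow> rep r b) (- int K)"
      using ex_common_vanishes_below[OF finR, of "\<lambda>(r, b). rep r b"] by auto
    have "vanishes_below (rep x b) (- int K)" if x: "x \<in> M" and b: "b \<in> B" for x b
    proof -
      define r where "r = inv_into M f (f x)"
      have r: "r \<in> R" "r \<in> M" "f r = f x"
        using x by (auto simp: R_def r_def inv_into_into f_inv_into_f)
      have "x - r \<in> L" using f(2)[OF x r(2)] r by simp
      then have 1: "vanishes_below (rep (x - r) b) (- int K)"
        using b by (auto simp: L_def intro: vanishes_below_mono)
      have 2: "vanishes_below (rep r b) (- int K)" using K[of "(r, b)"] r b by simp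
      have "rep x b = rep (x - r) b + rep r b"
        using rep_diff VB x r(2) M(1) by (simp add: subset_iff)
      with 1 2 show ?thesis by (simp add: vanishes_below_def)
    qed
    then show ?thesis by (rule that)
  qed
  have vB: "v \<in> span B" using v spanB by simp
  obtain o' where o': "o' \<noteq> 0" "scale o' v \<in> M"
  proof -
    obtain d where d: "\<And>b. b \<in> B \<Longrightarrow> vanishes_below (rep v b) (- int d)"
      using ex_common_vanishes_below[OF finB, of "rep v"] by auto
    have XL: "scale (fls_X ^ (d + k)) v \<in> L" for k
    proof -
      have "vanishes_below (fls_X ^ (d + k) * rep v b) (int d + - int d)" if "b \<in> B" for b
        using d[OF that] by (intro vanishes_below_mult) (auto simp: vanishes_below_iff)
      then show ?thesis using XV vB by (simp add: L_def rep_scale)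
    qed
    obtain f :: "'w \<Rightarrow> 'w set" where f: "finite (f ` L)"
      "\<And>x y. x \<in> L \<Longrightarrow> y \<in> L \<Longrightarrow> f x = f y \<Longrightarrow> x - y \<in> M"
      using M(4) unfolding finitely_many_cosets_def by blast
    \<comment> \<open>Pigeonhole modulo \<open>M\<close> on the multiples of \<open>v\<close> lying
      in \<open>L\<close>; the shift by \<open>d\<close> clears the poles of \<open>v\<close>. Two
      distinct powers of the uniformizer have different orders, so their difference is a nonzero
      multiplier.\<close>
    have "finite (range (\<lambda>k. f (scale (fls_X ^ (d + k)) v)))"
      using XL by (intro finite_subset[OF _ f(1)]) auto
    then have "\<not> inj (\<lambda>k :: nat. f (scale (fls_X ^ (d + k)) v))"
      using finite_imageD infinite_UNIV_nat by blast
    then obtain k l :: nat where kl: "k \<noteq> l"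
      "f (scale (fls_X ^ (d + k)) v) = f (scale (fls_X ^ (d + l)) v)"
      by (auto simp: inj_def)
    have "fls_subdegree (fls_X ^ (d + k) :: 'c fls) \<noteq> fls_subdegree (fls_X ^ (d + l) :: 'c fls)"
      using kl(1) by simp
    then have "fls_X ^ (d + k) - fls_X ^ (d + l) \<noteq> (0 :: 'c fls)" by fastforce
    moreover have "scale (fls_X ^ (d + k) - fls_X ^ (d + l)) v \<in> M"
      using f(2)[OF XL XL kl(2)] by (simp add: scale_left_diff_distrib)
    ultimately show ?thesis by (rule that)
  qed
  have pow: "scale (fls_X_inv ^ N * o') v \<in> M" for N
  proof (induction N)
    case (Suc N)
    have "act g (scale (fls_X_inv ^ N * o') v) = scale (fls_X_inv ^ Suc N * o') v"
      by (simp add: act_scale[OF g] eigen mult_ac)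
    with M(2)[OF g Suc] show ?case by simp
  qed (use o' in simp)
  have "\<exists>b\<in>B. rep v b \<noteq> 0"
  proof (rule ccontr)
    assume "\<not> ?thesis"
    then have "(\<Sum>b\<in>B. scale (rep v b) b) = 0" by (intro sum.neutral) auto
    then show False using rep_eq[OF vB] \<open>v \<noteq> 0\<close> by simp
  qed
  then obtain b where b: "b \<in> B" "rep v b \<noteq> 0" by blast
  define f where "f = o' * rep v b"
  have f0: "f \<noteq> 0" using b o' by (simp add: f_def)
  \<comment> \<open>Large enough that the order of \<open>f\<close>, lowered by \<open>N\<close>,
    falls strictly below \<open>- int K\<close>.\<close>
  define N where "N = K + nat (fls_subdegree f) + 1"
  have "vanishes_below (fls_X_inv ^ N * f) (- int K)"
    using K[OF pow b(1), of N] vB by (simp add: rep_scale f_def mult.assoc)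
  moreover have "fls_subdegree (fls_X_inv ^ N * f) = - int N + fls_subdegree f"
    using f0 by simp
  ultimately have "- int K \<le> - int N + fls_subdegree f" using f0 by (simp add: vanishes_below_iff)
  then show False unfolding N_def by linarith
qed

section \<open>Embeddings of countable domains\<close>

lemma prime_CHAR_field: "CHAR('f::field) > 0 \<Longrightarrow> Factorial_Ring.prime CHAR('f)"
  by (rule prime_CHAR_semidom)

lemma frobenius_diff:
  fixes x y :: "'f::field"
  assumes "CHAR('f) > 0"
  shows "(x - y) ^ (CHAR('f) ^ r) = x ^ (CHAR('f) ^ r) - y ^ (CHAR('f) ^ r)"
  using freshmans_dream'[OF prime_CHAR_field[OF assms] refl, of "x - y" y r] by simp

lemma frobenius_inj:
  fixes x y :: "'f::field"
  assumes "CHAR('f) > 0" "x ^ (CHAR('f) ^ r) = y ^ (CHAR('f) ^ r)"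
  shows "x = y"
  using frobenius_diff[OF assms(1), of x y r] assms(2) by simp

lemma frobenius_fixed_closed:
  fixes x y :: "'f::field"
  assumes "CHAR('f) > 0" "x ^ CHAR('f) = x" "y ^ CHAR('f) = y"
  shows "(x - y) ^ CHAR('f) = x - y" "(x + y) ^ CHAR('f) = x + y" "(- x) ^ CHAR('f) = - x"
    "(x * y) ^ CHAR('f) = x * y" "inverse x ^ CHAR('f) = inverse x" "(x / y) ^ CHAR('f) = x / y"
proof -
  show "(x - y) ^ CHAR('f) = x - y" using frobenius_diff[OF assms(1), of x y 1] assms by simp
  show "(x + y) ^ CHAR('f) = x + y"
    using freshmans_dream[OF prime_CHAR_field[OF assms(1)] refl, of x y] assms by simp
  show "(- x) ^ CHAR('f) = - x"
    using frobenius_diff[OF assms(1), of 0 x 1] assms by (simp add: zero_power)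
qed (simp_all add: assms power_mult_distrib power_inverse power_divide)

text \<open>In positive characteristic these are the elements of finite subfields, that is, the
  elements algebraic over the prime field. The equational form passes directly through ring
  embeddings, and sums are handled by a common period.\<close>

definition frobenius_periodic :: "'f::field \<Rightarrow> bool" where
  "frobenius_periodic x \<longleftrightarrow> (\<exists>r>0. x ^ (CHAR('f) ^ r) = x)"

lemma frobenius_iterate:
  fixes x :: "'f::field"
  assumes "x ^ (CHAR('f) ^ r) = x"
  shows "x ^ (CHAR('f) ^ (r * n)) = x"
proof (induction n)
  case (Suc n)
  have "x ^ (CHAR('f) ^ (r * Suc n)) = (x ^ (CHAR('f) ^ r)) ^ (CHAR('f) ^ (r * n))"
    by (simp add: power_add flip: power_mult)
  with Suc assms show ?case by simp
qed simp

lemma frobenius_periodic_add: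
  fixes x y :: "'f::field"
  assumes "CHAR('f) > 0" "frobenius_periodic x" "frobenius_periodic y"
  shows "frobenius_periodic (x + y)"
proof -
  obtain r s where rs: "r > 0" "s > 0" "x ^ (CHAR('f) ^ r) = x" "y ^ (CHAR('f) ^ s) = y"
    using assms by (auto simp: frobenius_periodic_def)
  have "(x + y) ^ (CHAR('f) ^ (r * s)) = x ^ (CHAR('f) ^ (r * s)) + y ^ (CHAR('f) ^ (r * s))"
    by (rule freshmans_dream'[OF prime_CHAR_field[OF assms(1)] refl])
  also have "\<dots> = x + y"
    using frobenius_iterate[OF rs(3), of s] frobenius_iterate[OF rs(4), of r] by (simp add: mult.commute)
  finally show ?thesis using rs by (auto simp: frobenius_periodic_def intro!: exI[of _ "r * s"])
qed

lemma frobenius_periodic_0: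
  assumes "CHAR('f::field) > 0"
  shows "frobenius_periodic (0 :: 'f)"
  using assms by (auto simp: frobenius_periodic_def intro!: exI[of _ 1])

lemma finite_frobenius_fixed:
  assumes "CHAR('f::field) > 0"
  shows "finite {x :: 'f. x ^ CHAR('f) = x}"
proof -
  define q :: "'f poly" where "q = Polynomial.monom 1 CHAR('f) - Polynomial.monom 1 1"
  have "1 \<noteq> CHAR('f)" using prime_CHAR_field[OF assms] not_prime_1 by metis
  then have "poly.coeff q CHAR('f) = 1" by (simp add: q_def)
  then have "q \<noteq> 0" by auto
  then have "finite {x. poly q x = 0}" by (rule poly_roots_finite)
  then show ?thesis by (simp add: q_def poly_monom)
qed

text \<open>All powers of \<open>x\<close> are combinations of the powers below \<open>d\<close>
  with coefficients in the finite set \<open>F\<close>. Hence two iterates of Frobenius agree at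
  \<open>x\<close>, and injectivity of Frobenius cancels the part before the period.\<close>

lemma frobenius_periodic_if_algebraic:
  fixes x :: "'f::field"
  assumes char: "CHAR('f) > 0" and q: "q \<noteq> 0" "\<And>i. poly.coeff q i ^ CHAR('f) = poly.coeff q i"
    and root: "poly q x = 0"
  shows "frobenius_periodic x"
proof -
  define F where "F = {y :: 'f. y ^ CHAR('f) = y}"
  have finF: "finite F" unfolding F_def by (rule finite_frobenius_fixed[OF char])
  have F0: "0 \<in> F" "1 \<in> F" using char by (auto simp: F_def)
  define d where "d = Polynomial.degree q"
  have "d \<noteq> 0"
  proof
    assume "d = 0"
    then obtain c where "q = [:c:]" by (auto simp: d_def elim: degree_eq_zeroE)
    with q root show False by simp
  qed
  define l where "l = poly.coeff q d"
  have l0: "l \<noteq> 0" using q by (simp add: l_def d_def)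
  have top: "l * x ^ d = - (\<Sum>i<d. poly.coeff q i * x ^ i)"
    using root unfolding poly_altdef d_def[symmetric] lessThan_Suc_atMost[symmetric]
    by (simp add: l_def add_eq_0_iff)
  define R where "R = (\<lambda>c. \<Sum>i<d. c i * x ^ i) ` ({..<d} \<rightarrow>\<^sub>E F)"
  have "finite R" unfolding R_def using finF by (intro finite_imageI finite_PiE) auto
  have RI: "(\<Sum>i<d. c i * x ^ i) \<in> R" if "\<And>i. i < d \<Longrightarrow> c i \<in> F" for c
    unfolding R_def using that by (intro image_eqI[of _ _ "restrict c {..<d}"]) auto
  have "\<exists>c. (\<forall>i. c i \<in> F) \<and> x ^ n = (\<Sum>i<d. c i * x ^ i)" for n
  proof (induction n)
    case 0
    have "(\<Sum>i<d. (if i = 0 then 1 else 0) * x ^ i) = (\<Sum>i<d. if i = 0 then 1 else 0)"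
      by (intro sum.cong) auto
    then show ?case using F0 \<open>d \<noteq> 0\<close> by (intro exI[of _ "\<lambda>i. if i = 0 then 1 else 0"]) auto
  next
    case (Suc n)
    then obtain c where c: "\<And>i. c i \<in> F" "x ^ n = (\<Sum>i<d. c i * x ^ i)" by auto
    obtain e where e: "d = Suc e" using \<open>d \<noteq> 0\<close> by (cases d) auto
    \<comment> \<open>Multiplication by \<open>x\<close> shifts the coefficients; the overflowing
      term \<open>c e * x ^ d\<close> is removed by subtracting \<open>c e / l\<close> times the
      relation given by \<open>q\<close>.\<close>
    define c' where "c' i = (case i of 0 \<Rightarrow> 0 | Suc j \<Rightarrow> c j) - c e * (poly.coeff q i / l)" for i
    have "c' i \<in> F" for i
      using c(1) F0 q(2) frobenius_fixed_closed[OF char] char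
      unfolding c'_def l_def F_def by (simp split: nat.split)
    moreover have "x ^ Suc n = (\<Sum>i<d. c' i * x ^ i)"
    proof -
      have "(\<Sum>i<d. c' i * x ^ i) = (\<Sum>i<d. (case i of 0 \<Rightarrow> 0 | Suc j \<Rightarrow> c j) * x ^ i) -
          c e / l * (\<Sum>i<d. poly.coeff q i * x ^ i)"
        by (simp add: c'_def left_diff_distrib sum_subtractf sum_distrib_left mult.assoc)
      also have "(\<Sum>i<d. (case i of 0 \<Rightarrow> 0 | Suc j \<Rightarrow> c j) * x ^ i) = (\<Sum>i<e. c i * x ^ Suc i)"
        unfolding e by (subst sum.lessThan_Suc_shift) simp
      also have "(\<Sum>i<d. poly.coeff q i * x ^ i) = - (l * x ^ d)" using top by simp
      also have "(\<Sum>i<e. c i * x ^ Suc i) - c e / l * - (l * x ^ d) = (\<Sum>i<d. c i * x ^ Suc i)"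
        using l0 by (simp add: e)
      also have "\<dots> = x ^ Suc n" by (simp add: c(2) sum_distrib_left mult_ac)
      finally show ?thesis by simp
    qed
    ultimately show ?case by blast
  qed
  then have "x ^ n \<in> R" for n using RI by metis
  then have "range (\<lambda>i. x ^ (CHAR('f) ^ i)) \<subseteq> R" by blast
  then have "finite (range (\<lambda>i. x ^ (CHAR('f) ^ i)))" using \<open>finite R\<close> finite_subset by blast
  then have "\<not> inj (\<lambda>i. x ^ (CHAR('f) ^ i))" using finite_imageD infinite_UNIV_nat by blast
  then obtain a b where ab: "a < b" "x ^ (CHAR('f) ^ a) = x ^ (CHAR('f) ^ b)"
    by (metis (mono_tags, lifting) injI linorder_neqE_nat)
  have "x ^ (CHAR('f) ^ b) = (x ^ (CHAR('f) ^ (b - a))) ^ (CHAR('f) ^ a)"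
    using ab(1) by (simp flip: power_mult power_add)
  then have "x ^ (CHAR('f) ^ (b - a)) = x" using frobenius_inj[OF char] ab(2) by metis
  then show ?thesis using ab(1) by (auto simp: frobenius_periodic_def intro!: exI[of _ "b - a"])
qed

text \<open>In characteristic zero the type is all of \<open>'k\<close>, so that it is a field in every case.\<close>

typedef (overloaded) 'k prime_field = "{x :: 'k::field. CHAR('k) = 0 \<or> x ^ CHAR('k) = x}"
  by (intro exI[of _ 1]) auto

setup_lifting type_definition_prime_field

instantiation prime_field :: (field) field
begin
lift_definition zero_prime_field :: "'a prime_field" is 0 by (auto simp: zero_power)
lift_definition one_prime_field :: "'a prime_field" is 1 by auto
lift_definition plus_prime_field :: "'a prime_field \<Rightarrow> 'a prime_field \<Rightarrow> 'a prime_field" is "(+)"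
  by (cases "CHAR('a) = 0") (auto simp: frobenius_fixed_closed)
lift_definition minus_prime_field :: "'a prime_field \<Rightarrow> 'a prime_field \<Rightarrow> 'a prime_field" is "(-)"
  by (cases "CHAR('a) = 0") (auto simp: frobenius_fixed_closed)
lift_definition uminus_prime_field :: "'a prime_field \<Rightarrow> 'a prime_field" is uminus
  by (cases "CHAR('a) = 0") (auto simp: frobenius_fixed_closed)
lift_definition times_prime_field :: "'a prime_field \<Rightarrow> 'a prime_field \<Rightarrow> 'a prime_field" is "(*)"
  by (cases "CHAR('a) = 0") (auto simp: frobenius_fixed_closed)
lift_definition inverse_prime_field :: "'a prime_field \<Rightarrow> 'a prime_field" is inverse
  by (cases "CHAR('a) = 0") (auto simp: frobenius_fixed_closed)
lift_definition divide_prime_field :: "'a prime_field \<Rightarrow> 'a prime_field \<Rightarrow> 'a prime_field" is "(/)"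
  by (cases "CHAR('a) = 0") (auto simp: frobenius_fixed_closed)
instance
  by standard (transfer; simp add: algebra_simps divide_inverse)+
end

lemma finite_prime_field:
  assumes "CHAR('k::field) > 0"
  shows "finite (UNIV :: 'k prime_field set)"
proof -
  have "finite {x :: 'k. CHAR('k) = 0 \<or> x ^ CHAR('k) = x}"
    using finite_frobenius_fixed[OF assms] assms by simp
  then have "finite (Abs_prime_field ` {x :: 'k. CHAR('k) = 0 \<or> x ^ CHAR('k) = x})"
    by (rule finite_imageI)
  then show ?thesis
    unfolding type_definition.Abs_image[OF type_definition_prime_field] .
qed

lemma CHAR_prime_field: "CHAR('k::field prime_field) = CHAR('k)"
proof -
  have *: "Rep_prime_field (of_nat n) = (of_nat n :: 'k)" for n
    by (induction n) (simp_all add: zero_prime_field.rep_eq one_prime_field.rep_eq plus_prime_field.rep_eq)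
  have "of_nat n = (0 :: 'k prime_field) \<longleftrightarrow> of_nat n = (0 :: 'k)" for n
    using Rep_prime_field_inject[of "of_nat n :: 'k prime_field" 0] by (simp add: * zero_prime_field.rep_eq)
  then show ?thesis
    by (intro CHAR_eqI) (auto simp: of_nat_eq_0_iff_char_dvd)
qed

lemma prime_field_frobenius:
  fixes c :: "'k::field prime_field"
  assumes "CHAR('k) > 0"
  shows "c ^ CHAR('k) = c"
proof -
  have "Rep_prime_field (c ^ n) = Rep_prime_field c ^ n" for n
    by (induction n) (simp_all add: one_prime_field.rep_eq times_prime_field.rep_eq)
  then show ?thesis
    using Rep_prime_field[of c] assms by (metis (mono_tags, lifting) CollectD Rep_prime_field_inject neq0_conv)
qed

text \<open>Power series with coefficients 0 and 1 already form a copy of the power set of the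
  natural numbers. Uncountability is what leaves room for images of transcendental elements.\<close>

lemma uncountable_fls_alg_closure: "uncountable (UNIV :: 'c::field fls alg_closure set)"
proof
  assume "countable (UNIV :: 'c fls alg_closure set)"
  moreover have "inj (\<lambda>S. to_ac (fps_to_fls (Abs_fps (\<lambda>n. if n \<in> S then 1 else 0 :: 'c))))"
    (is "inj ?f")
  proof
    fix S T assume "?f S = ?f T"
    then have "(if n \<in> S then 1 else 0 :: 'c) = (if n \<in> T then 1 else 0)" for n
      by (auto simp: fps_eq_iff dest!: spec[of _ n])
    then show "S = T" by (metis subsetI subset_antisym zero_neq_one)
  qed
  ultimately have "countable (UNIV :: nat set set)"
    by (meson countable_image_inj_on countable_subset subset_UNIV inj_on_subset)
  then obtain g :: "nat \<Rightarrow> nat set" where "surj g"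
    by (metis UNIV_not_empty range_from_nat_into)
  then show False using Cantors_theorem[of UNIV] by auto
qed

text \<open>An injective ring homomorphism on the subring \<open>A\<close>, with values of
  \<open>f\<close> off \<open>A\<close> unconstrained. With a subring instead of a subfield,
  adjoining an element means evaluating polynomials, and no fractions have to be defined.\<close>

definition subring_embedding :: "'a::field set \<Rightarrow> ('a \<Rightarrow> 'b::field) \<Rightarrow> bool" where
  "subring_embedding A f \<longleftrightarrow> 1 \<in> A \<and> (\<forall>x\<in>A. \<forall>y\<in>A. x - y \<in> A \<and> x * y \<in> A \<and>
     f (x - y) = f x - f y \<and> f (x * y) = f x * f y) \<and> f 1 = 1 \<and> (\<forall>x\<in>A. f x = 0 \<longrightarrow> x = 0)"

context
  fixes A :: "'a::field set" and f :: "'a \<Rightarrow> 'b::field"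
  assumes emb: "subring_embedding A f"
begin

lemma subring_embedding_simps:
  shows "0 \<in> A" "1 \<in> A" "f 0 = 0" "f 1 = 1"
    and "x \<in> A \<Longrightarrow> y \<in> A \<Longrightarrow> x - y \<in> A" "x \<in> A \<Longrightarrow> y \<in> A \<Longrightarrow> x * y \<in> A"
    and "x \<in> A \<Longrightarrow> y \<in> A \<Longrightarrow> f (x - y) = f x - f y"
    and "x \<in> A \<Longrightarrow> y \<in> A \<Longrightarrow> f (x * y) = f x * f y"
    and "x \<in> A \<Longrightarrow> f x = 0 \<longleftrightarrow> x = 0"
    and "x \<in> A \<Longrightarrow> y \<in> A \<Longrightarrow> x + y \<in> A" "x \<in> A \<Longrightarrow> y \<in> A \<Longrightarrow> f (x + y) = f x + f y"
    and "x \<in> A \<Longrightarrow> y \<in> A \<Longrightarrow> f x = f y \<longleftrightarrow> x = y"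
proof -
  have *: "1 \<in> A" "f 1 = 1" "\<And>x y. x \<in> A \<Longrightarrow> y \<in> A \<Longrightarrow> x - y \<in> A \<and> x * y \<in> A \<and>
      f (x - y) = f x - f y \<and> f (x * y) = f x * f y" "\<And>x. x \<in> A \<Longrightarrow> f x = 0 \<Longrightarrow> x = 0"
    using emb by (auto simp: subring_embedding_def)
  show 0: "0 \<in> A" "f 0 = 0" using *(3)[OF *(1,1)] by auto
  show "1 \<in> A" "f 1 = 1" using * by auto
  show "x \<in> A \<Longrightarrow> y \<in> A \<Longrightarrow> x - y \<in> A" "x \<in> A \<Longrightarrow> y \<in> A \<Longrightarrow> x * y \<in> A"
    "x \<in> A \<Longrightarrow> y \<in> A \<Longrightarrow> f (x - y) = f x - f y"
    "x \<in> A \<Longrightarrow> y \<in> A \<Longrightarrow> f (x * y) = f x * f y" using * by auto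
  show "x \<in> A \<Longrightarrow> f x = 0 \<longleftrightarrow> x = 0" using 0 * by auto
  show "x \<in> A \<Longrightarrow> y \<in> A \<Longrightarrow> f x = f y \<longleftrightarrow> x = y" using *(3,4)[of "x - y"] *(3)[of x y] by auto
  show "x \<in> A \<Longrightarrow> y \<in> A \<Longrightarrow> x + y \<in> A" "x \<in> A \<Longrightarrow> y \<in> A \<Longrightarrow> f (x + y) = f x + f y"
    using *(3)[of x "0 - y"] *(3)[of 0 y] 0 by auto
qed

lemma subring_embedding_sum:
  assumes "\<And>i. i \<in> I \<Longrightarrow> g i \<in> A"
  shows "(\<Sum>i\<in>I. g i) \<in> A" "f (\<Sum>i\<in>I. g i) = (\<Sum>i\<in>I. f (g i))"
proof -
  have "(\<Sum>i\<in>I. g i) \<in> A \<and> f (\<Sum>i\<in>I. g i) = (\<Sum>i\<in>I. f (g i))"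
    using assms
    by (induction I rule: infinite_finite_induct) (auto simp: subring_embedding_simps)
  then show "(\<Sum>i\<in>I. g i) \<in> A" "f (\<Sum>i\<in>I. g i) = (\<Sum>i\<in>I. f (g i))" by auto
qed

definition polys where "polys = {q. \<forall>i. poly.coeff q i \<in> A}"

lemma polys_closed:
  assumes "q \<in> polys" "r \<in> polys"
  shows "q - r \<in> polys" "q + r \<in> polys" "q * r \<in> polys"
    and "map_poly f (q - r) = map_poly f q - map_poly f r"
    and "map_poly f (q + r) = map_poly f q + map_poly f r"
    and "map_poly f (q * r) = map_poly f q * map_poly f r"
  using assms unfolding polys_def
  by (auto intro!: poly_eqI simp: coeff_map_poly coeff_mult subring_embedding_simps subring_embedding_sum)

lemma polys_monom:
  assumes "c \<in> A"
  shows "Polynomial.monom c n \<in> polys" "map_poly f (Polynomial.monom c n) = Polynomial.monom (f c) n"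
  using assms by (auto simp: polys_def map_poly_monom subring_embedding_simps)

lemma map_poly_eq_0: "q \<in> polys \<Longrightarrow> map_poly f q = 0 \<longleftrightarrow> q = 0"
  by (auto simp: polys_def poly_eq_iff coeff_map_poly subring_embedding_simps)

lemma polys_0: "0 \<in> polys"
  by (auto simp: polys_def subring_embedding_simps)

lemma countable_polys:
  assumes "countable A"
  shows "countable polys"
proof -
  have "polys \<subseteq> Poly ` lists A"
  proof
    fix q assume "q \<in> polys"
    then have "coeffs q \<in> lists A" by (auto simp: polys_def coeffs_def)
    moreover have "q = Poly (coeffs q)" by simp
    ultimately show "q \<in> Poly ` lists A" by blast
  qed
  with assms show ?thesis by (meson countable_image countable_lists countable_subset)
qed

text \<open>The leading coefficient of \<open>m\<close> need not be invertible in \<open>A\<close>,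
  so a power of it multiplies \<open>q\<close> and division takes place inside \<open>polys\<close>.
  The remainder is described by vanishing coefficients, which treats remainder zero and constant
  \<open>m\<close> uniformly.\<close>

lemma pseudo_division:
  assumes "q \<in> polys" "m \<in> polys"
  shows "\<exists>k s r. s \<in> polys \<and> r \<in> polys \<and> Polynomial.monom (Polynomial.lead_coeff m ^ k) 0 * q = m * s + r \<and>
    (\<forall>i\<ge>Polynomial.degree m. poly.coeff r i = 0)"
proof -
  define d where "d = Polynomial.degree m"
  define l where "l = Polynomial.lead_coeff m"
  have lA: "l \<in> A" using assms by (auto simp: l_def polys_def)
  have "\<exists>k s r. s \<in> polys \<and> r \<in> polys \<and> Polynomial.monom (l ^ k) 0 * q = m * s + r \<and>
    (\<forall>i\<ge>d. poly.coeff r i = 0)" if "q \<in> polys" "\<forall>i\<ge>n. poly.coeff q i = 0" for n q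
    using that
  proof (induction n arbitrary: q)
    case 0
    then have "q = 0" by (simp add: poly_eq_iff)
    then show ?case using polys_0 by (intro exI[of _ 0]) auto
  next
    case (Suc n)
    show ?case
    proof (cases "n < d")
      case True
      then have "\<forall>i\<ge>d. poly.coeff q i = 0" using Suc.prems by auto
      then show ?thesis using Suc.prems polys_0 by (intro exI[of _ 0] exI[of _ q]) auto
    next
      case False
      define t where "t = Polynomial.monom (poly.coeff q n) (n - d)"
      define q' where "q' = Polynomial.monom l 0 * q - m * t"
      have t: "t \<in> polys" unfolding t_def using Suc.prems by (intro polys_monom) (auto simp: polys_def)
      have q': "q' \<in> polys" unfolding q'_def
        using t Suc.prems assms lA by (intro polys_closed polys_monom) auto
      have "poly.coeff q' i = 0" if "i \<ge> n" for i
      proof (cases "i = n")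
        case True
        then show ?thesis using False
          by (simp add: q'_def t_def coeff_monom_mult mult.commute[of m] d_def l_def)
      next
        case neq: False
        with that have "i > n" by simp
        then have "poly.coeff q i = 0" "i - (n - d) > d" "\<not> i < n - d"
          using Suc.prems(2) False by auto
        then show ?thesis
          by (simp add: q'_def t_def coeff_monom_mult mult.commute[of m] d_def coeff_eq_0)
      qed
      from Suc.IH[OF q'] this obtain k s r where
        ksr: "s \<in> polys" "r \<in> polys" "Polynomial.monom (l ^ k) 0 * q' = m * s + r"
        "\<forall>i\<ge>d. poly.coeff r i = 0" by blast
      have "Polynomial.monom (l ^ Suc k) 0 = Polynomial.monom (l ^ k) 0 * Polynomial.monom l 0"
        by (simp add: mult_monom mult.commute)
      then have "Polynomial.monom (l ^ Suc k) 0 * q = Polynomial.monom (l ^ k) 0 * (q' + m * t)"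
        by (simp add: q'_def mult.assoc)
      also have "\<dots> = m * (s + Polynomial.monom (l ^ k) 0 * t) + r"
        unfolding distrib_left ksr(3) by (simp add: algebra_simps)
      finally have "Polynomial.monom (l ^ Suc k) 0 * q = m * (s + Polynomial.monom (l ^ k) 0 * t) + r" .
      moreover have "l ^ k \<in> A" by (induction k) (auto simp: subring_embedding_simps lA)
      then have "s + Polynomial.monom (l ^ k) 0 * t \<in> polys"
        using ksr t by (intro polys_closed polys_monom)
      ultimately show ?thesis using ksr by blast
    qed
  qed
  from this[OF assms(1), of "Suc (Polynomial.degree q)"] show ?thesis
    by (auto simp: coeff_eq_0 d_def l_def)
qed

text \<open>The assumption says that \<open>b\<close> and \<beta> satisfy corresponding relations
  over \<open>A\<close>. Hence sending the value of \<open>q\<close> at \<open>b\<close> to the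
  value of its image at \<beta> is well defined and injective.\<close>

lemma extend_embedding:
  assumes "\<And>q. q \<in> polys \<Longrightarrow> poly q b = 0 \<longleftrightarrow> poly (map_poly f q) \<beta> = 0"
  obtains A' f' where "subring_embedding A' f'" "A \<subseteq> A'" "b \<in> A'" "\<And>x. x \<in> A \<Longrightarrow> f' x = f x"
    "f' b = \<beta>" "countable A \<Longrightarrow> countable A'"
proof -
  define A' where "A' = (\<lambda>q. poly q b) ` polys"
  define f' where "f' y = poly (map_poly f (SOME q. q \<in> polys \<and> poly q b = y)) \<beta>" for y
  have f': "f' (poly q b) = poly (map_poly f q) \<beta>" if q: "q \<in> polys" for q
  proof -
    define r where "r = (SOME r. r \<in> polys \<and> poly r b = poly q b)"
    have r: "r \<in> polys" "poly r b = poly q b"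
      using someI[of "\<lambda>r. r \<in> polys \<and> poly r b = poly q b" q] q by (auto simp: r_def)
    then have "poly (map_poly f (q - r)) \<beta> = 0" using assms[of "q - r"] q by (simp add: polys_closed)
    then show ?thesis using q r by (simp add: polys_closed f'_def r_def)
  qed
  have const: "[:c:] \<in> polys" "map_poly f [:c:] = [:f c:]" if "c \<in> A" for c
    using polys_monom[OF that, of 0] by (auto simp: monom_0)
  have var: "[:0, 1:] \<in> polys" "map_poly f [:0, 1:] = [:0, 1:]"
    using polys_monom[of 1 1] subring_embedding_simps by (auto simp: monom_altdef)
  show ?thesis
  proof
    show "subring_embedding A' f'"
      unfolding subring_embedding_def
    proof (intro conjI ballI impI)
      show "1 \<in> A'" unfolding A'_def using const[of 1] subring_embedding_simps
        by (intro image_eqI[of _ _ "[:1:]"]) auto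
      show "f' 1 = 1" using f'[OF const(1)[of 1]] const(2)[of 1] subring_embedding_simps by simp
      fix x assume "x \<in> A'"
      then obtain q where q: "q \<in> polys" "x = poly q b" by (auto simp: A'_def)
      { assume "f' x = 0" then show "x = 0" using q f' assms by auto }
      fix y assume "y \<in> A'"
      then obtain r where r: "r \<in> polys" "y = poly r b" by (auto simp: A'_def)
      have *: "x - y = poly (q - r) b" "x * y = poly (q * r) b" using q r by auto
      show "x - y \<in> A'" "x * y \<in> A'" unfolding * A'_def using polys_closed q r by blast+
      show "f' (x - y) = f' x - f' y" "f' (x * y) = f' x * f' y"
        unfolding * f'[OF polys_closed(1)[OF q(1) r(1)]] f'[OF polys_closed(3)[OF q(1) r(1)]]
        using q r by (simp_all add: f' polys_closed)
    qed
    show "A \<subseteq> A'" using const unfolding A'_def by force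
    show "b \<in> A'" unfolding A'_def using var by (intro image_eqI[of _ _ "[:0, 1:]"]) auto
    show "f' x = f x" if "x \<in> A" for x using f'[OF const(1)[OF that]] const(2)[OF that] by simp
    show "f' b = \<beta>" using f'[OF var(1)] var(2) by simp
    show "countable A'" if "countable A" unfolding A'_def using countable_polys[OF that] by simp
  qed
qed

text \<open>The nonzero polynomials over \<open>A\<close> are countably many and each image has
  finitely many roots, so some \<beta> in the uncountable target avoids them all. Both sides of the
  equivalence then hold for \<open>q = 0\<close> alone.\<close>

lemma ex_conjugate_transcendental:
  assumes "countable A" "uncountable (UNIV :: 'b set)" "\<And>q. q \<in> polys \<Longrightarrow> poly q b = 0 \<Longrightarrow> q = 0"
  shows "\<exists>\<beta>. \<forall>q\<in>polys. poly q b = 0 \<longleftrightarrow> poly (map_poly f q) \<beta> = 0"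
proof -
  have "countable (\<Union>q\<in>polys - {0}. {\<beta>. poly (map_poly f q) \<beta> = 0})"
    using countable_polys[OF assms(1)] map_poly_eq_0
    by (intro countable_UN) (auto intro!: countable_finite poly_roots_finite)
  then obtain \<beta> where "\<beta> \<notin> (\<Union>q\<in>polys - {0}. {\<beta>. poly (map_poly f q) \<beta> = 0})"
    using assms(2) by (metis UNIV_eq_I)
  then have "poly q b = 0 \<longleftrightarrow> poly (map_poly f q) \<beta> = 0" if "q \<in> polys" for q
    using assms(3)[OF that] that by (cases "q = 0") auto
  then show ?thesis by blast
qed

end

text \<open>The image of \<open>b\<close> is a root of the image of a polynomial of minimal degree vanishing at \<open>b\<close>.\<close>

lemma ex_conjugate_algebraic:
  fixes f :: "'a::field \<Rightarrow> 'b::alg_closed_field"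
  assumes emb: "subring_embedding A f"
    and q0: "q0 \<in> polys A" "poly q0 b = 0" "q0 \<noteq> 0"
  shows "\<exists>\<beta>. \<forall>q\<in>polys A. poly q b = 0 \<longleftrightarrow> poly (map_poly f q) \<beta> = 0"
proof -
  note [simp] = polys_closed[OF emb] polys_monom[OF emb] map_poly_eq_0[OF emb]
  have deg_small: "Polynomial.degree r < Polynomial.degree m" 
    if "\<forall>i\<ge>Polynomial.degree m. poly.coeff r i = 0" "r \<noteq> 0" for r m :: "'a poly"
    using that by (metis leading_coeff_0_iff not_le)
  have lead: "Polynomial.lead_coeff m ^ k \<in> A" if "m \<in> polys A" for m k
    using that by (induction k) (auto simp: polys_def[OF emb] subring_embedding_simps[OF emb])
  obtain m where m: "m \<in> polys A" "poly m b = 0" "m \<noteq> 0"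
    and m_min: "\<And>q. q \<in> polys A \<Longrightarrow> poly q b = 0 \<Longrightarrow> q \<noteq> 0 \<Longrightarrow> Polynomial.degree m \<le> Polynomial.degree q"
    using ex_has_least_nat[of "\<lambda>q. q \<in> polys A \<and> poly q b = 0 \<and> q \<noteq> 0" q0 Polynomial.degree] q0 by auto
  have deg_map: "Polynomial.degree (map_poly f q) = Polynomial.degree q" if "q \<in> polys A" for q
    using that subring_embedding_simps[OF emb] unfolding polys_def[OF emb]
    by (intro degree_map_poly) auto
  have "Polynomial.degree m > 0"
  proof (rule ccontr)
    assume "\<not> ?thesis"
    then obtain c where "m = [:c:]" by (auto elim: degree_eq_zeroE)
    with m show False by simp
  qed
  then obtain \<beta> where \<beta>: "poly (map_poly f m) \<beta> = 0"
    using alg_closed_imp_poly_has_root[of "map_poly f m"] deg_map[OF m(1)] by auto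
  have fwd: "poly (map_poly f q) \<beta> = 0" if q: "q \<in> polys A" "poly q b = 0" for q
  proof -
    obtain k s r where ksr: "s \<in> polys A" "r \<in> polys A"
      "Polynomial.monom (Polynomial.lead_coeff m ^ k) 0 * q = m * s + r"
      "\<forall>i\<ge>Polynomial.degree m. poly.coeff r i = 0"
      using pseudo_division[OF emb q(1) m(1)] by blast
    have "poly (Polynomial.monom (Polynomial.lead_coeff m ^ k) 0 * q) b = poly (m * s + r) b"
      using ksr(3) by simp
    then have "poly r b = 0" using q m by simp
    then have "r = 0" using m_min[OF ksr(2)] deg_small[OF ksr(4)] by force
    have "map_poly f (Polynomial.monom (Polynomial.lead_coeff m ^ k) 0) * map_poly f q =
        map_poly f (Polynomial.monom (Polynomial.lead_coeff m ^ k) 0 * q)"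
      using q lead[OF m(1), of k] by simp
    also have "\<dots> = map_poly f m * map_poly f s" using ksr m \<open>r = 0\<close> by simp
    finally have "poly (map_poly f (Polynomial.monom (Polynomial.lead_coeff m ^ k) 0)) \<beta> *
        poly (map_poly f q) \<beta> = 0"
      using \<beta> by (metis mult_eq_0_iff poly_mult)
    then have "f (Polynomial.lead_coeff m ^ k) * poly (map_poly f q) \<beta> = 0"
      using lead[OF m(1), of k] by (simp add: poly_monom)
    then show ?thesis
      using lead[OF m(1), of k] m(3) by (simp add: subring_embedding_simps[OF emb])
  qed
  \<comment> \<open>For the converse, a relation \<open>n\<close> of minimal degree is taken on the
    side of \<beta>. Up to powers of its leading coefficient it divides every polynomial whose image
    vanishes at \<beta>, so it suffices that \<open>n\<close> vanishes at \<open>b\<close>.\<close>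
  obtain n where n: "n \<in> polys A" "poly (map_poly f n) \<beta> = 0" "n \<noteq> 0"
    and n_min: "\<And>q. q \<in> polys A \<Longrightarrow> poly (map_poly f q) \<beta> = 0 \<Longrightarrow> q \<noteq> 0 \<Longrightarrow>
      Polynomial.degree n \<le> Polynomial.degree q"
    using ex_has_least_nat[of "\<lambda>q. q \<in> polys A \<and> poly (map_poly f q) \<beta> = 0 \<and> q \<noteq> 0" m Polynomial.degree]
      m \<beta> by auto
  have div: "\<exists>k s. s \<in> polys A \<and> Polynomial.monom (Polynomial.lead_coeff n ^ k) 0 * q = n * s"
    if q: "q \<in> polys A" "poly (map_poly f q) \<beta> = 0" for q
  proof -
    obtain k s r where ksr: "s \<in> polys A" "r \<in> polys A"
      "Polynomial.monom (Polynomial.lead_coeff n ^ k) 0 * q = n * s + r"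
      "\<forall>i\<ge>Polynomial.degree n. poly.coeff r i = 0"
      using pseudo_division[OF emb q(1) n(1)] by blast
    have "poly (map_poly f (Polynomial.monom (Polynomial.lead_coeff n ^ k) 0 * q)) \<beta> =
        poly (map_poly f (n * s + r)) \<beta>" using ksr(3) by simp
    moreover have "map_poly f (n * s + r) = map_poly f n * map_poly f s + map_poly f r"
      using n ksr(1,2) by simp
    moreover have "map_poly f (Polynomial.monom (Polynomial.lead_coeff n ^ k) 0 * q) =
        map_poly f (Polynomial.monom (Polynomial.lead_coeff n ^ k) 0) * map_poly f q"
      using q lead[OF n(1), of k] by (intro polys_closed(6)[OF emb] polys_monom(1)[OF emb])
    ultimately have "poly (map_poly f r) \<beta> = 0" using q n by (simp only: poly_mult poly_add) simp
    then have "r = 0" using n_min[OF ksr(2)] deg_small[OF ksr(4)] by force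
    then show ?thesis using ksr by auto
  qed
  have nb: "poly n b = 0"
  proof (rule ccontr)
    \<comment> \<open>The cofactor \<open>s\<close> of \<open>n\<close> in a multiple of
      \<open>m\<close> then vanishes at \<open>b\<close>, so its degree is at least that of
      \<open>m\<close>. This forces \<open>n\<close> to be a nonzero constant, whose image cannot
      vanish at \<beta>.\<close>
    assume nb: "poly n b \<noteq> 0"
    obtain k s where ks: "s \<in> polys A" "Polynomial.monom (Polynomial.lead_coeff n ^ k) 0 * m = n * s"
      using div[OF m(1) \<beta>] by blast
    have "poly (n * s) b = 0" using m by (simp flip: ks(2))
    then have sb: "poly s b = 0" using nb by simp
    have "Polynomial.monom (Polynomial.lead_coeff n ^ k) 0 \<noteq> 0" using n(3) by simp
    then have "s \<noteq> 0" using ks(2) m(3) by (metis mult_eq_0_iff)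
    then have "Polynomial.degree m \<le> Polynomial.degree s" using m_min ks sb by blast
    moreover have "Polynomial.degree (Polynomial.monom (Polynomial.lead_coeff n ^ k) 0 * m) = Polynomial.degree m"
      using n(3) m(3) by (simp add: degree_mult_eq degree_monom_eq)
    then have "Polynomial.degree m = Polynomial.degree n + Polynomial.degree s"
      using ks(2) n(3) \<open>s \<noteq> 0\<close> by (simp add: degree_mult_eq)
    ultimately have "Polynomial.degree n = 0" by simp
    then obtain c where c: "n = [:c:]" by (auto elim: degree_eq_zeroE)
    with nb have "poly (map_poly f n) \<beta> = f c" "c \<noteq> 0"
      using subring_embedding_simps(3)[OF emb] by (auto simp: map_poly_pCons)
    moreover have "c \<in> A" using n(1) c by (auto simp: polys_def[OF emb] dest: spec[of _ 0])
    ultimately show False using n(2) by (simp add: subring_embedding_simps[OF emb])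
  qed
  have "poly q b = 0" if q: "q \<in> polys A" "poly (map_poly f q) \<beta> = 0" for q
  proof -
    obtain k s where ks: "Polynomial.monom (Polynomial.lead_coeff n ^ k) 0 * q = n * s"
      using div[OF q] by blast
    have "poly (Polynomial.monom (Polynomial.lead_coeff n ^ k) 0 * q) b = 0" using nb by (simp add: ks)
    then show ?thesis using n(3) by (simp add: poly_monom)
  qed
  with fwd show ?thesis by blast
qed

lemma extend_embedding_finite:
  fixes f :: "'a::field \<Rightarrow> 'b::alg_closed_field"
  assumes unc: "uncountable (UNIV :: 'b set)" and "finite S" "subring_embedding A f" "countable A"
  shows "\<exists>A' f'. subring_embedding A' f' \<and> A \<subseteq> A' \<and> S \<subseteq> A' \<and> (\<forall>x\<in>A. f' x = f x) \<and> countable A'"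
  using assms(2)
proof (induction S)
  case empty
  then show ?case using assms by blast
next
  case (insert b S)
  then obtain A1 f1 where 1: "subring_embedding A1 f1" "A \<subseteq> A1" "S \<subseteq> A1" "\<forall>x\<in>A. f1 x = f x" "countable A1"
    by blast
  have "\<exists>\<beta>. \<forall>q\<in>polys A1. poly q b = 0 \<longleftrightarrow> poly (map_poly f1 q) \<beta> = 0"
    using ex_conjugate_transcendental[OF 1(1,5) unc] ex_conjugate_algebraic[OF 1(1)] by blast
  then obtain \<beta> where "\<And>q. q \<in> polys A1 \<Longrightarrow> poly q b = 0 \<longleftrightarrow> poly (map_poly f1 q) \<beta> = 0" by blast
  from extend_embedding[OF 1(1) this] obtain A2 f2 where
    "subring_embedding A2 f2" "A1 \<subseteq> A2" "b \<in> A2" "\<And>x. x \<in> A1 \<Longrightarrow> f2 x = f1 x" "countable A2"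
    using 1(5) by metis
  with 1 show ?case by (intro exI[of _ A2] exI[of _ f2]) auto
qed

text \<open>Equal characteristics mean that the same integers become zero in both fields, so the
  image does not depend on the integer chosen to represent an element.\<close>

lemma prime_subring_embedding:
  assumes "CHAR('a::field) = CHAR('b::field)"
  obtains f :: "'a::field \<Rightarrow> 'b::field" where "subring_embedding (range of_int) f" "\<And>z. f (of_int z) = of_int z"
proof -
  define f :: "'a \<Rightarrow> 'b" where "f x = of_int (SOME z. of_int z = x)" for x
  have iff: "of_int z = (0 :: 'a) \<longleftrightarrow> of_int z = (0 :: 'b)" for z
    using assms by (simp add: of_int_eq_0_iff_char_dvd)
  have f: "f (of_int z) = of_int z" for z
  proof -
    define w where "w = (SOME w. of_int w = (of_int z :: 'a))"
    have "of_int w = (of_int z :: 'a)"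
      unfolding w_def by (rule someI_ex) (rule exI[of _ z], rule refl)
    then have "of_int (w - z) = (0 :: 'a)" by (simp only: of_int_diff right_minus_eq)
    then have "of_int (w - z) = (0 :: 'b)" using iff[of "w - z"] by (rule iffD1[rotated])
    then have "of_int w = (of_int z :: 'b)" by (simp only: of_int_diff right_minus_eq)
    moreover have "f (of_int z) = of_int w" unfolding f_def w_def ..
    ultimately show ?thesis by (rule trans[rotated])
  qed
  have "subring_embedding (range of_int) f"
    unfolding subring_embedding_def
  proof (intro conjI ballI impI)
    show "(1 :: 'a) \<in> range of_int" by (rule range_eqI[of _ _ 1]) simp
    show "f 1 = 1" using f[of 1] by simp
    fix x :: 'a assume "x \<in> range of_int"
    then obtain z where z: "x = of_int z" by auto
    { assume "f x = 0" then show "x = 0" using iff f z by simp }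
    fix y :: 'a assume "y \<in> range of_int"
    then obtain w where w: "y = of_int w" by auto
    show "x - y \<in> range of_int" "x * y \<in> range of_int"
      unfolding z w by (metis of_int_diff rangeI, metis of_int_mult rangeI)
    show "f (x - y) = f x - f y" "f (x * y) = f x * f y"
      unfolding z w of_int_diff[symmetric] of_int_mult[symmetric] f by auto
  qed
  with f show ?thesis by (rule that[rotated])
qed

lemma of_int_frobenius:
  assumes "CHAR('f::field) > 0"
  shows "(of_int z :: 'f) ^ CHAR('f) = of_int z"
proof -
  have "(of_nat n :: 'f) ^ CHAR('f) = of_nat n" for n
    using assms by (induction n) (simp_all add: frobenius_fixed_closed)
  then show ?thesis
    using frobenius_fixed_closed(3)[OF assms]
    by (cases z rule: int_diff_cases) (simp add: frobenius_fixed_closed[OF assms])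
qed

text \<open>Neither \<open>x\<close> nor \<open>y\<close> is a root of a nonzero polynomial with
  coefficients fixed by Frobenius. Over the image of the integers, vanishing at \<open>x\<close> and
  vanishing at \<open>y\<close> therefore both amount to \<open>q = 0\<close>.\<close>

lemma transcendental_embedding:
  fixes x :: "'a::field" and y :: "'b::field"
  assumes "CHAR('a) = CHAR('b)" "CHAR('a) > 0" "\<not> frobenius_periodic x" "\<not> frobenius_periodic y"
  obtains A f where "subring_embedding A f" "countable A" "x \<in> A" "f x = y"
proof -
  obtain f :: "'a \<Rightarrow> 'b" where f: "subring_embedding (range of_int) f" "\<And>z. f (of_int z) = of_int z"
    using prime_subring_embedding[OF assms(1)] by metis
  have "poly q x = 0 \<longleftrightarrow> poly (map_poly f q) y = 0" if q: "q \<in> polys (range of_int)" for q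
  proof -
    have c: "poly.coeff q i \<in> range of_int" for i using q by (auto simp: polys_def[OF f(1)])
    have "poly.coeff q i ^ CHAR('a) = poly.coeff q i" for i
      using c[of i] of_int_frobenius[OF assms(2)] by auto
    then have "poly q x = 0 \<longleftrightarrow> q = 0"
      using frobenius_periodic_if_algebraic[OF assms(2)] assms(3) by auto
    moreover have "poly.coeff (map_poly f q) i ^ CHAR('b) = poly.coeff (map_poly f q) i" for i
      using c[of i] of_int_frobenius[where 'f='b] assms(1,2) f(2)
        subring_embedding_simps(3)[OF f(1)] by (auto simp: coeff_map_poly)
    then have "poly (map_poly f q) y = 0 \<longleftrightarrow> map_poly f q = 0"
      using frobenius_periodic_if_algebraic[where 'f='b] assms by auto
    ultimately show ?thesis using map_poly_eq_0[OF f(1) q] by simp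
  qed
  moreover have "countable (range (of_int :: int \<Rightarrow> 'a))" by simp
  ultimately show ?thesis using extend_embedding[OF f(1), of x y] that by metis
qed

section \<open>Algebraic elements and traces\<close>

lemma (in vector_space) ex_linear_relation:
  fixes y :: "nat \<Rightarrow> 'b"
  assumes W: "finite W" and y: "\<And>i. y i \<in> span W"
  obtains c where "\<exists>i\<le>card W. c i \<noteq> 0" "(\<Sum>i\<le>card W. scale (c i) (y i)) = 0"
proof (cases "inj_on y {..card W}")
  case True
  then have "card (y ` {..card W}) = Suc (card W)" by (simp add: card_image)
  then have "dependent (y ` {..card W})"
    using independent_span_bound[OF W, of "y ` {..card W}"] y by auto
  then obtain u where u: "\<exists>v\<in>y ` {..card W}. u v \<noteq> 0" "(\<Sum>v\<in>y ` {..card W}. scale (u v) v) = 0"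
    using dependent_finite[of "y ` {..card W}"] by auto
  have "(\<Sum>i\<le>card W. scale (u (y i)) (y i)) = 0"
    using u(2) by (simp add: sum.reindex[OF True])
  with u(1) show ?thesis by (intro that[of "\<lambda>i. u (y i)"]) auto
next
  case False
  \<comment> \<open>The relation concerns an indexed family, so a repeated vector is itself a
    relation, with coefficients 1 and -1.\<close>
  then obtain a b where ab: "a \<le> card W" "b \<le> card W" "a \<noteq> b" "y a = y b"
    by (auto simp: inj_on_def)
  define c :: "nat \<Rightarrow> 'a" where "c i = (if i = a then 1 else if i = b then - 1 else 0)" for i
  have "scale (c i) (y i) = (if i = a then y a else 0) - (if i = b then y b else 0)" for i
    using ab by (auto simp: c_def)
  then have "(\<Sum>i\<le>card W. scale (c i) (y i)) = y a - y b"
    using ab by (simp add: sum_subtractf)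
  then show ?thesis using ab by (intro that[of c]) (auto simp: c_def)
qed

lemma (in vector_space) linear_maps_span:
  assumes "x \<in> span S" "Vector_Spaces.linear scale scale f" "\<And>s. s \<in> S \<Longrightarrow> f s \<in> span T"
  shows "f x \<in> span T"
proof -
  interpret f: Vector_Spaces.linear scale scale f by fact
  have "f ` span S \<subseteq> span T"
    unfolding f.span_image[symmetric] using assms(3) by (intro span_minimal) auto
  with assms(1) show ?thesis by auto
qed

abbreviation ac_scale :: "'e::field \<Rightarrow> 'e alg_closure \<Rightarrow> 'e alg_closure" where
  "ac_scale c x \<equiv> to_ac c * x"

interpretation ac: vector_space ac_scale
  by standard (auto simp: algebra_simps)

lemma ac_mult_linear: "Vector_Spaces.linear ac_scale ac_scale (\<lambda>x. y * x)"
  using ac.vector_space_axioms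
  by (auto simp: Vector_Spaces.linear_iff distrib_left mult.left_commute)

text \<open>Finitely many algebraic elements generate a finite-dimensional algebra over the ground
  field. The span of \<open>W\<close> replaces a finite extension of the local field, so that no
  valuation has to be extended.\<close>

lemma ex_finite_span_closed_mult:
  fixes Y :: "'e::field alg_closure set"
  assumes "finite Y"
  shows "\<exists>W. finite W \<and> 1 \<in> ac.span W \<and> (\<forall>y\<in>Y. \<forall>w\<in>ac.span W. y * w \<in> ac.span W)"
  using assms
proof (induction Y)
  case empty
  show ?case by (intro exI[of _ "{1}"]) (auto intro: ac.span_base)
next
  case (insert y Y)
  then obtain W where W: "finite W" "1 \<in> ac.span W" "\<And>y w. y \<in> Y \<Longrightarrow> w \<in> ac.span W \<Longrightarrow> y * w \<in> ac.span W"
    by blast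
  obtain p :: "'e poly" where p: "p \<noteq> 0" "poly (map_poly to_ac p) y = 0"
    using alg_closure_algebraic by blast
  define d where "d = Polynomial.degree p"
  have deg: "Polynomial.degree (map_poly to_ac p) = d"
    unfolding d_def by (rule degree_map_poly) auto
  have "d \<noteq> 0"
  proof
    assume "d = 0"
    then obtain c where "p = [:c:]" by (auto simp: d_def elim: degree_eq_zeroE)
    with p show False by (simp add: map_poly_pCons)
  qed
  define l where "l = poly.coeff p d"
  have l0: "l \<noteq> 0" using p by (simp add: l_def d_def)
  have top: "to_ac l * y ^ d = - (\<Sum>i<d. to_ac (poly.coeff p i) * y ^ i)"
    using p(2) unfolding poly_altdef deg lessThan_Suc_atMost[symmetric]
    by (simp add: l_def coeff_map_poly add_eq_0_iff)
  \<comment> \<open>Multiplication by \<open>y\<close> raises the exponent \<open>j\<close>; when it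
    reaches \<open>d\<close>, the relation \<open>top\<close> lowers it again after division by the
    nonzero scalar \<open>l\<close>.\<close>
  define U where "U = (\<lambda>(j, w). y ^ j * w) ` ({..<d} \<times> W)"
  have U: "y ^ j * w \<in> ac.span U" if "j < d" "w \<in> ac.span W" for j w
    using that(2)
  proof (rule ac.linear_maps_span[OF _ ac_mult_linear])
    fix s assume "s \<in> W"
    with that(1) show "y ^ j * s \<in> ac.span U" by (intro ac.span_base) (auto simp: U_def)
  qed
  have closed: "z * w \<in> ac.span U"
    if "\<And>j w. j < d \<Longrightarrow> w \<in> W \<Longrightarrow> z * (y ^ j * w) \<in> ac.span U" "w \<in> ac.span U" for z w
    using that(2) by (rule ac.linear_maps_span[OF _ ac_mult_linear]) (use that(1) in \<open>auto simp: U_def\<close>)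
  have old: "z * w \<in> ac.span U" if z: "z \<in> Y" and w: "w \<in> ac.span U" for z w
  proof (rule closed[OF _ w])
    fix j w assume jw: "j < d" "w \<in> W"
    then have "y ^ j * (z * w) \<in> ac.span U" by (intro U W(3) z ac.span_base)
    then show "z * (y ^ j * w) \<in> ac.span U" by (simp add: mult.left_commute)
  qed
  have new: "y * w \<in> ac.span U" if w: "w \<in> ac.span U" for w
  proof (rule closed[OF _ w])
    fix j w assume jw: "j < d" "w \<in> W"
    show "y * (y ^ j * w) \<in> ac.span U"
    proof (cases "Suc j < d")
      case True
      then show ?thesis using U[of "Suc j" w] jw by (simp add: ac.span_base mult.assoc)
    next
      case False
      then have "y * (y ^ j * w) = y ^ d * w" using jw by (metis Suc_lessI mult.assoc power_Suc)
      also have "y ^ d = to_ac (inverse l) * (to_ac l * y ^ d)"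
        using l0 by (simp flip: mult.assoc)
      also have "\<dots> * w = ac_scale (inverse l) (- (\<Sum>i<d. ac_scale (poly.coeff p i) (y ^ i * w)))"
        unfolding top by (simp add: sum_distrib_right mult.assoc)
      also have "\<dots> \<in> ac.span U"
        using jw by (intro ac.span_scale ac.span_neg ac.span_sum U ac.span_base) auto
      finally show ?thesis .
    qed
  qed
  have "1 \<in> ac.span U" using U[of 0 1] W(2) \<open>d \<noteq> 0\<close> by simp
  moreover have "finite U" using W(1) by (simp add: U_def)
  ultimately show ?case using old new by (intro exI[of _ U]) auto
qed

text \<open>Subtracting the constant term, itself fixed by Frobenius, leaves a fixed series
  \<open>e\<close> without constant term. If \<open>e\<close> is nonzero, a power map with exponent
  greater than 1 multiplies its order by that exponent, so the order is 0, which contradicts the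
  missing constant term.\<close>

lemma fls_frobenius_fixed_const:
  fixes c :: "'k::field prime_field fls"
  assumes char: "CHAR('k) > 0" and r: "r > 0" and c: "c ^ (CHAR('k) ^ r) = c"
  shows "c = fls_const (fls_nth c 0)"
proof (rule ccontr)
  assume neq: "c \<noteq> fls_const (fls_nth c 0)"
  define e where "e = c - fls_const (fls_nth c 0)"
  have CH: "CHAR('k prime_field fls) = CHAR('k)" by (simp add: CHAR_prime_field)
  have "fls_nth c 0 ^ (CHAR('k) ^ (1 * r)) = fls_nth c 0"
    using frobenius_iterate[of "fls_nth c 0" 1 r] prime_field_frobenius[OF char] by (simp add: CHAR_prime_field)
  then have "fls_const (fls_nth c 0) ^ (CHAR('k) ^ r) = fls_const (fls_nth c 0)"
    by (simp flip: fls_const_power)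
  then have ee: "e ^ (CHAR('k) ^ r) = e"
    using frobenius_diff[of c "fls_const (fls_nth c 0)" r] char c unfolding e_def CH by simp
  have e0: "e \<noteq> 0" using neq by (simp add: e_def)
  have "int (CHAR('k) ^ r) * fls_subdegree e = fls_subdegree e"
    using fls_subdegree_pow[of e "CHAR('k) ^ r"] ee by simp
  moreover have "CHAR('k) ^ r \<noteq> 1"
    using prime_CHAR_field[OF char] r by (simp add: power_eq_1_iff prime_nat_iff)
  then have "int (CHAR('k) ^ r) \<noteq> 1" by (simp del: of_nat_power)
  ultimately have "fls_subdegree e = 0" by (simp del: of_nat_power)
  moreover have "fls_nth e 0 = 0" by (simp add: e_def)
  ultimately show False using nth_fls_subdegree_nonzero[OF e0] by simp
qed

text \<open>If \<open>z ^ q = z\<close>, the \<open>q\<close>-th power of the minimal relation satisfied by \<open>z\<close> is again the minimal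
  relation, so its coefficients are constants.\<close>

lemma finite_frobenius_periodic_multipliers:
  fixes W :: "'k::field prime_field fls alg_closure set"
  assumes char: "CHAR('k) > 0" and W: "finite W" "1 \<in> ac.span W"
  shows "finite {z. frobenius_periodic z \<and> (\<forall>w\<in>ac.span W. z * w \<in> ac.span W)}"
proof -
  define N where "N = card W"
  define C where "C = range (\<lambda>k :: 'k prime_field. to_ac (fls_const k))"
  \<comment> \<open>Finitely many polynomials, with degree at most \<open>N\<close> and coefficients
    from the prime field; each of the elements in question is shown to be a root of a nonzero
    one.\<close>
  define Q where "Q = (\<lambda>c. \<Sum>i\<le>N. Polynomial.monom (c i) i) ` ({..N} \<rightarrow>\<^sub>E C)"
  have CH: "CHAR('k prime_field fls) = CHAR('k)" "CHAR('k prime_field fls alg_closure) = CHAR('k)"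
    by (simp_all add: CHAR_prime_field)
  have "finite C" unfolding C_def using finite_prime_field[OF char] by simp
  then have finQ: "finite Q" unfolding Q_def by (intro finite_imageI finite_PiE) auto
  have "z \<in> (\<Union>q\<in>Q - {0}. {z. poly q z = 0})"
    if z: "frobenius_periodic z" "\<And>w. w \<in> ac.span W \<Longrightarrow> z * w \<in> ac.span W" for z
  proof -
    obtain r where r: "r > 0" "z ^ (CHAR('k) ^ r) = z"
      using z(1) unfolding frobenius_periodic_def CH(2) by blast
    \<comment> \<open>This is where the degree bound becomes uniform in \<open>z\<close>: the powers
      of \<open>z\<close> all lie in one space spanned by \<open>N\<close> elements.\<close>
    have zW: "z ^ i \<in> ac.span W" for i
      by (induction i) (use W z(2) in auto)
    define rel where "rel d \<longleftrightarrow> (\<exists>c. c d = 1 \<and> (\<Sum>i\<le>d. to_ac (c i) * z ^ i) = 0)" for d :: nat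
    have relI: "\<exists>d\<le>n. rel d" if c: "\<exists>i\<le>n. c i \<noteq> 0" "(\<Sum>i\<le>n. to_ac (c i) * z ^ i) = 0" for c and n :: nat
    proof -
      define d where "d = Max {i \<in> {..n}. c i \<noteq> 0}"
      have d: "d \<in> {i \<in> {..n}. c i \<noteq> 0}" unfolding d_def using c by (intro Max_in) auto
      have beyond: "c i = 0" if "i \<le> n" "i > d" for i
      proof (rule ccontr)
        assume "c i \<noteq> 0"
        then have "i \<le> d" unfolding d_def using that(1) by (intro Max_ge) auto
        with that(2) show False by simp
      qed
      have "(\<Sum>i\<le>d. to_ac (c i) * z ^ i) = (\<Sum>i\<le>n. to_ac (c i) * z ^ i)"
        using d beyond by (intro sum.mono_neutral_left) auto
      then have "(\<Sum>i\<le>d. to_ac (c i / c d) * z ^ i) = 0"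
        using c(2) by (simp add: sum_divide_distrib[symmetric])
      with d show ?thesis unfolding rel_def by (intro exI[of _ d] conjI exI[of _ "\<lambda>i. c i / c d"]) auto
    qed
    obtain c0 where c0: "\<exists>i\<le>N. c0 i \<noteq> 0" "(\<Sum>i\<le>N. to_ac (c0 i) * z ^ i) = 0"
      by (rule ac.ex_linear_relation[OF W(1) zW, folded N_def])
    from relI[OF c0] obtain d0 where d0: "d0 \<le> N" "rel d0" by blast
    define d where "d = (LEAST d. rel d)"
    have d: "rel d" "d \<le> N" 
      using LeastI[of rel d0] Least_le[of rel d0] d0 unfolding d_def by auto
    obtain c where c: "c d = 1" "(\<Sum>i\<le>d. to_ac (c i) * z ^ i) = 0" using d(1) by (auto simp: rel_def)
    have "(\<Sum>i\<le>d. to_ac (c i) * z ^ i) ^ (CHAR('k) ^ r) =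
        (\<Sum>i\<le>d. (to_ac (c i) * z ^ i) ^ (CHAR('k) ^ r))"
      using freshmans_dream_sum'[where 'a = "'k prime_field fls alg_closure"]
        prime_CHAR_field[where 'f = "'k prime_field fls alg_closure"] char unfolding CH by blast
    also have "\<dots> = (\<Sum>i\<le>d. to_ac (c i ^ (CHAR('k) ^ r)) * z ^ i)"
    proof (intro sum.cong refl)
      fix i
      have "(z ^ i) ^ (CHAR('k) ^ r) = z ^ i" by (metis r(2) power_mult mult.commute)
      then show "(to_ac (c i) * z ^ i) ^ (CHAR('k) ^ r) = to_ac (c i ^ (CHAR('k) ^ r)) * z ^ i"
        by (simp add: power_mult_distrib)
    qed
    finally have "(\<Sum>i\<le>d. to_ac (c i ^ (CHAR('k) ^ r)) * z ^ i) = 0"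
      using c(2) char by (simp add: zero_power)
    then have diff: "(\<Sum>i\<le>d. to_ac (c i - c i ^ (CHAR('k) ^ r)) * z ^ i) = 0"
      using c(2) by (simp add: left_diff_distrib sum_subtractf)
    have const: "c i ^ (CHAR('k) ^ r) = c i" if "i \<le> d" for i
    proof (rule ccontr)
      assume neq: "c i ^ (CHAR('k) ^ r) \<noteq> c i"
      then have "i \<noteq> d" using c(1) by auto
      then obtain e where e: "d = Suc e" "i \<le> e" using \<open>i \<le> d\<close> by (cases d) auto
      have "(\<Sum>i\<le>e. to_ac (c i - c i ^ (CHAR('k) ^ r)) * z ^ i) = 0"
        using diff c(1) by (simp add: e(1))
      moreover have "\<exists>i\<le>e. c i - c i ^ (CHAR('k) ^ r) \<noteq> 0" using neq e(2) by auto
      ultimately obtain d' where "d' \<le> e" "rel d'" using relI[of e "\<lambda>i. c i - c i ^ (CHAR('k) ^ r)"] by blast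
      then show False using Least_le[of rel d'] e(1) unfolding d_def[symmetric] by simp
    qed
    define b where "b = (\<lambda>i\<in>{..N}. if i \<le> d then to_ac (c i) else 0)"
    have "b \<in> {..N} \<rightarrow>\<^sub>E C"
    proof (intro PiE_I)
      fix i assume "i \<in> {..N}"
      moreover have "to_ac (c i) \<in> C" if "i \<le> d"
        unfolding C_def using fls_frobenius_fixed_const[OF char r(1) const[OF that]] by (metis rangeI)
      moreover have "0 \<in> C" unfolding C_def by (intro range_eqI[of _ _ 0]) simp
      ultimately show "b i \<in> C" by (auto simp: b_def)
    qed (auto simp: b_def)
    then have "(\<Sum>i\<le>N. Polynomial.monom (b i) i) \<in> Q" unfolding Q_def by blast
    moreover have "poly.coeff (\<Sum>i\<le>N. Polynomial.monom (b i) i) d = 1"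
      using d(2) c(1) by (simp add: coeff_sum b_def)
    then have "(\<Sum>i\<le>N. Polynomial.monom (b i) i) \<noteq> 0" by auto
    moreover have "poly (\<Sum>i\<le>N. Polynomial.monom (b i) i) z = 0"
    proof -
      have "poly (\<Sum>i\<le>N. Polynomial.monom (b i) i) z = (\<Sum>i\<le>N. b i * z ^ i)"
        by (simp add: poly_sum poly_monom)
      also have "\<dots> = (\<Sum>i\<le>d. to_ac (c i) * z ^ i)"
        using d(2) by (intro sum.mono_neutral_cong_right) (auto simp: b_def)
      finally show ?thesis using c(2) by simp
    qed
    ultimately show ?thesis by blast
  qed
  then have "{z. frobenius_periodic z \<and> (\<forall>w\<in>ac.span W. z * w \<in> ac.span W)} \<subseteq>
      (\<Union>q\<in>Q - {0}. {z. poly q z = 0})" by blast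
  moreover have "finite (\<Union>q\<in>Q - {0}. {z. poly q z = 0})"
    using finQ by (auto intro: poly_roots_finite)
  ultimately show ?thesis by (rule finite_subset)
qed

section \<open>The trace as a sum of eigenvalues\<close>

lemma coeff_prod_mset_linear:
  fixes M :: "'a::comm_ring_1 multiset"
  shows "poly.coeff (\<Prod>x\<in>#M. [:- x, 1:]) (size M) = 1 \<and>
    (\<forall>k. size M = Suc k \<longrightarrow> poly.coeff (\<Prod>x\<in>#M. [:- x, 1:]) k = - sum_mset M)"
proof (induction M)
  case (add x M)
  define P where "P = (\<Prod>x\<in>#M. [:- x, 1:])"
  have P: "(\<Prod>x\<in>#add_mset x M. [:- x, 1:]) = Polynomial.smult (- x) P + pCons 0 P"
    by (simp add: P_def)
  have deg: "Polynomial.degree P \<le> size M"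
    unfolding P_def
  proof (induction M)
    case (add x M)
    have "Polynomial.degree ([:- x, 1:] * (\<Prod>x\<in>#M. [:- x, 1:])) \<le> 1 + size M"
      using degree_mult_le[of "[:- x, 1:]" "\<Prod>x\<in>#M. [:- x, 1:]"] add by simp
    then show ?case by (simp only: image_mset_add_mset prod_mset.add_mset size_add_mset plus_1_eq_Suc)
  qed simp
  have "poly.coeff P (Suc (size M)) = 0" using deg by (intro coeff_eq_0) simp
  moreover have "poly.coeff (Polynomial.smult (- x) P + pCons 0 P) (size M) = - sum_mset (add_mset x M)"
    using add.IH unfolding P_def[symmetric] by (cases "size M") (auto simp: coeff_pCons)
  ultimately show ?case
    unfolding P using add.IH unfolding P_def[symmetric] by simp
qed simp

text \<open>In the Leibniz expansion a permutation other than the identity moves at least two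
  indices. Its product then contains at most \<open>n - 1\<close> linear factors and does not reach
  the coefficient at \<open>n\<close>.\<close>

lemma coeff_char_poly_trace:
  fixes A :: "'a::idom mat"
  assumes A: "A \<in> carrier_mat (Suc n) (Suc n)"
  shows "poly.coeff (char_poly A) n = - (\<Sum>i<Suc n. A $$ (i, i))"
proof -
  define B where "B = [:0, 1:] \<cdot>\<^sub>m 1\<^sub>m (dim_row A) + map_mat (\<lambda>a. [:- a:]) A"
  have B: "B \<in> carrier_mat (Suc n) (Suc n)" using A by (auto simp: B_def)
  have Bij: "B $$ (i, j) = (if i = j then [:- A $$ (i, i), 1:] else [:- A $$ (i, j):])"
    if "i < Suc n" "j < Suc n" for i j
    using A that by (auto simp: B_def)
  have small: "poly.coeff (signof p * (\<Prod>i = 0..<Suc n. B $$ (i, p i))) n = 0"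
    if p: "p permutes {0..<Suc n}" "p \<noteq> id" for p
  proof -
    obtain i where i: "p i \<noteq> i" using p(2) by (auto simp: fun_eq_iff)
    then have iS: "i \<in> {0..<Suc n}" using p(1) by (auto simp: permutes_def)
    have pi: "p (p i) \<noteq> p i" using i permutes_inj[OF p(1)] by (auto simp: inj_eq)
    have piS: "p i \<in> {0..<Suc n}" using iS permutes_in_image[OF p(1)] by blast
    have "Polynomial.degree (\<Prod>i = 0..<Suc n. B $$ (i, p i)) \<le>
        (\<Sum>i = 0..<Suc n. Polynomial.degree (B $$ (i, p i)))"
      using degree_prod_sum_le[of "{0..<Suc n}" "\<lambda>i. B $$ (i, p i)"] by (simp add: o_def)
    also have "\<dots> \<le> (\<Sum>i = 0..<Suc n. if p i = i then 1 else 0)"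
    proof (intro sum_mono)
      fix j assume j: "j \<in> {0..<Suc n}"
      then have "p j < Suc n" using permutes_in_image[OF p(1)] by force
      with j show "Polynomial.degree (B $$ (j, p j)) \<le> (if p j = j then 1 else 0)"
        by (auto simp: Bij)
    qed
    also have "\<dots> = card {j \<in> {0..<Suc n}. p j = j}" 
      by (simp add: sum.If_cases Int_def del: sum.op_ivl_Suc)
    also have "\<dots> \<le> card ({0..<Suc n} - {i, p i})"
      using i pi by (intro card_mono) auto
    also have "\<dots> = Suc n - 2" using i iS piS by (subst card_Diff_subset) auto
    finally have "Polynomial.degree (signof p * (\<Prod>i = 0..<Suc n. B $$ (i, p i))) \<le> Suc n - 2" by simp
    moreover have "n > 0" using i iS piS by (cases n) auto
    ultimately show ?thesis by (intro coeff_eq_0) simp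
  qed
  have "poly.coeff (char_poly A) n =
      (\<Sum>p\<in>{p. p permutes {0..<Suc n}}. poly.coeff (signof p * (\<Prod>i = 0..<Suc n. B $$ (i, p i))) n)"
    unfolding char_poly_defs B_def[symmetric] det_def'[OF B] by (simp add: coeff_sum)
  also have "\<dots> = (\<Sum>p\<in>{id}. poly.coeff (signof p * (\<Prod>i = 0..<Suc n. B $$ (i, p i))) n)"
    using small by (intro sum.mono_neutral_right) (auto simp: finite_permutations permutes_id)
  also have "\<dots> = poly.coeff (\<Prod>i = 0..<Suc n. [:- A $$ (i, i), 1:]) n"
    by (simp add: Bij del: prod.op_ivl_Suc)
  also have "(\<Prod>i = 0..<Suc n. [:- A $$ (i, i), 1:]) =
      (\<Prod>x\<in>#image_mset (\<lambda>i. A $$ (i, i)) (mset_set {0..<Suc n}). [:- x, 1:])"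
    by (simp add: prod_unfold_prod_mset image_mset.compositionality o_def del: prod.op_ivl_Suc)
  also have "poly.coeff \<dots> n = - sum_mset (image_mset (\<lambda>i. A $$ (i, i)) (mset_set {0..<Suc n}))"
    using coeff_prod_mset_linear[of "image_mset (\<lambda>i. A $$ (i, i)) (mset_set {0..<Suc n})"] by simp
  also have "\<dots> = - (\<Sum>i<Suc n. A $$ (i, i))"
    by (simp only: sum_unfold_sum_mset[symmetric] lessThan_atLeast0)
  finally show ?thesis .
qed

text \<open>Over an algebraically closed field the trace is the sum of the roots of the
  characteristic polynomial; these are eigenvalues, and sums of periodic elements are periodic. The
  finite index set is enumerated in order to pass to matrices with numerical indices.\<close>

lemma frobenius_periodic_trace:
  fixes a :: "'i \<Rightarrow> 'i \<Rightarrow> 'l::alg_closed_field"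
  assumes char: "CHAR('l) > 0" and I: "finite I"
    and eigen: "\<And>e x. \<exists>i\<in>I. x i \<noteq> 0 \<Longrightarrow> \<forall>i\<in>I. (\<Sum>j\<in>I. a i j * x j) = e * x i \<Longrightarrow> frobenius_periodic e"
  shows "frobenius_periodic (\<Sum>i\<in>I. a i i)"
proof (cases "I = {}")
  case True
  then show ?thesis using frobenius_periodic_0[OF char] by simp
next
  case False
  then obtain n where n: "card I = Suc n" using I by (metis card_eq_0_iff not0_implies_Suc)
  obtain h where h: "bij_betw h {0..<Suc n} I" using ex_bij_betw_nat_finite[OF I] n by auto
  define A where "A = mat (Suc n) (Suc n) (\<lambda>(i, j). a (h i) (h j))"
  have A: "A \<in> carrier_mat (Suc n) (Suc n)" by (simp add: A_def)
  have monic: "Polynomial.lead_coeff (char_poly A) = 1" "Polynomial.degree (char_poly A) = Suc n"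
    using degree_monic_char_poly[OF A] by auto
  then have "char_poly A \<noteq> 0" by auto
  then obtain M where M: "size M = Suc n" "char_poly A = (\<Prod>x\<in>#M. [:- x, 1:])"
    using alg_closed_imp_factorization[of "char_poly A"] monic by auto
  have "frobenius_periodic e" if e: "e \<in># M" for e
  proof -
    have "poly (char_poly A) e = 0"
      unfolding M(2) using e by (simp add: poly_prod_mset prod_mset_zero_iff image_iff)
    then have "eigenvalue A e" by (simp add: eigenvalue_root_char_poly[OF A])
    then obtain v where v: "v \<in> carrier_vec (Suc n)" "v \<noteq> 0\<^sub>v (Suc n)" "A *\<^sub>v v = e \<cdot>\<^sub>v v"
      using A by (auto simp: eigenvalue_def eigenvector_def)
    define x where "x i = v $ inv_into {0..<Suc n} h i" for i
    have xh: "x (h k) = v $ k" if "k < Suc n" for k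
      using that h by (simp add: x_def bij_betw_def inv_into_f_f)
    obtain k where k: "k < Suc n" "v $ k \<noteq> 0" using v(1,2) by (auto simp: vec_eq_iff)
    show ?thesis
    proof (rule eigen[of x])
      show "\<exists>i\<in>I. x i \<noteq> 0" using k h xh by (intro bexI[of _ "h k"]) (auto simp: bij_betw_def)
      show "\<forall>i\<in>I. (\<Sum>j\<in>I. a i j * x j) = e * x i"
      proof
        fix i assume "i \<in> I"
        then obtain m where m: "m < Suc n" "i = h m" using h by (auto simp: bij_betw_def)
        have "(\<Sum>j\<in>I. a i j * x j) = (\<Sum>k = 0..<Suc n. a i (h k) * x (h k))"
          using sum.reindex_bij_betw[OF h, of "\<lambda>j. a i j * x j"] by (rule sym)
        also have "\<dots> = (\<Sum>k = 0..<Suc n. A $$ (m, k) * v $ k)"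
          using m by (intro sum.cong) (auto simp: A_def xh)
        also have "\<dots> = (A *\<^sub>v v) $ m"
          using m v(1) A by (simp add: mult_mat_vec_def scalar_prod_def del: sum.op_ivl_Suc)
        also have "\<dots> = e * x i" using m v by (simp add: xh)
        finally show "(\<Sum>j\<in>I. a i j * x j) = e * x i" .
      qed
    qed
  qed
  then have "frobenius_periodic (sum_mset M)"
    by (induction M) (auto simp: frobenius_periodic_0[OF char] frobenius_periodic_add[OF char])
  moreover have "(\<Sum>i\<in>I. a i i) = (\<Sum>i<Suc n. A $$ (i, i))"
  proof -
    have "(\<Sum>i\<in>I. a i i) = (\<Sum>k = 0..<Suc n. a (h k) (h k))"
      using sum.reindex_bij_betw[OF h, of "\<lambda>i. a i i"] by (rule sym)
    also have "\<dots> = (\<Sum>i<Suc n. A $$ (i, i))"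
      unfolding lessThan_atLeast0 by (intro sum.cong) (auto simp: A_def)
    finally show ?thesis .
  qed
  moreover have "- (\<Sum>i<Suc n. A $$ (i, i)) = - sum_mset M"
    using coeff_char_poly_trace[OF A] coeff_prod_mset_linear[of M] M by simp
  ultimately show ?thesis by (simp only: neg_equal_iff_equal)
qed

section \<open>Eigenvalues and traces of the representation\<close>

lemma sum_fun_apply: "(\<Sum>i\<in>A. f i) x = (\<Sum>i\<in>A. f i x)"
  by (induction A rule: infinite_finite_induct) simp_all

text \<open>Indices come from an arbitrary finite set because the index set will later be a set of
  basis vectors. The entries are constrained only for indices in \<open>I\<close>.\<close>

locale matrix_representation = group G for G (structure) +
  fixes I :: "'i set" and \<sigma> :: "'a \<Rightarrow> 'i \<Rightarrow> 'i \<Rightarrow> 'l::field"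
  assumes finite_I: "finite I"
    and \<sigma>_mult: "g \<in> carrier G \<Longrightarrow> h \<in> carrier G \<Longrightarrow> i \<in> I \<Longrightarrow> j \<in> I \<Longrightarrow>
      \<sigma> (g \<otimes> h) i j = (\<Sum>k\<in>I. \<sigma> g i k * \<sigma> h k j)"
    and \<sigma>_one: "i \<in> I \<Longrightarrow> j \<in> I \<Longrightarrow> \<sigma> \<one> i j = (if i = j then 1 else 0)"
begin

text \<open>All matrix entries, transported by \<open>f\<close>, multiply the span of
  \<open>W\<close> into itself. The representation can thus be read over the small field
  \<open>'e\<close>, on families of elements of that span indexed by \<open>I\<close>;
  \<open>S\<close> holds further elements to be carried along.\<close>

definition bounded_embedding ::
  "'l set \<Rightarrow> 'l set \<Rightarrow> ('l \<Rightarrow> 'e::field alg_closure) \<Rightarrow> 'e alg_closure set \<Rightarrow> bool" where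
  "bounded_embedding S A f W \<longleftrightarrow> subring_embedding A f \<and> S \<subseteq> A \<and>
    (\<forall>g\<in>carrier G. \<forall>i\<in>I. \<forall>j\<in>I. \<sigma> g i j \<in> A) \<and> finite W \<and> 1 \<in> ac.span W \<and>
    (\<forall>x\<in>S. \<forall>w\<in>ac.span W. f x * w \<in> ac.span W) \<and>
    (\<forall>g\<in>carrier G. \<forall>i\<in>I. \<forall>j\<in>I. \<forall>w\<in>ac.span W. f (\<sigma> g i j) * w \<in> ac.span W)"

lemma bounded_embeddingD:
  assumes "bounded_embedding S A f W"
  shows "subring_embedding A f" "S \<subseteq> A"
    "\<And>g i j. g \<in> carrier G \<Longrightarrow> i \<in> I \<Longrightarrow> j \<in> I \<Longrightarrow> \<sigma> g i j \<in> A"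
    "finite W" "1 \<in> ac.span W" "\<And>x w. x \<in> S \<Longrightarrow> w \<in> ac.span W \<Longrightarrow> f x * w \<in> ac.span W"
    "\<And>g i j w. g \<in> carrier G \<Longrightarrow> i \<in> I \<Longrightarrow> j \<in> I \<Longrightarrow> w \<in> ac.span W \<Longrightarrow> f (\<sigma> g i j) * w \<in> ac.span W"
  using assms unfolding bounded_embedding_def by auto

text \<open>Only \<open>S\<close> and the entries of the generators have to be adjoined: the
  remaining entries are sums of products of these, by induction over products of generators.\<close>

lemma ex_bounded_embedding:
  fixes f0 :: "'l \<Rightarrow> 'e::field fls alg_closure"
  assumes fg: "finitely_generated_group G"
    and f0: "subring_embedding A0 f0" "countable A0" and "finite S"
  shows "\<exists>A f W. bounded_embedding S A f W \<and> A0 \<subseteq> A \<and> (\<forall>x\<in>A0. f x = f0 x)"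
proof -
  obtain T where T: "finite T" "T \<subseteq> carrier G"
    and gen: "\<And>P x. x \<in> carrier G \<Longrightarrow> P \<one> \<Longrightarrow> (\<And>s. s \<in> T \<Longrightarrow> P s) \<Longrightarrow>
      (\<And>x y. x \<in> carrier G \<Longrightarrow> y \<in> carrier G \<Longrightarrow> P x \<Longrightarrow> P y \<Longrightarrow> P (x \<otimes> y)) \<Longrightarrow> P x"
    using generating_set_closed_under_inverse[OF fg] by blast
  define E where "E = (\<lambda>(s, i, j). \<sigma> s i j) ` (T \<times> I \<times> I)"
  have "finite (S \<union> E)" using \<open>finite S\<close> T finite_I by (simp add: E_def)
  from extend_embedding_finite[OF uncountable_fls_alg_closure this f0]
  obtain A f where Af: "subring_embedding A f" "A0 \<subseteq> A" "S \<union> E \<subseteq> A" "\<forall>x\<in>A0. f x = f0 x"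
    by blast
  note simps = subring_embedding_simps[OF Af(1)] subring_embedding_sum[OF Af(1)]
  have "finite (f ` (S \<union> E))" using \<open>finite (S \<union> E)\<close> by simp
  from ex_finite_span_closed_mult[OF this]
  obtain W where W: "finite W" "1 \<in> ac.span W"
      "\<And>y w. y \<in> f ` (S \<union> E) \<Longrightarrow> w \<in> ac.span W \<Longrightarrow> y * w \<in> ac.span W"
    by blast
  have *: "\<forall>i\<in>I. \<forall>j\<in>I. \<sigma> g i j \<in> A \<and> (\<forall>w\<in>ac.span W. f (\<sigma> g i j) * w \<in> ac.span W)"
    if "g \<in> carrier G" for g
    using that
  proof (rule gen)
    show "\<forall>i\<in>I. \<forall>j\<in>I. \<sigma> \<one> i j \<in> A \<and> (\<forall>w\<in>ac.span W. f (\<sigma> \<one> i j) * w \<in> ac.span W)"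
      by (auto simp: \<sigma>_one simps ac.span_zero)
    fix s assume "s \<in> T"
    then have "\<sigma> s i j \<in> E" if "i \<in> I" "j \<in> I" for i j using that by (force simp: E_def)
    then show "\<forall>i\<in>I. \<forall>j\<in>I. \<sigma> s i j \<in> A \<and> (\<forall>w\<in>ac.span W. f (\<sigma> s i j) * w \<in> ac.span W)"
      using Af(3) W(3) by blast
  next
    fix g h
    assume gh: "g \<in> carrier G" "h \<in> carrier G"
      "\<forall>i\<in>I. \<forall>j\<in>I. \<sigma> g i j \<in> A \<and> (\<forall>w\<in>ac.span W. f (\<sigma> g i j) * w \<in> ac.span W)"
      "\<forall>i\<in>I. \<forall>j\<in>I. \<sigma> h i j \<in> A \<and> (\<forall>w\<in>ac.span W. f (\<sigma> h i j) * w \<in> ac.span W)"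
    show "\<forall>i\<in>I. \<forall>j\<in>I. \<sigma> (g \<otimes> h) i j \<in> A \<and> (\<forall>w\<in>ac.span W. f (\<sigma> (g \<otimes> h) i j) * w \<in> ac.span W)"
    proof (intro ballI conjI)
      fix i j assume ij: "i \<in> I" "j \<in> I"
      have s: "\<sigma> g i k * \<sigma> h k j \<in> A" if "k \<in> I" for k using gh ij that by (simp add: simps)
      show "\<sigma> (g \<otimes> h) i j \<in> A" unfolding \<sigma>_mult[OF gh(1,2) ij] by (intro simps s)
      fix w assume w: "w \<in> ac.span W"
      have "f (\<sigma> (g \<otimes> h) i j) * w = (\<Sum>k\<in>I. f (\<sigma> g i k) * (f (\<sigma> h k j) * w))"
        unfolding \<sigma>_mult[OF gh(1,2) ij] using s gh ij
        by (simp add: simps sum_distrib_right mult.assoc)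
      also have "\<dots> \<in> ac.span W" using gh ij w by (intro ac.span_sum) auto
      finally show "f (\<sigma> (g \<otimes> h) i j) * w \<in> ac.span W" .
    qed
  qed
  show ?thesis
    unfolding bounded_embedding_def
    by (intro exI[of _ A] exI[of _ f] exI[of _ W]) (use Af * W in auto)
qed

lemma frobenius_periodic_eigenvalue:
  assumes fg: "finitely_generated_group G" and ocn: "outer_commensurator_normalizer G"
    and char: "CHAR('l) > 0" and g: "g \<in> carrier G"
    and x: "\<exists>i\<in>I. x i \<noteq> 0" "\<forall>i\<in>I. (\<Sum>j\<in>I. \<sigma> g i j * x j) = e * x i"
  shows "frobenius_periodic e"
proof (rule ccontr)
  assume e: "\<not> frobenius_periodic e"
  define t where "t = (to_ac fls_X_inv :: 'l prime_field fls alg_closure)"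
  have CH: "CHAR('l) = CHAR('l prime_field fls alg_closure)" by (simp add: CHAR_prime_field)
  \<comment> \<open>An iterate of Frobenius multiplies the order -1 of this element by a power of
    the characteristic greater than 1.\<close>
  have "\<not> frobenius_periodic t"
  proof
    assume "frobenius_periodic t"
    then obtain r where r: "r > 0" "t ^ (CHAR('l) ^ r) = t"
      unfolding frobenius_periodic_def CH[symmetric] by blast
    have "(fls_X_inv :: 'l prime_field fls) ^ (CHAR('l) ^ r) = fls_X_inv"
      using r(2) unfolding t_def to_ac_power[symmetric] to_ac_eq_iff .
    then have "- int (CHAR('l) ^ r) = - 1"
      by (metis fls_subdegree_fls_X_inv_pow fls_X_inv_subdegree)
    then have "CHAR('l) ^ r = 1" by (metis minus_equation_iff of_nat_eq_1_iff add.inverse_inverse)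
    then show False using prime_CHAR_field[OF char] r by (simp add: power_eq_1_iff prime_nat_iff)
  qed
  then obtain A0 f0 where f0: "subring_embedding A0 f0" "countable A0" "e \<in> A0" "f0 e = t"
    using transcendental_embedding[OF CH char e] by metis
  \<comment> \<open>The coordinates of the eigenvector are adjoined too, so that \<open>f\<close>
    turns it into an eigenvector of the transported matrix with eigenvalue
    \<open>f e\<close>.\<close>
  have "finite (x ` I)" using finite_I by simp
  from ex_bounded_embedding[OF fg f0(1,2) this]
  obtain A f W where bounded: "bounded_embedding (x ` I) A f W" "A0 \<subseteq> A" "\<And>y. y \<in> A0 \<Longrightarrow> f y = f0 y"
    by blast
  note f = bounded_embeddingD(1-3)[OF bounded(1)] and W = bounded_embeddingD(4-7)[OF bounded(1)]
  note simps = subring_embedding_simps[OF f(1)] subring_embedding_sum[OF f(1)]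
  define scale where "scale c v = (\<lambda>i :: 'i. to_ac c * v i)"
    for c :: "'l prime_field fls" and v
  interpret V: vector_space scale
    by standard (auto simp: scale_def algebra_simps)
  \<comment> \<open>Restriction of scalars: the families supported on \<open>I\<close> with entries
    in the span of \<open>W\<close> form a finite-dimensional space over the Laurent series, spanned
    by \<open>U\<close>.\<close>
  define single where "single i w = (\<lambda>j. if j = i then w else 0)" for i :: 'i and w :: "'l prime_field fls alg_closure"
  define U where "U = (\<lambda>(i, w). single i w) ` (I \<times> W)"
  define act where "act g v = (\<lambda>i. if i \<in> I then \<Sum>j\<in>I. f (\<sigma> g i j) * v j else 0)" for g and v :: "'i \<Rightarrow> 'l prime_field fls alg_closure"
  have single_span: "single i w \<in> V.span U" if i: "i \<in> I" and w: "w \<in> ac.span W" for i w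
    using w
  proof (induction rule: ac.span_induct_alt)
    case base
    have "single i 0 = 0" by (auto simp: single_def)
    then show ?case using V.span_zero[of U] by (simp only:)
  next
    case (step c w v)
    have "single i w \<in> V.span U" using i step by (intro V.span_base) (auto simp: U_def)
    moreover have eq: "single i (to_ac c * w + v) = scale c (single i w) + single i v"
      by (auto simp: single_def scale_def)
    ultimately show ?case unfolding eq using step by (intro V.span_add V.span_scale)
  qed
  have spanI: "v \<in> V.span U" if "\<And>i. i \<in> I \<Longrightarrow> v i \<in> ac.span W" "\<And>i. i \<notin> I \<Longrightarrow> v i = 0" for v
  proof -
    have "v = (\<Sum>i\<in>I. single i (v i))"
    proof
      fix j
      have "(\<Sum>i\<in>I. single i (v i)) j = (\<Sum>i\<in>I. if j = i then v i else 0)"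
        by (simp add: single_def sum_fun_apply)
      then show "v j = (\<Sum>i\<in>I. single i (v i)) j" using finite_I that(2) by auto
    qed
    also have "\<dots> \<in> V.span U" using that(1) by (intro V.span_sum single_span)
    finally show ?thesis .
  qed
  have support: "v i = 0" if "v \<in> V.span U" "i \<notin> I" for v i
    using that by (induction rule: V.span_induct_alt) (auto simp: U_def single_def scale_def split: if_splits)
  define v where "v = (\<lambda>i. if i \<in> I then f (x i) else 0)"
  have "v = 0"
  proof (rule no_expanding_eigenvector[where G = G and scale = scale and act = act and W = U and g = g])
    show "finite (UNIV :: 'l prime_field set)" by (rule finite_prime_field[OF char])
    show "vector_space scale" by (rule V.vector_space_axioms)
    show "countable (carrier G)" by (rule countable_finitely_generated_group[OF fg])
    show "finite U" using finite_I W(1) by (simp add: U_def)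
    show "Vector_Spaces.linear scale scale (act h)" for h
      using V.vector_space_axioms unfolding Vector_Spaces.linear_iff
      by (auto simp: act_def scale_def distrib_left sum.distrib sum_distrib_left mult.left_commute)
    show "act h u \<in> V.span U" if h: "h \<in> carrier G" and uU: "u \<in> U" for h u
    proof -
      obtain j w where u: "u = single j w" "j \<in> I" "w \<in> W" using uU by (auto simp: U_def)
      have "act h u i = f (\<sigma> h i j) * w" if "i \<in> I" for i
        using that u(2) finite_I by (simp add: act_def u(1) single_def if_distrib cong: if_cong)
      then show ?thesis
        using u(2,3) W(4) h by (intro spanI) (auto simp: ac.span_base act_def)
    qed
    show "act \<one> u = u" if u: "u \<in> V.span U" for u
    proof
      fix i
      show "act \<one> u i = u i"
      proof (cases "i \<in> I")
        case True
        then have "act \<one> u i = (\<Sum>j\<in>I. if i = j then u j else 0)"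
          unfolding act_def by (auto simp: \<sigma>_one simps intro!: sum.cong)
        then show ?thesis using True finite_I by simp
      qed (use support[OF u] in \<open>simp add: act_def\<close>)
    qed
    show "act (g' \<otimes> h) u = act g' (act h u)"
      if gh: "g' \<in> carrier G" "h \<in> carrier G" for g' h u
    proof
      fix i
      show "act (g' \<otimes> h) u i = act g' (act h u) i"
      proof (cases "i \<in> I")
        case True
        have "act (g' \<otimes> h) u i = (\<Sum>j\<in>I. (\<Sum>k\<in>I. f (\<sigma> g' i k) * f (\<sigma> h k j)) * u j)"
          using True gh f(3) by (simp add: act_def \<sigma>_mult simps)
        also have "\<dots> = (\<Sum>k\<in>I. \<Sum>j\<in>I. f (\<sigma> g' i k) * f (\<sigma> h k j) * u j)"
          unfolding sum_distrib_right by (rule sum.swap)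
        also have "\<dots> = act g' (act h u) i"
          using True by (simp add: act_def sum_distrib_left mult.assoc)
        finally show ?thesis .
      qed (simp add: act_def)
    qed
    show "v \<in> V.span U"
      using W(2) W(3)[of _ 1] by (intro spanI) (auto simp: v_def)
    show "act g v = scale fls_X_inv v"
    proof
      fix i
      show "act g v i = scale fls_X_inv v i"
      proof (cases "i \<in> I")
        case True
        have xA: "x j \<in> A" if "j \<in> I" for j using f(2) that by auto
        have "act g v i = f (\<Sum>j\<in>I. \<sigma> g i j * x j)"
          using True g f(3) xA by (simp add: act_def v_def simps)
        also have "\<dots> = f (e * x i)" using x(2) True by simp
        also have "\<dots> = f e * f (x i)" using xA[OF True] f0(3) bounded(2) by (intro simps) auto
        also have "f e = to_ac fls_X_inv" using bounded(3)[OF f0(3)] f0(4) by (simp add: t_def)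
        finally show ?thesis using True by (simp add: scale_def v_def)
      qed (simp add: act_def scale_def v_def)
    qed
  qed (use g ocn group_axioms in auto)
  then have "f (x i) = 0" if "i \<in> I" for i using that by (auto simp: v_def fun_eq_iff split: if_splits)
  then have "x i = 0" if "i \<in> I" for i using simps(9)[of "x i"] f(2) that by auto
  with x(1) show False by blast
qed

end

text \<open>An embedding sends the traces to periodic elements that multiply a finite-dimensional
  space over the Laurent series into itself. There are finitely many of those, and the embedding is
  injective.\<close>

lemma (in matrix_representation) finite_traces:
  assumes fg: "finitely_generated_group G" and ocn: "outer_commensurator_normalizer G"
    and char: "CHAR('l) > 0"
    and periodic: "\<And>g. g \<in> carrier G \<Longrightarrow> frobenius_periodic (\<Sum>i\<in>I. \<sigma> g i i)"
  shows "finite ((\<lambda>g. \<Sum>i\<in>I. \<sigma> g i i) ` carrier G)"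
proof -
  have CH: "CHAR('l) = CHAR('l prime_field fls alg_closure)" by (simp add: CHAR_prime_field)
  obtain f0 :: "'l \<Rightarrow> 'l prime_field fls alg_closure" where f0: "subring_embedding (range of_int) f0"
    using prime_subring_embedding[OF CH] by metis
  have "countable (range (of_int :: int \<Rightarrow> 'l))" by simp
  from ex_bounded_embedding[OF fg f0 this finite.emptyI]
  obtain A W and f :: "'l \<Rightarrow> 'l prime_field fls alg_closure"
    where bounded: "bounded_embedding {} A f W" by blast
  note f = bounded_embeddingD(1,3)[OF bounded] and W = bounded_embeddingD(4,5,7)[OF bounded]
  note simps = subring_embedding_simps[OF f(1)] subring_embedding_sum[OF f(1)]
  have A: "(\<Sum>i\<in>I. \<sigma> g i i) \<in> A" if "g \<in> carrier G" for g using f(2)[OF that] by (intro simps)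
  have "frobenius_periodic (f x)" if x: "x \<in> A" "frobenius_periodic x" for x
  proof -
    obtain r where r: "r > 0" "x ^ (CHAR('l) ^ r) = x" using x(2) by (auto simp: frobenius_periodic_def)
    have "x ^ n \<in> A \<and> f (x ^ n) = f x ^ n" for n
      by (induction n) (use x(1) in \<open>auto simp: simps\<close>)
    then have "f x ^ (CHAR('l) ^ r) = f x" using r(2) by metis
    then show ?thesis unfolding frobenius_periodic_def CH[symmetric] using r(1) by blast
  qed
  moreover have "f (\<Sum>i\<in>I. \<sigma> g i i) * w \<in> ac.span W" if "g \<in> carrier G" "w \<in> ac.span W" for g w
  proof -
    have "f (\<Sum>i\<in>I. \<sigma> g i i) * w = (\<Sum>i\<in>I. f (\<sigma> g i i) * w)"
      using f(2)[OF that(1)] by (simp add: simps sum_distrib_right)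
    also have "\<dots> \<in> ac.span W" using W(3)[OF that(1)] that(2) by (intro ac.span_sum)
    finally show ?thesis .
  qed
  ultimately have "f ` (\<lambda>g. \<Sum>i\<in>I. \<sigma> g i i) ` carrier G \<subseteq>
      {z. frobenius_periodic z \<and> (\<forall>w\<in>ac.span W. z * w \<in> ac.span W)}"
    using A periodic by blast
  then have "finite (f ` (\<lambda>g. \<Sum>i\<in>I. \<sigma> g i i) ` carrier G)"
    using finite_frobenius_periodic_multipliers[OF char W(1,2)] by (rule finite_subset)
  moreover have "inj_on f ((\<lambda>g. \<Sum>i\<in>I. \<sigma> g i i) ` carrier G)"
    using A simps(12) by (auto simp: inj_on_def)
  ultimately show ?thesis by (rule finite_imageD)
qed

section \<open>Irreducible representations with finitely many traces\<close>

lemma (in vector_space) dim_less: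
  assumes "subspace S" "S \<subseteq> T" "T \<subseteq> span B" "finite B" "x \<in> T" "x \<notin> S"
  shows "dim S < dim T"
proof -
  obtain BS where BS: "BS \<subseteq> S" "independent BS" "S \<subseteq> span BS" "card BS = dim S"
    using basis_exists[of S] by metis
  obtain BT where BT: "BT \<subseteq> T" "independent BT" "T \<subseteq> span BT" "card BT = dim T"
    using basis_exists[of T] by metis
  have "finite BT"
    using independent_span_bound[OF assms(4) BT(2)] BT(1) assms(3) by blast
  have "span BS \<subseteq> S" using BS(1) assms(1) by (rule span_minimal)
  then have "x \<notin> span BS" using assms(6) by blast
  then have "independent (insert x BS)" and "x \<notin> BS"
    using BS(2) independent_insertI[of x BS] span_base[of x BS] by blast+
  moreover have "insert x BS \<subseteq> span BT" using BS(1) assms(2,5) BT(3) by blast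
  ultimately have "finite (insert x BS) \<and> card (insert x BS) \<le> card BT"
    by (intro independent_span_bound[OF \<open>finite BT\<close>])
  then show ?thesis using BS(4) BT(4) \<open>x \<notin> BS\<close> by (metis Suc_le_eq card_insert_disjoint finite_insert)
qed

text \<open>Some nonzero polynomial in \<open>S\<close> kills \<open>y\<close>. Its linear factors
  are split off one at a time; as soon as the remaining factor no longer kills \<open>y\<close>, its
  value at \<open>y\<close> is an eigenvector.\<close>

lemma ex_eigenvector_in_invariant_subspace:
  fixes scale :: "'l::alg_closed_field \<Rightarrow> 'w::ab_group_add \<Rightarrow> 'w"
  assumes "vector_space scale" "Vector_Spaces.linear scale scale S"
    and Y: "module.subspace scale Y" "Y \<subseteq> module.span scale W" "finite W"
      "\<And>y. y \<in> Y \<Longrightarrow> S y \<in> Y"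
    and y: "y \<in> Y" "y \<noteq> 0"
  shows "\<exists>e z. z \<in> Y \<and> z \<noteq> 0 \<and> S z = scale e z"
proof -
  interpret vector_space scale by fact
  interpret S: Vector_Spaces.linear scale scale S by fact
  define N where "N = card W"
  \<comment> \<open>The value at \<open>y\<close> of the polynomial \<open>q\<close> in
    \<open>S\<close>, with the sum cut off at \<open>N\<close>. It is faithful for degree at most
    \<open>N\<close>, which is why \<open>step\<close> asks for degree below
    \<open>N\<close>.\<close>
  define ev where "ev q = (\<Sum>i\<le>N. scale (poly.coeff q i) ((S ^^ i) y))" for q
  have iter: "(S ^^ i) y \<in> Y" for i by (induction i) (use y Y in auto)
  have evY: "ev q \<in> Y" for q unfolding ev_def using iter Y by (intro subspace_sum subspace_scale)
  have step: "ev ([:- e, 1:] * r) = S (ev r) - scale e (ev r)" if deg: "Polynomial.degree r < N" for e r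
  proof -
    obtain M where M: "N = Suc M" using deg by (cases N) auto
    have c: "poly.coeff ([:- e, 1:] * r) i = (case i of 0 \<Rightarrow> 0 | Suc j \<Rightarrow> poly.coeff r j) - e * poly.coeff r i" for i
      by (simp add: coeff_pCons)
    have "S (ev r) = (\<Sum>i\<le>N. scale (poly.coeff r i) ((S ^^ Suc i) y))"
      unfolding ev_def by (simp add: S.sum S.scale)
    also have "\<dots> = (\<Sum>i\<le>M. scale (poly.coeff r i) ((S ^^ Suc i) y))"
      using deg by (simp add: M coeff_eq_0)
    also have "\<dots> = (\<Sum>i\<le>N. scale (case i of 0 \<Rightarrow> 0 | Suc j \<Rightarrow> poly.coeff r j) ((S ^^ i) y))"
      unfolding M sum.atMost_Suc_shift by simp
    finally show ?thesis
      unfolding ev_def c by (simp add: scale_left_diff_distrib sum_subtractf scale_sum_right)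
  qed
  have main: "\<exists>e z. z \<in> Y \<and> z \<noteq> 0 \<and> S z = scale e z"
    if "q \<noteq> 0" "Polynomial.degree q \<le> N" "ev q = 0" for q
    using that
  proof (induction "Polynomial.degree q" arbitrary: q rule: less_induct)
    case less
    show ?case
    proof (cases "Polynomial.degree q = 0")
      case True
      then obtain c where "q = [:c:]" by (auto elim: degree_eq_zeroE)
      with less.prems have "c \<noteq> 0" "ev [:c:] = 0" by auto
      moreover have "ev [:c:] = (\<Sum>i\<le>N. if i = 0 then scale c y else 0)"
        unfolding ev_def by (intro sum.cong) (auto simp: coeff_pCons split: nat.split)
      ultimately show ?thesis using y by simp
    next
      case False
      then obtain e where "poly q e = 0" using alg_closed_imp_poly_has_root by blast
      then obtain r where r: "q = [:- e, 1:] * r" by (auto simp: poly_eq_0_iff_dvd)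
      then have r0: "r \<noteq> 0" using less.prems by auto
      then have "Polynomial.degree q = Suc (Polynomial.degree r)"
        unfolding r by (subst degree_mult_eq) auto
      then have deg: "Polynomial.degree r < Polynomial.degree q" "Polynomial.degree r < N"
        using less.prems by auto
      have "S (ev r) = scale e (ev r)" using step[OF deg(2), of e] less.prems(3) r by simp
      then show ?thesis
        using less.hyps[OF deg(1) r0] deg(2) evY[of r] by (cases "ev r = 0") auto
    qed
  qed
  have "(S ^^ i) y \<in> span W" for i using iter Y(2) by blast
  then obtain c where c: "\<exists>i\<le>N. c i \<noteq> 0" "(\<Sum>i\<le>N. scale (c i) ((S ^^ i) y)) = 0"
    by (rule ex_linear_relation[OF Y(3), folded N_def])
  define q where "q = (\<Sum>i\<le>N. Polynomial.monom (c i) i)"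
  have cq: "poly.coeff q i = (if i \<le> N then c i else 0)" for i
    by (simp add: q_def coeff_sum)
  then have "Polynomial.degree q \<le> N" by (intro degree_le) simp
  moreover from c(1) obtain i where "i \<le> N" "c i \<noteq> 0" by blast
  then have "poly.coeff q i \<noteq> 0" by (simp add: cq)
  then have "q \<noteq> 0" by (metis coeff_0)
  moreover have "ev q = 0" using c(2) by (simp add: ev_def cq)
  ultimately show ?thesis by (intro main)
qed

section \<open>Matrices acting on functions supported in a finite index set\<close>

abbreviation vec_scale :: "'l::field \<Rightarrow> ('i \<Rightarrow> 'l) \<Rightarrow> 'i \<Rightarrow> 'l" where
  "vec_scale c v \<equiv> (\<lambda>i. c * v i)"

abbreviation mat_scale :: "'l::field \<Rightarrow> ('i \<Rightarrow> 'i \<Rightarrow> 'l) \<Rightarrow> 'i \<Rightarrow> 'i \<Rightarrow> 'l" where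
  "mat_scale c a \<equiv> (\<lambda>i j. c * a i j)"

interpretation vec: vector_space vec_scale
  by standard (simp_all add: fun_eq_iff distrib_left distrib_right mult.assoc)

interpretation mat: vector_space mat_scale
  by standard (intro ext, simp add: distrib_left distrib_right mult.assoc)+

definition mat_vec :: "'i set \<Rightarrow> ('i \<Rightarrow> 'i \<Rightarrow> 'l::field) \<Rightarrow> ('i \<Rightarrow> 'l) \<Rightarrow> 'i \<Rightarrow> 'l" where
  "mat_vec I a v = (\<lambda>i. if i \<in> I then \<Sum>j\<in>I. a i j * v j else 0)"

definition mat_mat :: "'i set \<Rightarrow> ('i \<Rightarrow> 'i \<Rightarrow> 'l::field) \<Rightarrow> ('i \<Rightarrow> 'i \<Rightarrow> 'l) \<Rightarrow> 'i \<Rightarrow> 'i \<Rightarrow> 'l" where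
  "mat_mat I a b = (\<lambda>i j. \<Sum>k\<in>I. a i k * b k j)"

definition vectors :: "'i set \<Rightarrow> ('i \<Rightarrow> 'l::field) set" where
  "vectors I = {v. \<forall>i. i \<notin> I \<longrightarrow> v i = 0}"

lemma subspace_vectors: "vec.subspace (vectors I)"
  by (rule vec.subspaceI) (auto simp: vectors_def)

lemma vectors_span:
  fixes I :: "'i set"
  assumes "finite I"
  shows "vectors I \<subseteq> vec.span ((\<lambda>i j. if j = i then 1 else 0 :: 'l::field) ` I)"
proof
  fix v :: "'i \<Rightarrow> 'l" assume v: "v \<in> vectors I"
  have "v = (\<Sum>i\<in>I. vec_scale (v i) (\<lambda>j. if j = i then 1 else 0))"
  proof
    fix j
    have "(\<Sum>i\<in>I. vec_scale (v i) (\<lambda>j. if j = i then 1 else 0)) j = (\<Sum>i\<in>I. if j = i then v i else 0)"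
      unfolding sum_fun_apply by (intro sum.cong) auto
    then show "v j = (\<Sum>i\<in>I. vec_scale (v i) (\<lambda>j. if j = i then 1 else 0)) j"
      using v assms by (auto simp: vectors_def)
  qed
  also have "\<dots> \<in> vec.span ((\<lambda>i j. if j = i then 1 else 0) ` I)"
    by (intro vec.span_sum vec.span_scale vec.span_base) auto
  finally show "v \<in> vec.span ((\<lambda>i j. if j = i then 1 else 0) ` I)" .
qed

lemma mat_vec_in_vectors: "mat_vec I a v \<in> vectors I"
  by (auto simp: mat_vec_def vectors_def)

lemma mat_vec_linear: "Vector_Spaces.linear vec_scale vec_scale (mat_vec I a)"
  using vec.vector_space_axioms unfolding Vector_Spaces.linear_iff
  by (auto simp: mat_vec_def distrib_left sum.distrib sum_distrib_left mult.left_commute)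

lemma mat_vec_simps:
  "mat_vec I a (v + w) = mat_vec I a v + mat_vec I a w"
  "mat_vec I a (v - w) = mat_vec I a v - mat_vec I a w"
  "mat_vec I a (vec_scale c v) = vec_scale c (mat_vec I a v)"
  "mat_vec I a 0 = 0"
  "mat_vec I 0 v = 0"
  "mat_vec I (a + b) v = mat_vec I a v + mat_vec I b v"
  "mat_vec I (a - b) v = mat_vec I a v - mat_vec I b v"
  "mat_vec I (mat_scale c a) v = vec_scale c (mat_vec I a v)"
  by (auto simp: mat_vec_def algebra_simps sum.distrib sum_subtractf sum_distrib_left)

lemma mat_vec_mat_mat: "mat_vec I (mat_mat I a b) v = mat_vec I a (mat_vec I b v)"
proof
  fix i
  have "(\<Sum>j\<in>I. (\<Sum>k\<in>I. a i k * b k j) * v j) = (\<Sum>k\<in>I. \<Sum>j\<in>I. a i k * b k j * v j)"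
    unfolding sum_distrib_right by (rule sum.swap)
  then show "mat_vec I (mat_mat I a b) v i = mat_vec I a (mat_vec I b v) i"
    by (auto simp: mat_vec_def mat_mat_def sum_distrib_left mult.assoc)
qed

lemma finite_range_combination:
  assumes "finite (f ` A)" "finite (g ` A)"
  shows "finite ((\<lambda>x. h (f x) (g x)) ` A)"
proof -
  have "(\<lambda>x. h (f x) (g x)) ` A \<subseteq> (\<lambda>(a, b). h a b) ` (f ` A \<times> g ` A)" by auto
  then show ?thesis using assms by (meson finite_SigmaI finite_imageI finite_subset)
qed

lemma finite_range_reindex:
  assumes "finite (f ` A)" "\<And>x. x \<in> B \<Longrightarrow> h x \<in> A" "\<And>x. x \<in> B \<Longrightarrow> g x = f (h x)"
  shows "finite (g ` B)"
  using assms(1) by (rule rev_finite_subset) (use assms in auto)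

lemma (in matrix_representation) mat_vec_\<sigma>:
  assumes "g \<in> carrier G" "h \<in> carrier G"
  shows "mat_vec I (\<sigma> (g \<otimes> h)) v = mat_vec I (\<sigma> g) (mat_vec I (\<sigma> h) v)"
  unfolding mat_vec_mat_mat[symmetric]
  using assms by (auto simp: mat_vec_def mat_mat_def \<sigma>_mult)

text \<open>In the linear span of the matrices \<open>\<sigma> g\<close>, a nonzero element \<open>T\<close> with kernel of maximal
  dimension has rank one, as in Burnside's theorem. The traces of the matrices \<open>\<sigma> g T\<close> are then
  the values of a matrix coefficient of the representation, and all matrix coefficients are
  combinations of translates of this one.\<close>

lemma finite_irreducible_representation:
  fixes G (structure) and \<sigma> :: "'a \<Rightarrow> 'i \<Rightarrow> 'i \<Rightarrow> 'l::alg_closed_field"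
  assumes rep: "matrix_representation G I \<sigma>"
    and irr: "\<And>u. u \<in> vectors I \<Longrightarrow> u \<noteq> 0 \<Longrightarrow>
      vectors I \<subseteq> vec.span ((\<lambda>g. mat_vec I (\<sigma> g) u) ` carrier G)"
    and traces: "finite ((\<lambda>g. \<Sum>i\<in>I. \<sigma> g i i) ` carrier G)"
    and ij: "i \<in> I" "j \<in> I"
  shows "finite ((\<lambda>g. \<sigma> g i j) ` carrier G)"
proof -
  interpret matrix_representation G I \<sigma> by fact
  define E where "E = (\<lambda>i j. if j = i then 1 else 0 :: 'l) ` I"
  have E: "finite E" "vectors I \<subseteq> vec.span E"
    unfolding E_def using finite_I vectors_span[OF finite_I] by auto
  define unit where "unit j = (\<lambda>i. if i = j then 1 else 0 :: 'l)" for j :: 'i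
  have unit: "unit j \<in> vectors I" if "j \<in> I" for j using that by (auto simp: unit_def vectors_def)
  have mat_unit: "mat_vec I a (unit j) i = a i j" if "i \<in> I" "j \<in> I" for a i j
    using that finite_I by (simp add: mat_vec_def unit_def if_distrib cong: if_cong)
  \<comment> \<open>Entries of \<open>\<sigma> g\<close> off \<open>I\<close> are unspecified.
    Setting them to zero makes the multiplication rule an equality of functions, so that the span of
    these matrices is closed under products.\<close>
  define s where "s g = (\<lambda>i j. if i \<in> I \<and> j \<in> I then \<sigma> g i j else 0)" for g
  have s_vec: "mat_vec I (s g) v = mat_vec I (\<sigma> g) v" for g v
    by (auto simp: mat_vec_def s_def)
  have s_mult: "mat_mat I (s g) (s h) = s (g \<otimes> h)" if "g \<in> carrier G" "h \<in> carrier G" for g h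
    using that by (auto simp: mat_mat_def s_def \<sigma>_mult fun_eq_iff)
  define R where "R = mat.span (s ` carrier G)"
  have R_mult: "mat_mat I a b \<in> R" if a: "a \<in> R" and b: "b \<in> R" for a b
    using a unfolding R_def
  proof (induction rule: mat.span_induct_alt)
    case base
    have "mat_mat I 0 b = 0" by (auto simp: mat_mat_def fun_eq_iff)
    then show ?case using mat.span_zero by (simp only:)
  next
    case (step c x y)
    then obtain g where g: "g \<in> carrier G" "x = s g" by auto
    have "mat_mat I x b \<in> mat.span (s ` carrier G)"
      using b unfolding R_def
    proof (induction rule: mat.span_induct_alt)
      case base
      have "mat_mat I x 0 = 0" by (auto simp: mat_mat_def fun_eq_iff)
      then show ?case using mat.span_zero by (simp only:)
    next
      case (step c z w)
      then obtain h where h: "h \<in> carrier G" "z = s h" by auto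
      have eq: "mat_mat I x (mat_scale c z + w) = mat_scale c (mat_mat I x z) + mat_mat I x w"
        by (auto simp: mat_mat_def fun_eq_iff algebra_simps sum.distrib sum_distrib_left)
      have "mat_mat I x z \<in> mat.span (s ` carrier G)" using g h s_mult by (intro mat.span_base) simp
      then show ?case unfolding eq using step by (intro mat.span_add mat.span_scale)
    qed
    moreover have eq: "mat_mat I (mat_scale c x + y) b = mat_scale c (mat_mat I x b) + mat_mat I y b"
      by (auto simp: mat_mat_def fun_eq_iff algebra_simps sum.distrib sum_distrib_left)
    ultimately show ?case unfolding eq using step by (intro mat.span_add mat.span_scale)
  qed
  have R_transitive: "\<exists>a\<in>R. mat_vec I a u = x" if u: "u \<in> vectors I" "u \<noteq> 0" and x: "x \<in> vectors I" for u x
  proof -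
    have "x \<in> vec.span ((\<lambda>g. mat_vec I (\<sigma> g) u) ` carrier G)" using irr[OF u] x by blast
    then show ?thesis
    proof (induction rule: vec.span_induct_alt)
      case base
      show ?case unfolding R_def by (rule bexI[of _ 0]) (rule mat_vec_simps(5), rule mat.span_zero)
    next
      case (step c z w)
      then obtain g a where ga: "g \<in> carrier G" "z = mat_vec I (s g) u" "a \<in> R" "mat_vec I a u = w"
        by (auto simp: s_vec)
      then have "s g \<in> R" unfolding R_def by (intro mat.span_base) auto
      then have "mat_scale c (s g) + a \<in> R"
        using ga(3) unfolding R_def by (intro mat.span_add mat.span_scale)
      moreover have "mat_vec I (mat_scale c (s g) + a) u = vec_scale c z + w"
        unfolding mat_vec_simps using ga(2,4) by (simp only:)
      ultimately show ?case by (intro bexI[of _ "mat_scale c (s g) + a"])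
    qed
  qed
  define K where "K a = {x \<in> vectors I. mat_vec I a x = 0}" for a :: "'i \<Rightarrow> 'i \<Rightarrow> 'l"
  have subK: "vec.subspace (K a)" for a
    using subspace_vectors[of I] unfolding K_def vec.subspace_def by (auto simp: mat_vec_simps)
  define nonzero where "nonzero a \<longleftrightarrow> (\<exists>x\<in>vectors I. mat_vec I a x \<noteq> 0)" for a :: "'i \<Rightarrow> 'i \<Rightarrow> 'l"
  have bound: "vec.dim (K a) \<le> card E" for a
  proof (rule vec.dim_le_card[OF _ E(1)])
    show "K a \<subseteq> vec.span E" using E(2) unfolding K_def by blast
  qed
  have "unit j \<noteq> 0" using ij(2) by (auto simp: unit_def fun_eq_iff)
  moreover have "mat_vec I (s \<one>) (unit j) = unit j"
  proof
    fix i
    show "mat_vec I (s \<one>) (unit j) i = unit j i"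
    proof (cases "i \<in> I")
      case True
      then show ?thesis using mat_unit[OF True ij(2), of "s \<one>"] ij(2) by (simp add: s_def \<sigma>_one unit_def)
    next
      case False
      then show ?thesis using ij(2) by (auto simp: mat_vec_def unit_def)
    qed
  qed
  ultimately have "s \<one> \<in> R \<and> nonzero (s \<one>)"
    using unit[OF ij(2)] by (force simp: R_def nonzero_def intro: mat.span_base)
  then obtain T where T: "T \<in> R" "nonzero T"
    and T_max: "\<And>a. a \<in> R \<Longrightarrow> nonzero a \<Longrightarrow> vec.dim (K a) \<le> vec.dim (K T)"
    using ex_has_greatest_nat[of "\<lambda>a. a \<in> R \<and> nonzero a" "s \<one>" "\<lambda>a. vec.dim (K a)" "Suc (card E)"] bound
    by (auto simp: less_Suc_eq_le)
  have rank_one: "\<exists>c. mat_vec I T x2 = vec_scale c (mat_vec I T x1)"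
    if x1: "x1 \<in> vectors I" "mat_vec I T x1 \<noteq> 0" and x2: "x2 \<in> vectors I" for x1 x2
  proof (rule ccontr)
    assume indep: "\<not> ?thesis"
    obtain a where a: "a \<in> R" "mat_vec I a (mat_vec I T x1) = x2"
      using R_transitive[OF mat_vec_in_vectors x1(2) x2] by blast
    define Y where "Y = mat_vec I T ` vectors I"
    interpret lT: Vector_Spaces.linear vec_scale vec_scale "mat_vec I T" by (rule mat_vec_linear)
    have "\<exists>e z. z \<in> Y \<and> z \<noteq> 0 \<and> mat_vec I (mat_mat I T a) z = vec_scale e z"
    proof (rule ex_eigenvector_in_invariant_subspace[where W = E])
      show "vec.subspace Y" unfolding Y_def by (rule lT.subspace_image[OF subspace_vectors])
      show "Y \<subseteq> vec.span E" using E(2) mat_vec_in_vectors unfolding Y_def by blast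
      show "mat_vec I (mat_mat I T a) y \<in> Y" for y
        unfolding mat_vec_mat_mat Y_def by (intro imageI mat_vec_in_vectors)
      show "mat_vec I T x1 \<in> Y" using x1 by (simp add: Y_def)
    qed (use E x1 vec.vector_space_axioms mat_vec_linear in auto)
    then obtain e z where z: "z \<in> vectors I" "mat_vec I T z \<noteq> 0"
      "mat_vec I T (mat_vec I a (mat_vec I T z)) = vec_scale e (mat_vec I T z)"
      unfolding Y_def mat_vec_mat_mat by auto
    \<comment> \<open>\<open>T'\<close> kills the kernel of \<open>T\<close> and also
      \<open>z\<close>, which \<open>T\<close> does not kill. It is nonzero, since its value at
      \<open>x1\<close> vanishes only if \<open>T x2\<close> is \<open>e\<close> times
      \<open>T x1\<close>. This contradicts the maximality of the kernel of
      \<open>T\<close>.\<close>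
    define T' where "T' = mat_mat I (mat_mat I T a) T - mat_scale e T"
    have T': "mat_vec I T' x = mat_vec I T (mat_vec I a (mat_vec I T x)) - vec_scale e (mat_vec I T x)" for x
      by (simp add: T'_def mat_vec_simps mat_vec_mat_mat)
    have "T' \<in> R"
      unfolding T'_def using R_mult a(1) T(1) unfolding R_def by (blast intro: mat.span_diff mat.span_scale)
    moreover have "mat_vec I T' x1 \<noteq> 0" using indep unfolding T' a(2) by auto
    then have "nonzero T'" using x1 by (auto simp: nonzero_def)
    ultimately have "vec.dim (K T') \<le> vec.dim (K T)" by (rule T_max)
    moreover have "vec.dim (K T) < vec.dim (K T')"
    proof (rule vec.dim_less[OF subK _ _ E(1)])
      show "K T \<subseteq> K T'" by (auto simp: K_def T' mat_vec_simps)
      show "K T' \<subseteq> vec.span E" using E(2) by (auto simp: K_def)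
      show "z \<in> K T'" "z \<notin> K T" using z by (auto simp: K_def T')
    qed
    ultimately show False by simp
  qed
  obtain u f j0 where u: "u \<in> vectors I" "u \<noteq> 0" and f: "j0 \<in> I" "f j0 \<noteq> 0"
    and Tf: "\<And>i j. i \<in> I \<Longrightarrow> j \<in> I \<Longrightarrow> T i j = f j * u i"
  proof -
    have "\<exists>j\<in>I. mat_vec I T (unit j) \<noteq> 0"
    proof (rule ccontr)
      assume "\<not> ?thesis"
      then have "T i j = 0" if "i \<in> I" "j \<in> I" for i j using mat_unit[of i j T] that by auto
      then have "mat_vec I T x = 0" for x by (auto simp: mat_vec_def)
      with T(2) show False by (auto simp: nonzero_def)
    qed
    then obtain j0 where j0: "j0 \<in> I" "mat_vec I T (unit j0) \<noteq> 0" by blast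
    define u where "u = mat_vec I T (unit j0)"
    have "\<exists>c. mat_vec I T (unit j) = vec_scale c u" if "j \<in> I" for j
      unfolding u_def using rank_one[OF unit[OF j0(1)] j0(2) unit[OF that]] .
    then obtain f where f: "\<And>j. j \<in> I \<Longrightarrow> mat_vec I T (unit j) = vec_scale (f j) u" by metis
    show ?thesis
    proof (rule that[of u j0 f])
      show "u \<in> vectors I" "u \<noteq> 0" using j0 mat_vec_in_vectors by (auto simp: u_def)
      show "f j0 \<noteq> 0"
      proof
        assume "f j0 = 0"
        then have "u = 0" using f[OF j0(1)] by (simp add: u_def fun_eq_iff)
        then show False using j0 by (simp add: u_def)
      qed
      show "T i j = f j * u i" if "i \<in> I" "j \<in> I" for i j
        using mat_unit[OF that, of T] f[OF that(2)] by simp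
    qed (rule j0)
  qed
  \<comment> \<open>As a rank-one matrix, \<open>T\<close> is the product of the column
    \<open>u\<close> and the row \<open>f\<close>; the trace of \<open>\<sigma> g\<close> times
    \<open>T\<close> is therefore \<phi> applied to the image of \<open>u\<close> under
    \<open>\<sigma> g\<close>.\<close>
  define \<phi> where "\<phi> v = (\<Sum>i\<in>I. f i * v i)" for v
  have \<phi>_simps: "\<phi> (vec_scale c v + w) = c * \<phi> v + \<phi> w" "\<phi> (v - w) = \<phi> v - \<phi> w" "\<phi> 0 = 0" "\<phi> (v + w) = \<phi> v + \<phi> w"
      "\<phi> (vec_scale c v) = c * \<phi> v"
    for c v w by (simp_all add: \<phi>_def algebra_simps sum.distrib sum_subtractf sum_distrib_left)
  have trace_R: "finite ((\<lambda>g. \<Sum>i\<in>I. \<Sum>j\<in>I. \<sigma> g i j * a j i) ` carrier G)" if "a \<in> R" for a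
    using that unfolding R_def
  proof (induction rule: mat.span_induct_alt)
    case base
    show ?case by (rule finite_subset[of _ "{0}"]) auto
  next
    case (step c x y)
    then obtain h where h: "h \<in> carrier G" "x = s h" by auto
    have "(\<Sum>i\<in>I. \<Sum>j\<in>I. \<sigma> g i j * x j i) = (\<Sum>i\<in>I. \<sigma> (g \<otimes> h) i i)" if "g \<in> carrier G" for g
      using that h by (simp add: \<sigma>_mult s_def)
    then have "finite ((\<lambda>g. \<Sum>i\<in>I. \<Sum>j\<in>I. \<sigma> g i j * x j i) ` carrier G)"
      using h by (intro finite_range_reindex[OF traces, where h = "\<lambda>g. g \<otimes> h"]) auto
    then have "finite ((\<lambda>g. c * (\<Sum>i\<in>I. \<Sum>j\<in>I. \<sigma> g i j * x j i) +
        (\<Sum>i\<in>I. \<Sum>j\<in>I. \<sigma> g i j * y j i)) ` carrier G)"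
      using step(2) by (rule finite_range_combination)
    then show ?case
      by (simp add: algebra_simps sum.distrib sum_distrib_left)
  qed
  have "(\<Sum>i\<in>I. \<Sum>j\<in>I. \<sigma> g i j * T j i) = \<phi> (mat_vec I (\<sigma> g) u)" for g
    unfolding \<phi>_def mat_vec_def by (simp add: Tf sum_distrib_left mult_ac)
  then have fin_u: "finite ((\<lambda>g. \<phi> (mat_vec I (\<sigma> g) u)) ` carrier G)" using trace_R[OF T(1)] by simp
  have fin: "finite ((\<lambda>g. \<phi> (mat_vec I (\<sigma> g) x)) ` carrier G)" if "x \<in> vectors I" for x
  proof -
    have "x \<in> vec.span ((\<lambda>g. mat_vec I (\<sigma> g) u) ` carrier G)" using irr[OF u] that by blast
    then show ?thesis
    proof (induction rule: vec.span_induct_alt)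
      case base
      have "(\<lambda>g. \<phi> (mat_vec I (\<sigma> g) 0)) ` carrier G \<subseteq> {0}"
        unfolding mat_vec_simps(4) \<phi>_simps by blast
      then show ?case by (rule finite_subset) (rule finite.insertI, rule finite.emptyI)
    next
      case (step c z w)
      then obtain h where h: "h \<in> carrier G" "z = mat_vec I (\<sigma> h) u" by auto
      have "finite ((\<lambda>g. \<phi> (mat_vec I (\<sigma> g) z)) ` carrier G)"
        using h mat_vec_\<sigma> by (intro finite_range_reindex[OF fin_u, where h = "\<lambda>g. g \<otimes> h"]) auto
      then have "finite ((\<lambda>g. c * \<phi> (mat_vec I (\<sigma> g) z) + \<phi> (mat_vec I (\<sigma> g) w)) ` carrier G)"
        using step(2) by (rule finite_range_combination)
      then show ?case unfolding mat_vec_simps \<phi>_simps .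
    qed
  qed
  \<comment> \<open>The common kernel of the translates of \<phi> by \<open>B\<close>. For a finite
    \<open>B\<close> making its dimension minimal it is zero: a nonzero element has a spanning
    orbit, so some translate of \<phi> is nonzero on it and adding that translate would lower the
    dimension.\<close>
  define N where "N B = {x \<in> vectors I. \<forall>b\<in>B. \<phi> (mat_vec I (\<sigma> b) x) = 0}" for B
  have subN: "vec.subspace (N B)" for B
    using subspace_vectors[of I] unfolding N_def vec.subspace_def by (auto simp: mat_vec_simps \<phi>_simps)
  obtain B where B: "finite B" "B \<subseteq> carrier G"
    and B_min: "\<And>B'. finite B' \<Longrightarrow> B' \<subseteq> carrier G \<Longrightarrow> vec.dim (N B) \<le> vec.dim (N B')"
    using ex_has_least_nat[of "\<lambda>B. finite B \<and> B \<subseteq> carrier G" "{}" "\<lambda>B. vec.dim (N B)"] by auto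
  have N0: "x = 0" if x: "x \<in> N B" for x
  proof (rule ccontr)
    assume "x \<noteq> 0"
    have xI: "x \<in> vectors I" using x by (simp add: N_def)
    have "\<exists>b\<in>carrier G. \<phi> (mat_vec I (\<sigma> b) x) \<noteq> 0"
    proof (rule ccontr)
      assume zero: "\<not> ?thesis"
      have "unit j0 \<in> vec.span ((\<lambda>g. mat_vec I (\<sigma> g) x) ` carrier G)"
        using irr[OF xI \<open>x \<noteq> 0\<close>] unit[OF f(1)] by blast
      then have "\<phi> (unit j0) = 0"
        by (induction rule: vec.span_induct_alt) (use zero in \<open>auto simp: \<phi>_simps simp del: zero_fun_apply plus_fun_apply\<close>)
      moreover have "\<phi> (unit j0) = f j0"
        using f(1) finite_I by (simp add: \<phi>_def unit_def if_distrib cong: if_cong)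
      ultimately show False using f(2) by simp
    qed
    then obtain b where b: "b \<in> carrier G" "\<phi> (mat_vec I (\<sigma> b) x) \<noteq> 0" by blast
    have "vec.dim (N (insert b B)) < vec.dim (N B)"
    proof (rule vec.dim_less[OF subN _ _ E(1)])
      show "N B \<subseteq> vec.span E" using E(2) by (auto simp: N_def)
      show "x \<notin> N (insert b B)" using b by (simp add: N_def)
    qed (use x in \<open>auto simp: N_def\<close>)
    moreover have "vec.dim (N B) \<le> vec.dim (N (insert b B))" using b B by (intro B_min) auto
    ultimately show False by simp
  qed
  \<comment> \<open>The finitely many translates of \<phi> by \<open>B\<close> separate vectors, so
    these values determine the column \<open>j\<close> of \<open>\<sigma> g\<close>; each of them
    has a finite range by \<open>fin\<close>.\<close>
  define F where "F g = (\<lambda>b\<in>B. \<phi> (mat_vec I (\<sigma> (b \<otimes> g)) (unit j)))" for g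
  have "F ` carrier G \<subseteq> (\<Pi>\<^sub>E b\<in>B. (\<lambda>g. \<phi> (mat_vec I (\<sigma> g) (unit j))) ` carrier G)"
    unfolding F_def image_subset_iff restrict_PiE_iff using B by auto
  moreover have "finite (\<Pi>\<^sub>E b\<in>B. (\<lambda>g. \<phi> (mat_vec I (\<sigma> g) (unit j))) ` carrier G)"
    using B(1) fin[OF unit[OF ij(2)]] by (intro finite_PiE)
  ultimately have "finite (F ` carrier G)" by (rule finite_subset)
  then show ?thesis
  proof (rule finite_image_factor)
    fix g h assume gh: "g \<in> carrier G" "h \<in> carrier G" "F g = F h"
    define x where "x = mat_vec I (\<sigma> g) (unit j) - mat_vec I (\<sigma> h) (unit j)"
    have "\<phi> (mat_vec I (\<sigma> b) x) = 0" if b: "b \<in> B" for b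
    proof -
      have bG: "b \<in> carrier G" using b B by blast
      have "F g b = F h b" using gh(3) by simp
      then show ?thesis
        using b by (simp add: F_def x_def mat_vec_simps \<phi>_simps mat_vec_\<sigma>[OF bG gh(1)] mat_vec_\<sigma>[OF bG gh(2)])
    qed
    moreover have "x \<in> vectors I"
      unfolding x_def by (intro vec.subspace_diff subspace_vectors mat_vec_in_vectors)
    ultimately have "x = 0" by (intro N0) (simp add: N_def)
    then have "mat_vec I (\<sigma> g) (unit j) i = mat_vec I (\<sigma> h) (unit j) i" by (simp add: x_def fun_eq_iff)
    then show "\<sigma> g i j = \<sigma> h i j" using mat_unit[OF ij] by simp
  qed
qed

section \<open>Extensions of finite representations\<close>

text \<open>A new generator contributes only its multiples by elements fixed under Frobenius, and
  these are finite in number.\<close>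

lemma (in vector_space) finite_add_hull:
  fixes Q :: "'b set"
  assumes "finite Q" "CHAR('a) > 0"
  shows "finite (add_hull Q)"
  using assms(1)
proof (induction Q)
  case empty
  have "add_hull {} \<subseteq> {0 :: 'b}"
  proof
    fix x :: 'b assume "x \<in> add_hull {}"
    then show "x \<in> {0}" by (induction rule: add_hull.induct) auto
  qed
  then show ?case by (rule finite_subset) simp
next
  case (insert q Q)
  define P where "P = {c :: 'a. c ^ CHAR('a) = c}"
  have P: "0 \<in> P" "\<And>c. c \<in> P \<Longrightarrow> c + 1 \<in> P" "\<And>c. c \<in> P \<Longrightarrow> c - 1 \<in> P"
    using frobenius_fixed_closed[OF assms(2)] assms(2) by (simp_all add: P_def)
  have "x \<in> (\<lambda>(z, c). z + scale c q) ` (add_hull Q \<times> P)" if "x \<in> add_hull (insert q Q)" for x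
    using that
  proof (induction rule: add_hull.induct)
    case zero
    show ?case using P add_hull.zero by (intro image_eqI[of _ _ "(0, 0)"]) auto
  next
    case (plus x r)
    then obtain z c where zc: "z \<in> add_hull Q" "c \<in> P" "x = z + scale c q" by auto
    show ?case
    proof (cases "r = q")
      case True
      then show ?thesis using zc P
        by (intro image_eqI[of _ _ "(z, c + 1)"]) (auto simp: scale_left_distrib)
    next
      case False
      then show ?thesis using zc plus add_hull.plus[of z Q r]
        by (intro image_eqI[of _ _ "(z + r, c)"]) auto
    qed
  next
    case (minus x r)
    then obtain z c where zc: "z \<in> add_hull Q" "c \<in> P" "x = z + scale c q" by auto
    show ?case
    proof (cases "r = q")
      case True
      then show ?thesis using zc P
        by (intro image_eqI[of _ _ "(z, c - 1)"]) (auto simp: scale_left_diff_distrib)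
    next
      case False
      then show ?thesis using zc minus add_hull.minus[of z Q r]
        by (intro image_eqI[of _ _ "(z - r, c)"]) auto
    qed
  qed
  then have "add_hull (insert q Q) \<subseteq> (\<lambda>(z, c). z + scale c q) ` (add_hull Q \<times> P)" by blast
  moreover have "finite P" unfolding P_def by (rule finite_frobenius_fixed[OF assms(2)])
  ultimately show ?case using insert.IH by (meson finite_SigmaI finite_imageI finite_subset)
qed

lemma add_hull_sum: "(\<And>i. i \<in> A \<Longrightarrow> f i \<in> add_hull Q) \<Longrightarrow> (\<Sum>i\<in>A. f i) \<in> add_hull Q"
  by (induction A rule: infinite_finite_induct) (auto intro: add_hull.zero add_hull_add)

text \<open>If some vector has infinite orbit, let \<open>D\<close> be an invariant subspace of minimal dimension
  containing such a vector, and let \<open>U\<close> be its subspace of vectors with finite orbit. Then \<open>D / U\<close>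
  is irreducible, so the group acts on it through a finite quotient. The error terms
  \<open>u g l\<close> in \<open>U\<close>, which form a cocycle, lie in a finite additive group
  because \<open>G\<close> is finitely generated.\<close>

lemma finite_orbits:
  fixes G (structure) and scale :: "'l::alg_closed_field \<Rightarrow> 'w::ab_group_add \<Rightarrow> 'w"
  assumes vs: "vector_space scale"
    and fg: "finitely_generated_group G" and ocn: "outer_commensurator_normalizer G"
    and char: "CHAR('l) > 0"
    and lin: "\<And>g. g \<in> carrier G \<Longrightarrow> Vector_Spaces.linear scale scale (act g)"
    and act_one: "\<And>x. act \<one> x = x"
    and act_mult: "\<And>g h x. g \<in> carrier G \<Longrightarrow> h \<in> carrier G \<Longrightarrow> act (g \<otimes> h) x = act g (act h x)"
    and C: "finite C" "\<And>g x. g \<in> carrier G \<Longrightarrow> x \<in> C \<Longrightarrow> act g x \<in> module.span scale C"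
    and x: "x \<in> module.span scale C"
  shows "finite ((\<lambda>g. act g x) ` carrier G)"
proof (rule ccontr)
  assume infinite: "infinite ((\<lambda>g. act g x) ` carrier G)"
  interpret vector_space scale by fact
  interpret group G using fg by (simp add: finitely_generated_group_def)
  have act_add: "act g (x + y) = act g x + act g y" if "g \<in> carrier G" for g x y
    using lin[OF that] by (simp add: Vector_Spaces.linear_iff)
  have act_scale: "act g (scale c x) = scale c (act g x)" if "g \<in> carrier G" for g c x
    using lin[OF that] by (simp add: Vector_Spaces.linear_iff)
  have act_sum: "act g (\<Sum>i\<in>I. f i) = (\<Sum>i\<in>I. act g (f i))" if g: "g \<in> carrier G" for g I and f :: "'j \<Rightarrow> 'w"
  proof -
    interpret g: Vector_Spaces.linear scale scale "act g" by (rule lin[OF g])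
    show ?thesis by (rule g.sum)
  qed
  have act_zero: "act g 0 = 0" if "g \<in> carrier G" for g
    using act_scale[OF that, of 0 0] by simp
  define Fin where "Fin = {x. finite ((\<lambda>g. act g x) ` carrier G)}"
  have subFin: "subspace Fin"
  proof (rule subspaceI)
    show "0 \<in> Fin" by (auto simp: Fin_def act_zero intro: finite_subset[of _ "{0}"])
    fix y z assume yz: "y \<in> Fin" "z \<in> Fin"
    have "finite ((\<lambda>g. act g y + act g z) ` carrier G)"
      by (rule finite_range_combination) (use yz in \<open>auto simp: Fin_def\<close>)
    then have "finite ((\<lambda>g. act g (y + z)) ` carrier G)"
      by (rule finite_range_reindex[where h = "\<lambda>g. g"]) (auto simp: act_add)
    then show "y + z \<in> Fin" by (simp add: Fin_def)
  next
    fix c y assume "y \<in> Fin"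
    then have "finite (scale c ` (\<lambda>g. act g y) ` carrier G)" by (simp add: Fin_def)
    then have "finite ((\<lambda>g. scale c (act g y)) ` carrier G)" by (simp add: image_image)
    then have "finite ((\<lambda>g. act g (scale c y)) ` carrier G)"
      by (rule finite_range_reindex[where h = "\<lambda>g. g"]) (auto simp: act_scale)
    then show "scale c y \<in> Fin" by (simp add: Fin_def)
  qed
  have actFin: "act h y \<in> Fin" if "h \<in> carrier G" "y \<in> Fin" for h y
  proof -
    have "finite ((\<lambda>g. act g y) ` carrier G)" using that by (simp add: Fin_def)
    then have "finite ((\<lambda>g. act g (act h y)) ` carrier G)"
      by (rule finite_range_reindex[where h = "\<lambda>g. g \<otimes> h"]) (use that in \<open>auto simp: act_mult\<close>)
    then show ?thesis by (simp add: Fin_def)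
  qed
  define invariant where "invariant D \<longleftrightarrow> subspace D \<and> D \<subseteq> span C \<and>
    (\<forall>g\<in>carrier G. \<forall>y\<in>D. act g y \<in> D)" for D
  have "invariant (span C)"
    unfolding invariant_def using linear_maps_span[OF _ lin C(2)] by auto
  moreover have "\<not> span C \<subseteq> Fin" using x infinite by (auto simp: Fin_def)
  ultimately obtain D where D: "invariant D" "\<not> D \<subseteq> Fin"
    and D_min: "\<And>D'. invariant D' \<Longrightarrow> \<not> D' \<subseteq> Fin \<Longrightarrow> dim D \<le> dim D'"
    using ex_has_least_nat[of "\<lambda>D. invariant D \<and> \<not> D \<subseteq> Fin" "span C" dim] by auto
  have subD: "subspace D" and DC: "D \<subseteq> span C"
    and actD: "\<And>g y. g \<in> carrier G \<Longrightarrow> y \<in> D \<Longrightarrow> act g y \<in> D"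
    using D(1) by (auto simp: invariant_def)
  have D_eq: "D' = D" if D': "invariant D'" "D' \<subseteq> D" "\<not> D' \<subseteq> Fin" for D'
  proof (rule ccontr)
    assume "D' \<noteq> D"
    then obtain y where "y \<in> D" "y \<notin> D'" using D'(2) by blast
    moreover have "subspace D'" using D'(1) by (simp add: invariant_def)
    ultimately have "dim D' < dim D" using dim_less[OF _ D'(2) DC C(1)] by blast
    with D_min[OF D'(1,3)] show False by simp
  qed
  define U where "U = D \<inter> Fin"
  have subU: "subspace U" unfolding U_def by (rule subspace_inter[OF subD subFin])
  have actU: "act g y \<in> U" if "g \<in> carrier G" "y \<in> U" for g y
    using that actD actFin by (auto simp: U_def)
  obtain BU where BU: "BU \<subseteq> U" "independent BU" "U \<subseteq> span BU"
    using maximal_independent_subset[of U] by blast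
  have "BU \<subseteq> D" using BU(1) by (auto simp: U_def)
  then obtain BD where BD: "BU \<subseteq> BD" "BD \<subseteq> D" "independent BD" "D \<subseteq> span BD"
    using maximal_independent_subset_extend[OF _ BU(2)] by blast
  have finBD: "finite BD" using independent_span_bound[OF C(1) BD(3)] BD(2) DC by blast
  have spanBD: "span BD = D" using BD(2,4) subD by (rule span_subspace)
  have spanBU: "span BU = U" using BU(1,3) subU by (rule span_subspace)
  \<comment> \<open>These vectors represent a basis of \<open>D\<close> modulo \<open>U\<close>.
    Discarding the coordinates along \<open>BU\<close> yields the matrices of the quotient action
    without a quotient type.\<close>
  define I where "I = BD - BU"
  have finI: "finite I" using finBD by (simp add: I_def)
  have ID: "i \<in> D" if "i \<in> I" for i using that BD(2) by (auto simp: I_def)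
  define rep where "rep = representation BD"
  have rep_add: "rep (y + z) b = rep y b + rep z b" if "y \<in> D" "z \<in> D" for y z b
    using representation_add[OF BD(3)] that by (simp add: rep_def spanBD)
  have rep_scale: "rep (scale c y) b = c * rep y b" if "y \<in> D" for c y b
    using representation_scale[OF BD(3)] that by (simp add: rep_def spanBD)
  have rep_sum: "rep (\<Sum>j\<in>J. f j) b = (\<Sum>j\<in>J. rep (f j) b)"
    if "\<And>j. j \<in> J \<Longrightarrow> f j \<in> D" for J b and f :: "'w \<Rightarrow> 'w"
    using representation_sum[OF BD(3), of J f] that by (simp add: rep_def spanBD)
  have rep_U: "rep y i = 0" if y: "y \<in> U" and i: "i \<in> I" for y i
  proof -
    have "rep y = representation BU y"
      unfolding rep_def by (rule representation_extend[OF BD(3) _ BD(1)]) (use y spanBU in simp)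
    moreover have "representation BU y i = 0"
      using representation_ne_zero[of BU y i] i by (auto simp: I_def)
    ultimately show ?thesis by simp
  qed
  have rep_basis: "rep j i = (if i = j then 1 else 0)" if "j \<in> I" for i j
    using representation_basis[OF BD(3), of j] that by (simp add: rep_def I_def)
  define rem where "rem y = y - (\<Sum>i\<in>I. scale (rep y i) i)" for y
  have rem_U: "rem y \<in> U" if "y \<in> D" for y
  proof -
    have "y = (\<Sum>b\<in>BD. scale (rep y b) b)"
      using sum_representation_eq[OF BD(3) _ finBD subset_refl, of y] that by (simp add: rep_def spanBD)
    also have "\<dots> = (\<Sum>b\<in>I. scale (rep y b) b) + (\<Sum>b\<in>BU. scale (rep y b) b)"
      unfolding I_def using BD(1) finBD by (rule sum.subset_diff)
    finally have "rem y = (\<Sum>b\<in>BU. scale (rep y b) b)"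
      unfolding rem_def diff_eq_eq by (simp only: add.commute)
    also have "\<dots> \<in> U" using BU(1) by (intro subspace_sum subspace_scale subU) auto
    finally show ?thesis .
  qed
  have decomp: "y = (\<Sum>i\<in>I. scale (rep y i) i) + rem y" for y by (simp add: rem_def)
  define \<sigma> where "\<sigma> g i j = rep (act g j) i" for g i j
  have mult_vec: "rep (act g y) i = (\<Sum>k\<in>I. \<sigma> g i k * rep y k)"
    if g: "g \<in> carrier G" and y: "y \<in> D" and i: "i \<in> I" for g y i
  proof -
    have "act g y = act g ((\<Sum>k\<in>I. scale (rep y k) k) + rem y)" using decomp[of y] by simp
    also have "\<dots> = (\<Sum>k\<in>I. scale (rep y k) (act g k)) + act g (rem y)"
      by (simp add: act_add[OF g] act_sum[OF g] act_scale[OF g])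
    finally have "act g y = (\<Sum>k\<in>I. scale (rep y k) (act g k)) + act g (rem y)" .
    moreover have kD: "scale (rep y k) (act g k) \<in> D" if "k \<in> I" for k
      using that g by (intro subspace_scale subD actD ID)
    moreover have "act g (rem y) \<in> U" using actU[OF g rem_U[OF y]] .
    moreover from this have "act g (rem y) \<in> D" by (simp add: U_def)
    moreover have "(\<Sum>k\<in>I. scale (rep y k) (act g k)) \<in> D" using kD by (intro subspace_sum subD)
    ultimately have "rep (act g y) i = (\<Sum>k\<in>I. rep (scale (rep y k) (act g k)) i)"
      using i by (simp add: rep_add rep_sum rep_U)
    then show ?thesis using g by (simp add: rep_scale actD ID \<sigma>_def mult.commute)
  qed
  interpret matrix_representation G I \<sigma>
  proof
    show "finite I" by (rule finI)
    show "\<sigma> (g \<otimes> h) i j = (\<Sum>k\<in>I. \<sigma> g i k * \<sigma> h k j)"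
      if "g \<in> carrier G" "h \<in> carrier G" "i \<in> I" "j \<in> I" for g h i j
      using mult_vec[OF that(1) actD[OF that(2) ID[OF that(4)]] that(3)] that
      by (simp add: \<sigma>_def act_mult)
    show "\<sigma> \<one> i j = (if i = j then 1 else 0)" if "i \<in> I" "j \<in> I" for i j
      using that by (simp add: \<sigma>_def act_one rep_basis)
  qed
  have irreducible: "vectors I \<subseteq> vec.span ((\<lambda>g. mat_vec I (\<sigma> g) u) ` carrier G)"
    if u: "u \<in> vectors I" "u \<noteq> 0" for u
  proof
    fix v :: "'w \<Rightarrow> 'l" assume v: "v \<in> vectors I"
    define \<psi> where "\<psi> y = (\<lambda>i. if i \<in> I then rep y i else 0)" for y
    have \<psi>_comb: "\<psi> (\<Sum>i\<in>I. scale (w i) i) = w" if w: "w \<in> vectors I" for w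
    proof
      fix i
      have "rep (\<Sum>i\<in>I. scale (w i) i) i = (\<Sum>j\<in>I. w j * rep j i)"
        by (simp add: rep_sum subspace_scale[OF subD ID] rep_scale ID)
      also have "\<dots> = (\<Sum>j\<in>I. if i = j then w j else 0)"
        by (intro sum.cong) (simp_all add: rep_basis)
      finally show "\<psi> (\<Sum>i\<in>I. scale (w i) i) i = w i"
        using finI w by (auto simp: \<psi>_def vectors_def)
    qed
    define d where "d = (\<Sum>i\<in>I. scale (u i) i)"
    have dD: "d \<in> D" unfolding d_def by (intro subspace_sum subspace_scale subD ID)
    have d\<psi>: "\<psi> d = u" unfolding d_def by (rule \<psi>_comb[OF u(1)])
    have "d \<notin> U"
    proof
      assume "d \<in> U"
      then have "\<psi> d = (\<lambda>i. 0)" using rep_U by (auto simp: \<psi>_def)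
      with d\<psi> u(2) show False by (auto simp: fun_eq_iff)
    qed
    \<comment> \<open>Together with \<open>U\<close>, the orbit of \<open>d\<close> spans an
      invariant subspace that contains the infinite-orbit vector \<open>d\<close>; by minimality it
      is all of \<open>D\<close>, and passing to coordinates modulo \<open>U\<close> shows that the
      orbit of \<open>u\<close> spans.\<close>
    define Q where "Q = U \<union> (\<lambda>g. act g d) ` carrier G"
    have QD: "Q \<subseteq> D" using actD dD by (auto simp: Q_def U_def)
    have "span Q = D"
    proof (rule D_eq)
      show QsubD: "span Q \<subseteq> D" using QD subD by (rule span_minimal)
      have "act g y \<in> span Q" if g: "g \<in> carrier G" and y: "y \<in> span Q" for g y
        using y lin[OF g]
      proof (rule linear_maps_span)
        fix q assume "q \<in> Q"
        then consider "q \<in> U" | h where "h \<in> carrier G" "q = act h d" by (auto simp: Q_def)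
        then have "act g q \<in> Q"
        proof cases
          case 1
          then show ?thesis using actU[OF g] by (auto simp: Q_def)
        next
          case 2
          then have "act g q = act (g \<otimes> h) d" using g by (simp add: act_mult)
          with 2 g show ?thesis by (auto simp: Q_def)
        qed
        then show "act g q \<in> span Q" by (rule span_base)
      qed
      then show "invariant (span Q)" using QsubD DC by (auto simp: invariant_def)
      have "act \<one> d \<in> Q" by (auto simp: Q_def)
      then have "d \<in> span Q" by (simp add: act_one span_base)
      then show "\<not> span Q \<subseteq> Fin" using \<open>d \<notin> U\<close> dD by (auto simp: U_def)
    qed
    have claim: "y \<in> D \<and> \<psi> y \<in> vec.span ((\<lambda>g. mat_vec I (\<sigma> g) u) ` carrier G)" if "y \<in> span Q" for y
      using that
    proof (induction rule: span_induct_alt)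
      case base
      have "\<psi> 0 = 0" using rep_U[OF subspace_0[OF subU]] by (auto simp: \<psi>_def)
      then have "\<psi> 0 \<in> vec.span ((\<lambda>g. mat_vec I (\<sigma> g) u) ` carrier G)"
        using vec.span_zero by (simp only:)
      with subspace_0[OF subD] show ?case ..
    next
      case (step c q y)
      then have yD: "y \<in> D" and qD: "q \<in> D"
        and \<psi>y: "\<psi> y \<in> vec.span ((\<lambda>g. mat_vec I (\<sigma> g) u) ` carrier G)" using QD by auto
      have eq: "\<psi> (scale c q + y) = vec_scale c (\<psi> q) + \<psi> y"
        by (auto simp: \<psi>_def rep_add rep_scale subspace_scale[OF subD qD] yD qD)
      have "\<psi> q \<in> vec.span ((\<lambda>g. mat_vec I (\<sigma> g) u) ` carrier G)"
      proof (cases "q \<in> U")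
        case True
        then have "\<psi> q = 0" using rep_U by (auto simp: \<psi>_def)
        then show ?thesis using vec.span_zero by (simp only:)
      next
        case False
        then obtain g where g: "g \<in> carrier G" "q = act g d" using step by (auto simp: Q_def)
        have "rep d k = u k" if "k \<in> I" for k
          using fun_cong[OF d\<psi>, of k] that by (simp add: \<psi>_def)
        then have "\<psi> q = mat_vec I (\<sigma> g) u"
          using mult_vec[OF g(1) dD] unfolding g(2) by (simp add: \<psi>_def mat_vec_def fun_eq_iff)
        then show ?thesis using g(1) by (intro vec.span_base) auto
      qed
      then have "\<psi> (scale c q + y) \<in> vec.span ((\<lambda>g. mat_vec I (\<sigma> g) u) ` carrier G)"
        unfolding eq using \<psi>y by (intro vec.span_add vec.span_scale)
      moreover have "scale c q + y \<in> D" using yD qD by (intro subspace_add subspace_scale subD)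
      ultimately show ?case by blast
    qed
    have "(\<Sum>i\<in>I. scale (v i) i) \<in> span Q"
      unfolding \<open>span Q = D\<close> by (intro subspace_sum subspace_scale subD ID)
    from conjunct2[OF claim[OF this]]
    show "v \<in> vec.span ((\<lambda>g. mat_vec I (\<sigma> g) u) ` carrier G)"
      unfolding \<psi>_comb[OF v] .
  qed
  have "finite ((\<lambda>g. \<Sum>i\<in>I. \<sigma> g i i) ` carrier G)"
  proof (rule finite_traces[OF fg ocn char])
    fix g assume g: "g \<in> carrier G"
    show "frobenius_periodic (\<Sum>i\<in>I. \<sigma> g i i)"
      by (rule frobenius_periodic_trace[OF char finI], rule frobenius_periodic_eigenvalue[OF fg ocn char g])
  qed
  then have finite_\<sigma>: "finite ((\<lambda>g. \<sigma> g i j) ` carrier G)" if "i \<in> I" "j \<in> I" for i j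
    using finite_irreducible_representation[OF matrix_representation_axioms irreducible] that by blast
  obtain S where S: "finite S" "S \<subseteq> carrier G"
    and gen: "\<And>P x. x \<in> carrier G \<Longrightarrow> P \<one> \<Longrightarrow> (\<And>s. s \<in> S \<Longrightarrow> P s) \<Longrightarrow>
      (\<And>x y. x \<in> carrier G \<Longrightarrow> y \<in> carrier G \<Longrightarrow> P x \<Longrightarrow> P y \<Longrightarrow> P (x \<otimes> y)) \<Longrightarrow> P x"
    using generating_set_closed_under_inverse[OF fg] by blast
  define u where "u g l = rem (act g l)" for g l
  have uU: "u g l \<in> U" if "g \<in> carrier G" "l \<in> I" for g l
    unfolding u_def using that by (intro rem_U actD ID)
  have act_u: "act g l = (\<Sum>i\<in>I. scale (\<sigma> g i l) i) + u g l" for g l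
    unfolding u_def \<sigma>_def by (rule decomp)
  \<comment> \<open>The first factors are finite in number by \<open>finite_\<sigma>\<close>, the
    second because each \<open>u s l\<close> has a finite orbit. By linearity the group moves only
    the second factor, which makes the additive hull invariant.\<close>
  define Q where "Q = (\<lambda>(c, y). scale c y) `
    ((\<Union>l\<in>I. \<Union>j\<in>I. (\<lambda>k. \<sigma> k l j) ` carrier G) \<times> (\<Union>s\<in>S. \<Union>l\<in>I. (\<lambda>h. act h (u s l)) ` carrier G))"
  define Z where "Z = add_hull Q"
  have "finite ((\<lambda>h. act h (u s l)) ` carrier G)" if "s \<in> S" "l \<in> I" for s l
    using uU[of s l] that S(2) by (auto simp: U_def Fin_def)
  then have "finite (\<Union>s\<in>S. \<Union>l\<in>I. (\<lambda>h. act h (u s l)) ` carrier G)"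
    using finI S(1) by (intro finite_UN_I)
  moreover have "finite (\<Union>l\<in>I. \<Union>j\<in>I. (\<lambda>k. \<sigma> k l j) ` carrier G)"
    using finI finite_\<sigma> by (intro finite_UN_I)
  ultimately have "finite Q"
    unfolding Q_def by (rule finite_imageI[OF finite_cartesian_product[rotated]])
  then have finZ: "finite Z" unfolding Z_def using char by (rule finite_add_hull)
  have actZ: "act g z \<in> Z" if g: "g \<in> carrier G" and z: "z \<in> Z" for g z
    unfolding Z_def
  proof (rule add_hull_image[OF z[unfolded Z_def]])
    fix q assume "q \<in> Q"
    then obtain k l j h s m where q: "k \<in> carrier G" "l \<in> I" "j \<in> I" "h \<in> carrier G" "s \<in> S" "m \<in> I"
      "q = scale (\<sigma> k l j) (act h (u s m))" by (auto simp: Q_def)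
    have "act g q = scale (\<sigma> k l j) (act (g \<otimes> h) (u s m))"
      using g q by (simp add: act_scale act_mult)
    also have "\<dots> \<in> Q" unfolding Q_def using g q
      by (intro image_eqI[of _ _ "(\<sigma> k l j, act (g \<otimes> h) (u s m))"]) auto
    finally show "act g q \<in> add_hull Q" by (rule add_hull_base)
  qed (rule act_add[OF g])
  have cocycle: "u (g \<otimes> h) l = (\<Sum>i\<in>I. scale (\<sigma> h i l) (u g i)) + act g (u h l)"
    if gh: "g \<in> carrier G" "h \<in> carrier G" and l: "l \<in> I" for g h l
  proof -
    have "act (g \<otimes> h) l = act g ((\<Sum>i\<in>I. scale (\<sigma> h i l) i) + u h l)"
      using act_u[of h l] gh by (simp add: act_mult)
    also have "\<dots> = (\<Sum>i\<in>I. scale (\<sigma> h i l) (act g i)) + act g (u h l)"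
      by (simp add: act_add[OF gh(1)] act_sum[OF gh(1)] act_scale[OF gh(1)])
    also have "(\<Sum>i\<in>I. scale (\<sigma> h i l) (act g i)) =
        (\<Sum>i\<in>I. scale (\<sigma> h i l) (\<Sum>m\<in>I. scale (\<sigma> g m i) m)) + (\<Sum>i\<in>I. scale (\<sigma> h i l) (u g i))"
      unfolding sum.distrib[symmetric] scale_right_distrib[symmetric] act_u[symmetric] ..
    also have "(\<Sum>i\<in>I. scale (\<sigma> h i l) (\<Sum>m\<in>I. scale (\<sigma> g m i) m)) =
        (\<Sum>m\<in>I. scale (\<sigma> (g \<otimes> h) m l) m)"
    proof -
      have "(\<Sum>i\<in>I. scale (\<sigma> h i l) (\<Sum>m\<in>I. scale (\<sigma> g m i) m)) =
          (\<Sum>i\<in>I. \<Sum>m\<in>I. scale (\<sigma> g m i * \<sigma> h i l) m)"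
        by (simp add: scale_sum_right mult.commute)
      also have "\<dots> = (\<Sum>m\<in>I. \<Sum>i\<in>I. scale (\<sigma> g m i * \<sigma> h i l) m)" by (rule sum.swap)
      also have "\<dots> = (\<Sum>m\<in>I. scale (\<sigma> (g \<otimes> h) m l) m)"
        using gh l by (simp add: \<sigma>_mult scale_sum_left)
      finally show ?thesis .
    qed
    finally show ?thesis using act_u[of "g \<otimes> h" l] by (simp add: add.assoc)
  qed
  \<comment> \<open>The cocycle identity multiplies \<open>u g\<close> by entries of
    \<open>\<sigma> h\<close>, and \<open>Z\<close> need not be stable under such scalars. The claim
    is therefore made for all twists by \<open>k\<close> at once; the product step then only
    replaces \<open>k\<close> by \<open>h \<otimes> k\<close>.\<close>
  have uZ: "\<forall>k\<in>carrier G. \<forall>j\<in>I. (\<Sum>l\<in>I. scale (\<sigma> k l j) (u g l)) \<in> Z" if "g \<in> carrier G" for g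
    using that
  proof (rule gen)
    have "u \<one> l = 0" if "l \<in> I" for l
      using act_u[of \<one> l] that finI by (simp add: act_one \<sigma>_one if_distrib[of "\<lambda>c. scale c _"] cong: if_cong)
    then show "\<forall>k\<in>carrier G. \<forall>j\<in>I. (\<Sum>l\<in>I. scale (\<sigma> k l j) (u \<one> l)) \<in> Z"
      by (simp add: Z_def add_hull.zero)
  next
    fix s assume s: "s \<in> S"
    have "scale (\<sigma> k l j) (u s l) \<in> Q" if "k \<in> carrier G" "j \<in> I" "l \<in> I" for k j l
      unfolding Q_def
    proof (rule image_eqI[of _ _ "(\<sigma> k l j, act \<one> (u s l))"])
      show "(\<sigma> k l j, act \<one> (u s l)) \<in> (\<Union>l\<in>I. \<Union>j\<in>I. (\<lambda>k. \<sigma> k l j) ` carrier G) \<times>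
        (\<Union>s\<in>S. \<Union>l\<in>I. (\<lambda>h. act h (u s l)) ` carrier G)" using that s by blast
    qed (simp add: act_one)
    then show "\<forall>k\<in>carrier G. \<forall>j\<in>I. (\<Sum>l\<in>I. scale (\<sigma> k l j) (u s l)) \<in> Z"
      unfolding Z_def by (intro ballI add_hull_sum add_hull_base)
  next
    fix g h
    assume gh: "g \<in> carrier G" "h \<in> carrier G"
      and IHg: "\<forall>k\<in>carrier G. \<forall>j\<in>I. (\<Sum>l\<in>I. scale (\<sigma> k l j) (u g l)) \<in> Z"
      and IHh: "\<forall>k\<in>carrier G. \<forall>j\<in>I. (\<Sum>l\<in>I. scale (\<sigma> k l j) (u h l)) \<in> Z"
    show "\<forall>k\<in>carrier G. \<forall>j\<in>I. (\<Sum>l\<in>I. scale (\<sigma> k l j) (u (g \<otimes> h) l)) \<in> Z"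
    proof (intro ballI)
      fix k j assume kj: "k \<in> carrier G" "j \<in> I"
      have "(\<Sum>l\<in>I. scale (\<sigma> k l j) (u (g \<otimes> h) l)) =
          (\<Sum>l\<in>I. scale (\<sigma> k l j) (\<Sum>i\<in>I. scale (\<sigma> h i l) (u g i))) +
          (\<Sum>l\<in>I. scale (\<sigma> k l j) (act g (u h l)))"
        using cocycle[OF gh] by (simp add: scale_right_distrib sum.distrib)
      also have "(\<Sum>l\<in>I. scale (\<sigma> k l j) (act g (u h l))) = act g (\<Sum>l\<in>I. scale (\<sigma> k l j) (u h l))"
        by (simp add: act_sum[OF gh(1)] act_scale[OF gh(1)])
      also have "(\<Sum>l\<in>I. scale (\<sigma> k l j) (\<Sum>i\<in>I. scale (\<sigma> h i l) (u g i))) =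
          (\<Sum>l\<in>I. \<Sum>i\<in>I. scale (\<sigma> h i l * \<sigma> k l j) (u g i))"
        by (simp add: scale_sum_right mult.commute)
      also have "\<dots> = (\<Sum>i\<in>I. \<Sum>l\<in>I. scale (\<sigma> h i l * \<sigma> k l j) (u g i))" by (rule sum.swap)
      also have "\<dots> = (\<Sum>i\<in>I. scale (\<sigma> (h \<otimes> k) i j) (u g i))"
        using gh kj by (simp add: \<sigma>_mult scale_sum_left)
      finally have eq: "(\<Sum>l\<in>I. scale (\<sigma> k l j) (u (g \<otimes> h) l)) =
        (\<Sum>i\<in>I. scale (\<sigma> (h \<otimes> k) i j) (u g i)) + act g (\<Sum>l\<in>I. scale (\<sigma> k l j) (u h l))" .
      show "(\<Sum>l\<in>I. scale (\<sigma> k l j) (u (g \<otimes> h) l)) \<in> Z"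
        unfolding eq using IHg IHh gh kj actZ unfolding Z_def by (intro add_hull_add) auto
    qed
  qed
  have "I \<subseteq> Fin"
  proof
    fix j assume j: "j \<in> I"
    have "u g j \<in> Z" if g: "g \<in> carrier G" for g
    proof -
      have "(\<Sum>l\<in>I. scale (\<sigma> \<one> l j) (u g l)) = u g j"
        using j finI by (simp add: \<sigma>_one if_distrib[of "\<lambda>c. scale c _"] cong: if_cong)
      then show ?thesis using uZ[OF g] j by (metis one_closed)
    qed
    then have "(\<lambda>g. u g j) ` carrier G \<subseteq> Z" by blast
    then have 1: "finite ((\<lambda>g. u g j) ` carrier G)" using finZ by (rule finite_subset)
    have "(\<lambda>g. \<lambda>i\<in>I. \<sigma> g i j) ` carrier G \<subseteq> (\<Pi>\<^sub>E i\<in>I. (\<lambda>g. \<sigma> g i j) ` carrier G)"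
      unfolding image_subset_iff restrict_PiE_iff by auto
    moreover have "finite (\<Pi>\<^sub>E i\<in>I. (\<lambda>g. \<sigma> g i j) ` carrier G)"
      using finI finite_\<sigma> j by (intro finite_PiE) auto
    ultimately have "finite ((\<lambda>g. \<lambda>i\<in>I. \<sigma> g i j) ` carrier G)" by (rule finite_subset)
    from finite_range_combination[OF this 1]
    have "finite ((\<lambda>g. (\<Sum>i\<in>I. scale ((\<lambda>i\<in>I. \<sigma> g i j) i) i) + u g j) ` carrier G)" .
    then have "finite ((\<lambda>g. act g j) ` carrier G)"
      by (rule finite_range_reindex[where h = "\<lambda>g. g"]) (auto simp: act_u[of _ j])
    then show "j \<in> Fin" by (simp add: Fin_def)
  qed
  moreover have "BU \<subseteq> Fin" using BU(1) by (auto simp: U_def)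
  ultimately have "BD \<subseteq> Fin" by (auto simp: I_def)
  then have "D \<subseteq> Fin" using span_minimal[OF _ subFin] spanBD by blast
  with D(2) show False by simp
qed

section \<open>Translates of the matrix coefficients of the given representation\<close>

theorem theorem6p6:
  fixes \<Gamma> :: "('a, 'b) monoid_scheme"
    and scale :: "'k::field \<Rightarrow> 'v::ab_group_add \<Rightarrow> 'v"
    and Basis :: "'v set"
    and \<rho> :: "'a \<Rightarrow> 'v \<Rightarrow> 'v"
  assumes "finitely_generated_group \<Gamma>"
    and "outer_commensurator_normalizer \<Gamma>"
    and "CHAR('k) > 0"
    and "finite_dimensional_vector_space scale Basis"
    and "\<rho> \<in> hom \<Gamma> (general_linear_group scale)"
  shows "finite (\<rho> ` carrier \<Gamma>)"
proof -
  interpret G: group \<Gamma> using assms(1) by (simp add: finitely_generated_group_def)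
  interpret V: finite_dimensional_vector_space scale Basis by fact
  have lin: "Vector_Spaces.linear scale scale (\<rho> g)" if "g \<in> carrier \<Gamma>" for g
    using assms(5) that by (auto simp: hom_def general_linear_group_def)
  have mult: "\<rho> (g \<otimes>\<^bsub>\<Gamma>\<^esub> h) v = \<rho> g (\<rho> h v)" if "g \<in> carrier \<Gamma>" "h \<in> carrier \<Gamma>" for g h v
    using assms(5) that by (auto simp: hom_def general_linear_group_def)
  have one: "\<rho> \<one>\<^bsub>\<Gamma>\<^esub> v = v" for v
  proof -
    have "\<rho> \<one>\<^bsub>\<Gamma>\<^esub> (\<rho> \<one>\<^bsub>\<Gamma>\<^esub> v) = \<rho> \<one>\<^bsub>\<Gamma>\<^esub> v" using mult[of "\<one>\<^bsub>\<Gamma>\<^esub>" "\<one>\<^bsub>\<Gamma>\<^esub>" v] by simp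
    moreover have "inj (\<rho> \<one>\<^bsub>\<Gamma>\<^esub>)"
      using assms(5) by (auto simp: hom_def general_linear_group_def bij_def)
    ultimately show ?thesis by (simp add: inj_eq)
  qed
  define coord where "coord v b = V.representation Basis v b" for v b
  have span: "V.span Basis = UNIV" by (rule V.span_Basis)
  have coord_sum: "(\<Sum>b\<in>Basis. scale (coord v b) b) = v" for v
    using V.sum_representation_eq[OF V.independent_Basis _ V.finite_Basis subset_refl, of v]
    by (simp add: coord_def span)
  have coord_lin: "coord (\<rho> g v) b = (\<Sum>b'\<in>Basis. coord v b' * coord (\<rho> g b') b)"
    if g: "g \<in> carrier \<Gamma>" for g v b
  proof -
    interpret g: Vector_Spaces.linear scale scale "\<rho> g" by (rule lin[OF g])
    have "\<rho> g v = \<rho> g (\<Sum>b'\<in>Basis. scale (coord v b') b')" by (simp add: coord_sum)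
    also have "\<dots> = (\<Sum>b'\<in>Basis. scale (coord v b') (\<rho> g b'))" by (simp add: g.sum g.scale)
    finally show ?thesis
      unfolding coord_def
      by (simp add: V.representation_sum[OF V.independent_Basis] V.representation_scale[OF V.independent_Basis] span)
  qed
  \<comment> \<open>Right translation by \<open>h\<close> turns \<open>c b v\<close> into
    \<open>c b (\<rho> h v)\<close>, so the finitely many coefficients at basis vectors span an
    invariant space.\<close>
  define c where "c b v = (\<lambda>g. if g \<in> carrier \<Gamma> then to_ac (coord (\<rho> g v) b) else 0)" for b v
  \<comment> \<open>Off the carrier the function is left unchanged, so that translation by
    \<open>\<one>\<close> is the identity on all functions, not only on those vanishing
    there.\<close>
  define R where "R h f = (\<lambda>g. if g \<in> carrier \<Gamma> then f (g \<otimes>\<^bsub>\<Gamma>\<^esub> h) else f g)"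
    for h and f :: "'a \<Rightarrow> 'k alg_closure"
  define C where "C = (\<lambda>(b, b'). c b b') ` (Basis \<times> Basis)"
  have c_span: "c b v \<in> vec.span C" if b: "b \<in> Basis" for b v
  proof -
    have "c b v = (\<Sum>b'\<in>Basis. vec_scale (to_ac (coord v b')) (c b b'))"
    proof
      fix g
      show "c b v g = (\<Sum>b'\<in>Basis. vec_scale (to_ac (coord v b')) (c b b')) g"
        unfolding sum_fun_apply by (auto simp: c_def coord_lin[of g v] to_ac_sum)
    qed
    also have "\<dots> \<in> vec.span C"
      using b by (intro vec.span_sum vec.span_scale vec.span_base) (auto simp: C_def)
    finally show ?thesis .
  qed
  have orbit: "finite ((\<lambda>h. R h (c b b')) ` carrier \<Gamma>)" if b: "b \<in> Basis" "b' \<in> Basis" for b b'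
  proof (rule finite_orbits[where scale = vec_scale and C = C])
    show "vector_space (vec_scale :: 'k alg_closure \<Rightarrow> ('a \<Rightarrow> _) \<Rightarrow> _)" by (rule vec.vector_space_axioms)
    show "CHAR('k alg_closure) > 0" using assms(3) by simp
    show "Vector_Spaces.linear vec_scale vec_scale (R g)" for g
      using vec.vector_space_axioms by (auto simp: Vector_Spaces.linear_iff R_def)
    show "R \<one>\<^bsub>\<Gamma>\<^esub> f = f" for f by (auto simp: R_def)
    show "R (g \<otimes>\<^bsub>\<Gamma>\<^esub> h) f = R g (R h f)" if "g \<in> carrier \<Gamma>" "h \<in> carrier \<Gamma>" for g h f
      using that by (auto simp: R_def G.m_assoc)
    show "finite C" using V.finite_Basis by (simp add: C_def)
    show "c b b' \<in> vec.span C" using c_span b by blast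
    fix g f assume g: "g \<in> carrier \<Gamma>" and "f \<in> C"
    then obtain b b' where f: "b \<in> Basis" "f = c b b'" by (auto simp: C_def)
    have "R g f = c b (\<rho> g b')" using g by (auto simp: R_def c_def f(2) mult)
    then show "R g f \<in> vec.span C" using c_span[OF f(1)] by (simp only:)
  qed (use assms(1,2) in auto)
  \<comment> \<open>Evaluating the translate by \<open>h\<close> at \<open>\<one>\<close> recovers
    the matrix entry at \<open>h\<close>, so an entry takes at most as many values as its
    coefficient function has translates.\<close>
  have entries: "finite ((\<lambda>h. coord (\<rho> h b') b) ` carrier \<Gamma>)" if "b \<in> Basis" "b' \<in> Basis" for b b'
  proof (rule finite_image_factor[OF orbit[OF that]])
    fix g h assume gh: "g \<in> carrier \<Gamma>" "h \<in> carrier \<Gamma>" "R g (c b b') = R h (c b b')"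
    then have "R g (c b b') \<one>\<^bsub>\<Gamma>\<^esub> = R h (c b b') \<one>\<^bsub>\<Gamma>\<^esub>" by simp
    then show "coord (\<rho> g b') b = coord (\<rho> h b') b" using gh by (simp add: R_def c_def)
  qed
  let ?F = "\<lambda>g. \<lambda>(b, b')\<in>Basis \<times> Basis. coord (\<rho> g b') b"
  have "?F ` carrier \<Gamma> \<subseteq>
      (\<Pi>\<^sub>E (b, b')\<in>Basis \<times> Basis. (\<lambda>h. coord (\<rho> h b') b) ` carrier \<Gamma>)"
    unfolding image_subset_iff restrict_PiE_iff by auto
  moreover have "finite (\<Pi>\<^sub>E (b, b')\<in>Basis \<times> Basis. (\<lambda>h. coord (\<rho> h b') b) ` carrier \<Gamma>)"
    using V.finite_Basis entries by (intro finite_PiE) auto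
  ultimately have "finite (?F ` carrier \<Gamma>)" by (rule finite_subset)
  then show ?thesis
  proof (rule finite_image_factor)
    fix g h assume gh: "g \<in> carrier \<Gamma>" "h \<in> carrier \<Gamma>" "?F g = ?F h"
    have basis: "coord (\<rho> g b') b = coord (\<rho> h b') b" if "b \<in> Basis" "b' \<in> Basis" for b b'
      using fun_cong[OF gh(3), of "(b, b')"] that by simp
    have "coord (\<rho> g v) b = coord (\<rho> h v) b" if "b \<in> Basis" for v b
      unfolding coord_lin[OF gh(1), of v b] coord_lin[OF gh(2), of v b]
      using basis that by (intro sum.cong) simp_all
    then have "(\<Sum>b\<in>Basis. scale (coord (\<rho> g v) b) b) = (\<Sum>b\<in>Basis. scale (coord (\<rho> h v) b) b)" for v
      by (intro sum.cong) simp_all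
    then have "\<rho> g v = \<rho> h v" for v unfolding coord_sum .
    then show "\<rho> g = \<rho> h" by blast
  qed
qed

end
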